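(* (Formal unfoldings.) (a) Let $v(\xi;\lambda)$ be a smooth family of vector fields on a neighborhood of $0\in\mathbb{R}^3$, $\xi=(x,y,z)^T$, depending on parameters $\lambda$ near $0$, each divergence free, such that $v(\cdot;0)$ satisfies $v(0;0)=0$ and $D_\xi v(0;0)=N$. Then, up to terms of arbitrary degree in $(\xi,\lambda)$, a parameter-dependent volume-preserving near-identity change of coordinates brings the family into the form $$\dot\xi=N\xi+\hat e_3\big(\epsilon+\mu_1x+\mu_2y+p(x,y;\epsilon,\mu_1,\mu_2)\big),$$ where $\epsilon,\mu_1,\mu_2$ are unfolding parameters (depending on $\lambda$ and vanishing at $\lambda=0$) and the lowest order terms of $p$ in $(x,y)$ are quadratic. (b) Analogously, a smooth family of volume-preserving diffeomorphisms $f(\cdot;\lambda)$ with $f(0;0)=0$, $D_\xi f(0;0)=J=\mathbb{I}+N$ can, up to terms of arbitrary degree, be put by parameter-dependent volume-preserving near-identity coordinate changes into the form $$g(\xi)=J\Big(\xi+\hat e_3\big(\epsilon+\mu_1x+\mu_2y+p(x,y;\epsilon,\mu_1,\mu_2)\big)\Big),$$ with the lowest order terms of $p$ in $(x,y)$ quadratic.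
   Context: $N$ is the $3\times3$ matrix with $N_{12}=N_{23}=1$ and all other entries $0$; $\mathbb{I}$ is the $3\times3$ identity; $\hat e_3=(0,0,1)^T$.
   Formalization: The coefficients of p may depend on the parameters λ and not only through ε, μ₁, μ₂; the literal form fails, e.g. for v = Nξ + ê₃λx², where ε, μ₁, μ₂ are O(λ²) while the x² coefficient is λ + O(λ²). *)

theory Defs
  imports "HOL-Analysis.Analysis"
begin

text \<open>C-infinity smoothness on an open set S: f has a family of iterated partial
derivatives D ds (ds a list of basis directions), D [] = f on S, and every D ds is
Frechet differentiable at each point of S with partial derivative along i equal to
D (i # ds).\<close>
definition smooth_on :: "'a::euclidean_space set \<Rightarrow> ('a \<Rightarrow> 'b::real_normed_vector) \<Rightarrow> bool" where
  "smooth_on S f \<longleftrightarrow> open S \<and>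
     (\<exists>D :: 'a list \<Rightarrow> 'a \<Rightarrow> 'b.
        (\<forall>x\<in>S. D [] x = f x) \<and>
        (\<forall>ds x. set ds \<subseteq> Basis \<longrightarrow> x \<in> S \<longrightarrow>
           (D ds has_derivative (\<lambda>h. \<Sum>i\<in>Basis. (h \<bullet> i) *\<^sub>R D (i # ds) x)) (at x)))"

definition N3 :: "real^3^3" where
  "N3 = (\<chi> i j. if (i = 1 \<and> j = 2) \<or> (i = 2 \<and> j = 3) then 1 else 0)"

definition e3 :: "real^3" where
  "e3 = vector [0, 0, 1]"

end

(*
  Straightening.  A function X yields coordinates in which the field F reads (y, z, a) by taking
  Psi = (X, L X, L^2 X) with L the Lie derivative along F; for a map f one takes
  Psi = (S X, D S X, D^2 X) with S u = u o f and D = S - 1.  If Psi preserves volume, then so does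
  the transformed system, which forces a to be independent of z: this is the normal form.

  So everything rests on solving det(grad Psi) = 1 to arbitrarily high order.  Its linearisation at
  the nilpotent part is T h = d_x S h + d_y D S h + d_z D^2 h, and commuting derivatives past D
  gives T (D^n u) = c_n D^n (d_x u) + D^(n+1) (...) with c_n > 0.  As D is nilpotent on each
  order of vanishing, a descending induction on n shows that T is surjective.

  The exactly volume-preserving transformation is A o Psi^(-1) with A = (x, y, integral_0^z J),
  J = det(grad Psi): both factors have the same Jacobian J, and A is the identity up to the order
  to which J = 1.  Likewise d_z a is a multiple of det(grad Psi1, grad Psi2, grad D Psi3), which
  equals D J and hence vanishes to high order.
*)
theory Submission
  imports Defs
begin

subsection \<open>Smooth functions\<close>

text \<open>The family is read as one object on states and parameters together: a field with zero
  parameter velocity, or a map fixing the parameters. Degree in (\<xi>, \<lambda>) is then the order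
  of vanishing of a single function at a single point, and no fixed point has to persist for other
  parameters.

  The triple of components is dictated by the target. For the map J (\<xi> + c e3) the coordinate
  functions satisfy D x = y, D y = z + c and D z = c, that is, D y = S z. As D and S commute, (S X,
  D S X, D^2 X) obeys D u = v and D v = S w for every X, so one scalar unknown is left for one
  scalar equation.

  Why c_n > 0: to leading order d_x commutes with D, while the commutators of d_y and d_z with D are
  S d_x and S d_y, both with coefficient +1. Contributions D^n (d_x u) can therefore only add up;
  the total is c_n = (n + 2) (n + 3) / 2. The same commutators lower the direction of
  differentiation by a nilpotent matrix, which is why D is nilpotent on each order of vanishing.

  The theorem asks for determinant exactly 1, whereas only a jet of the volume equation is solved;
  hence the correction A, whose own error is of the order that may be neglected.\<close>

definition pd :: "'a::euclidean_space \<Rightarrow> ('a \<Rightarrow> real) \<Rightarrow> 'a \<Rightarrow> real" where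
  "pd v f z = frechet_derivative f (at z) v"

lemma pd_eq: "(f has_derivative f') (at z) \<Longrightarrow> pd v f z = f' v"
  unfolding pd_def by (metis frechet_derivative_at)

lemma smooth_on_open: "smooth_on S f \<Longrightarrow> open S"
  by (simp add: smooth_on_def)

text \<open>Choosing partial derivatives inside \<open>A\<close> for every member of
  \<open>A\<close> and iterating the choice along a list yields the whole family required by
  \<open>smooth_on\<close>. Smoothness proofs thus reduce to finding a class closed under partial
  derivatives.\<close>

lemma smooth_on_coinduct:
  fixes f :: "'a::euclidean_space \<Rightarrow> 'b::real_normed_vector"
  assumes "open S" "f \<in> A"
    and step: "\<And>g. g \<in> A \<Longrightarrow> \<exists>g'. (\<forall>i\<in>Basis. g' i \<in> A) \<and>
       (\<forall>x\<in>S. (g has_derivative (\<lambda>h. \<Sum>i\<in>Basis. (h \<bullet> i) *\<^sub>R g' i x)) (at x))"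
  shows "smooth_on S f"
proof -
  define P where "P g g' \<longleftrightarrow> (\<forall>i\<in>Basis. g' i \<in> A) \<and>
    (\<forall>x\<in>S. (g has_derivative (\<lambda>h. \<Sum>i\<in>Basis. (h \<bullet> i) *\<^sub>R g' i x)) (at x))" for g g'
  have "\<forall>g\<in>A. \<exists>g'. P g g'" using step unfolding P_def by simp
  then obtain st where "\<forall>g\<in>A. P g (st g)" by (rule bchoice[THEN exE])
  then have st: "\<And>g i. g \<in> A \<Longrightarrow> i \<in> Basis \<Longrightarrow> st g i \<in> A"
    "\<And>g x. g \<in> A \<Longrightarrow> x \<in> S \<Longrightarrow> (g has_derivative (\<lambda>h. \<Sum>i\<in>Basis. (h \<bullet> i) *\<^sub>R st g i x)) (at x)"
    unfolding P_def by simp_all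
  define D where "D ds = foldr (\<lambda>i g. st g i) ds f" for ds
  have DA: "set ds \<subseteq> Basis \<Longrightarrow> D ds \<in> A" for ds
    by (induction ds) (auto simp: D_def st \<open>f \<in> A\<close>)
  have "D [] = f" "\<And>i ds. D (i # ds) = st (D ds) i" by (simp_all add: D_def)
  then show ?thesis
    unfolding smooth_on_def using \<open>open S\<close> st(2) DA by (intro conjI exI[of _ D]) auto
qed

lemma smooth_onE:
  fixes f :: "'a::euclidean_space \<Rightarrow> 'b::real_normed_vector"
  assumes "smooth_on S f"
  obtains D where "open S" "\<And>x. x \<in> S \<Longrightarrow> D [] x = f x"
    "\<And>ds x. set ds \<subseteq> Basis \<Longrightarrow> x \<in> S \<Longrightarrow>
       (D ds has_derivative (\<lambda>h. \<Sum>i\<in>Basis. (h \<bullet> i) *\<^sub>R D (i # ds) x)) (at x)"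
  using assms unfolding smooth_on_def by blast

lemma smooth_on_cong:
  assumes "smooth_on S f" "\<And>x. x \<in> S \<Longrightarrow> f x = g x"
  shows "smooth_on S g"
  using assms unfolding smooth_on_def by auto

lemma smooth_on_subset:
  assumes "smooth_on S f" "open T" "T \<subseteq> S"
  shows "smooth_on T f"
  using assms unfolding smooth_on_def by blast

lemma smooth_on_derivative:
  fixes f :: "'a::euclidean_space \<Rightarrow> 'b::real_normed_vector"
  assumes "smooth_on S f"
  obtains f' where "\<And>x. x \<in> S \<Longrightarrow> (f has_derivative (\<lambda>h. \<Sum>i\<in>Basis. (h \<bullet> i) *\<^sub>R f' i x)) (at x)"
    "\<And>v. smooth_on S (\<lambda>x. \<Sum>i\<in>Basis. (v \<bullet> i) *\<^sub>R f' i x)"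
proof (rule smooth_onE[OF assms])
  fix D assume D: "open S" "\<And>x. x \<in> S \<Longrightarrow> D [] x = f x"
    "\<And>ds x. set ds \<subseteq> Basis \<Longrightarrow> x \<in> S \<Longrightarrow>
       (D ds has_derivative (\<lambda>h. \<Sum>i\<in>Basis. (h \<bullet> i) *\<^sub>R D (i # ds) x)) (at x)"
  show ?thesis
  proof (rule that[of "\<lambda>i. D [i]"])
    show "(f has_derivative (\<lambda>h. \<Sum>i\<in>Basis. (h \<bullet> i) *\<^sub>R D [i] x)) (at x)" if "x \<in> S" for x
      using has_derivative_transform_within_open[OF D(3)[of "[]" x] D(1) that] D(2) that by auto
    show "smooth_on S (\<lambda>x. \<Sum>i\<in>Basis. (v \<bullet> i) *\<^sub>R D [i] x)" for v
      unfolding smooth_on_def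
    \<comment> \<open>New directions enter a list at its head, so the iterated derivatives of the
      \<open>i\<close>-th partial derivative are those of \<open>f\<close> whose list ends in
      \<open>i\<close>.\<close>
    proof (intro conjI exI[of _ "\<lambda>ds x. \<Sum>i\<in>Basis. (v \<bullet> i) *\<^sub>R D (ds @ [i]) x"] allI impI)
      fix ds x assume ds: "set ds \<subseteq> (Basis::'a set)" and x: "x \<in> S"
      have "((\<lambda>x. \<Sum>i\<in>Basis. (v \<bullet> i) *\<^sub>R D (ds @ [i]) x) has_derivative
          (\<lambda>h. \<Sum>i\<in>Basis. (v \<bullet> i) *\<^sub>R (\<Sum>j\<in>Basis. (h \<bullet> j) *\<^sub>R D (j # (ds @ [i])) x))) (at x)"
        using ds x by (intro derivative_intros D(3)) auto
      moreover have "(\<Sum>i\<in>Basis. (v \<bullet> i) *\<^sub>R (\<Sum>j\<in>Basis. (h \<bullet> j) *\<^sub>R D (j # (ds @ [i])) x))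
         = (\<Sum>i\<in>Basis. (h \<bullet> i) *\<^sub>R (\<Sum>ia\<in>Basis. (v \<bullet> ia) *\<^sub>R D ((i # ds) @ [ia]) x))" for h
        unfolding scaleR_sum_right by (subst sum.swap) (simp add: mult.commute)
      ultimately show "((\<lambda>x. \<Sum>i\<in>Basis. (v \<bullet> i) *\<^sub>R D (ds @ [i]) x) has_derivative
        (\<lambda>h. \<Sum>i\<in>Basis. (h \<bullet> i) *\<^sub>R (\<Sum>ia\<in>Basis. (v \<bullet> ia) *\<^sub>R D ((i # ds) @ [ia]) x))) (at x)"
        by simp
    qed (use D in auto)
  qed
qed

lemma smooth_on_pd:
  assumes "smooth_on S f"
  shows "x \<in> S \<Longrightarrow> (f has_derivative (\<lambda>h. pd h f x)) (at x)" and "smooth_on S (pd v f)"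
proof -
  have "(\<forall>x\<in>S. (f has_derivative (\<lambda>h. pd h f x)) (at x)) \<and> smooth_on S (pd v f)"
  proof (rule smooth_on_derivative[OF assms])
  fix f' assume f': "\<And>x. x \<in> S \<Longrightarrow> (f has_derivative (\<lambda>h. \<Sum>i\<in>Basis. (h \<bullet> i) *\<^sub>R f' i x)) (at x)"
    "\<And>v. smooth_on S (\<lambda>x. \<Sum>i\<in>Basis. (v \<bullet> i) *\<^sub>R f' i x)"
  have "pd h f x = (\<Sum>i\<in>Basis. (h \<bullet> i) *\<^sub>R f' i x)" if "x \<in> S" for h x
    using f'(1)[OF that] by (rule pd_eq)
  then show "(\<forall>x\<in>S. (f has_derivative (\<lambda>h. pd h f x)) (at x)) \<and> smooth_on S (pd v f)"
    using f'(1) smooth_on_cong[OF f'(2)[of v]] by auto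
  qed
  then show "x \<in> S \<Longrightarrow> (f has_derivative (\<lambda>h. pd h f x)) (at x)" and "smooth_on S (pd v f)"
    by auto
qed

lemma has_derivative_pd: "f differentiable (at z) \<Longrightarrow> (f has_derivative (\<lambda>h. pd h f z)) (at z)"
  unfolding pd_def by (simp add: frechet_derivative_works)

lemma pd_linear: "f differentiable (at z) \<Longrightarrow> linear (\<lambda>v. pd v f z)"
  unfolding pd_def by (simp add: linear_frechet_derivative)

lemma pd_basis_sum:
  assumes "f differentiable (at z)"
  shows "pd v f z = (\<Sum>i\<in>Basis. (v \<bullet> i) * pd i f z)"
  using Linear_Algebra.linear_componentwise[OF pd_linear[OF assms], of v 1] by simp

lemma has_derivative_pd_sum:
  assumes "f differentiable (at z)"
  shows "(f has_derivative (\<lambda>h. \<Sum>i\<in>Basis. (h \<bullet> i) * pd i f z)) (at z)"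
  using has_derivative_pd[OF assms] by (rule has_derivative_eq_rhs) (intro ext pd_basis_sum assms)

lemma smooth_on_differentiable: "smooth_on S f \<Longrightarrow> z \<in> S \<Longrightarrow> f differentiable (at z)"
  for f :: "'a::euclidean_space \<Rightarrow> 'b::real_normed_vector"
  by (erule smooth_on_derivative, rule differentiableI, blast)

lemma smooth_on_continuous: "smooth_on S f \<Longrightarrow> continuous_on S f"
  for f :: "'a::euclidean_space \<Rightarrow> 'b::real_normed_vector"
  by (meson continuous_at_imp_continuous_on differentiable_imp_continuous_within smooth_on_differentiable)

section \<open>Closure properties of smooth functions\<close>

inductive_set alg :: "('a \<Rightarrow> real) set \<Rightarrow> ('a \<Rightarrow> real) set" for G where
  gen: "g \<in> G \<Longrightarrow> g \<in> alg G"
| const: "(\<lambda>_. c) \<in> alg G"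
| add: "f \<in> alg G \<Longrightarrow> g \<in> alg G \<Longrightarrow> (\<lambda>x. f x + g x) \<in> alg G"
| mult: "f \<in> alg G \<Longrightarrow> g \<in> alg G \<Longrightarrow> (\<lambda>x. f x * g x) \<in> alg G"

lemma alg_sum: "finite I \<Longrightarrow> (\<And>i. i \<in> I \<Longrightarrow> f i \<in> alg G) \<Longrightarrow> (\<lambda>x. \<Sum>i\<in>I. f i x) \<in> alg G"
  by (induction I rule: finite_induct) (auto intro: alg.intros)

text \<open>Sum and product rule express the derivatives of a polynomial in members of
  \<open>G\<close> as such polynomials again, provided this holds for the members of
  \<open>G\<close> themselves.\<close>

lemma smooth_on_alg:
  fixes f :: "'a::euclidean_space \<Rightarrow> real"
  assumes S: "open S" and f: "f \<in> alg G"
    and G: "\<And>g. g \<in> G \<Longrightarrow> \<exists>g'. (\<forall>i\<in>Basis. g' i \<in> alg G) \<and>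
       (\<forall>x\<in>S. (g has_derivative (\<lambda>h. \<Sum>i\<in>Basis. (h \<bullet> i) * g' i x)) (at x))"
  shows "smooth_on S f"
proof (rule smooth_on_coinduct[OF S f])
  fix g assume "g \<in> alg G"
  then show "\<exists>g'. (\<forall>i\<in>Basis. g' i \<in> alg G) \<and>
       (\<forall>x\<in>S. (g has_derivative (\<lambda>h. \<Sum>i\<in>Basis. (h \<bullet> i) *\<^sub>R g' i x)) (at x))"
  proof induction
    case (gen g) then show ?case using G by simp
  next
    case (const c) then show ?case by (intro exI[of _ "\<lambda>_ _. 0"]) (auto intro: alg.const)
  next
    case (add f g)
    then obtain f' g' where *: "\<forall>i\<in>Basis. f' i \<in> alg G" "\<forall>i\<in>Basis. g' i \<in> alg G"
      "\<And>x. x\<in>S \<Longrightarrow> (f has_derivative (\<lambda>h. \<Sum>i\<in>Basis. (h \<bullet> i) *\<^sub>R f' i x)) (at x)"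
      "\<And>x. x\<in>S \<Longrightarrow> (g has_derivative (\<lambda>h. \<Sum>i\<in>Basis. (h \<bullet> i) *\<^sub>R g' i x)) (at x)" by blast
    show ?case
    proof (intro exI[of _ "\<lambda>i x. f' i x + g' i x"] conjI ballI)
      fix x assume "x \<in> S"
      from has_derivative_add[OF *(3,4)[OF this]]
      show "((\<lambda>x. f x + g x) has_derivative (\<lambda>h. \<Sum>i\<in>Basis. (h \<bullet> i) *\<^sub>R (f' i x + g' i x))) (at x)"
        by (simp add: sum.distrib algebra_simps)
    qed (use * in \<open>auto intro: alg.add\<close>)
  next
    case (mult f g)
    then obtain f' g' where *: "\<forall>i\<in>Basis. f' i \<in> alg G" "\<forall>i\<in>Basis. g' i \<in> alg G"
      "\<And>x. x\<in>S \<Longrightarrow> (f has_derivative (\<lambda>h. \<Sum>i\<in>Basis. (h \<bullet> i) *\<^sub>R f' i x)) (at x)"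
      "\<And>x. x\<in>S \<Longrightarrow> (g has_derivative (\<lambda>h. \<Sum>i\<in>Basis. (h \<bullet> i) *\<^sub>R g' i x)) (at x)" by blast
    show ?case
    proof (intro exI[of _ "\<lambda>i x. f x * g' i x + f' i x * g x"] conjI ballI)
      fix x assume "x \<in> S"
      from has_derivative_mult[OF *(3,4)[OF this]]
      show "((\<lambda>x. f x * g x) has_derivative (\<lambda>h. \<Sum>i\<in>Basis. (h \<bullet> i) *\<^sub>R (f x * g' i x + f' i x * g x))) (at x)"
        by (simp add: sum.distrib sum_distrib_left sum_distrib_right algebra_simps)
    qed (use * mult.hyps in \<open>auto intro!: alg.add alg.mult\<close>)
  qed
qed

lemma smooth_on_pd_sum:
  assumes "smooth_on S f" "x \<in> S"
  shows "(f has_derivative (\<lambda>h. \<Sum>i\<in>Basis. (h \<bullet> i) * pd i f x)) (at x)"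
  by (rule has_derivative_pd_sum[OF smooth_on_differentiable[OF assms]])

text \<open>Tool for adding new functions \<open>G\<close> to the smooth ones: their derivatives may
  involve themselves and arbitrary smooth functions. Inverses and compositions are the two main
  instances.\<close>

lemma smooth_on_closed_family:
  fixes f :: "'a::euclidean_space \<Rightarrow> real"
  assumes S: "open S" and f: "f \<in> alg (G \<union> {g. smooth_on S g})"
    and G: "\<And>g. g \<in> G \<Longrightarrow> \<exists>g'. (\<forall>i\<in>Basis. g' i \<in> alg (G \<union> {g. smooth_on S g})) \<and>
       (\<forall>x\<in>S. (g has_derivative (\<lambda>h. \<Sum>i\<in>Basis. (h \<bullet> i) * g' i x)) (at x))"
  shows "smooth_on S f"
proof (rule smooth_on_alg[OF S f])
  fix g assume "g \<in> G \<union> {g. smooth_on S g}"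
  then show "\<exists>g'. (\<forall>i\<in>Basis. g' i \<in> alg (G \<union> {g. smooth_on S g})) \<and>
       (\<forall>x\<in>S. (g has_derivative (\<lambda>h. \<Sum>i\<in>Basis. (h \<bullet> i) * g' i x)) (at x))"
  proof
    assume "g \<in> {g. smooth_on S g}"
    then show ?thesis
      by (intro exI[of _ "\<lambda>i. pd i g"]) (auto intro!: alg.gen smooth_on_pd(2) smooth_on_pd_sum)
  qed (rule G)
qed

lemma smooth_on_const [simp]: "open S \<Longrightarrow> smooth_on S (\<lambda>_. c::real)"
  by (rule smooth_on_closed_family[where G = "{}"]) (auto intro: alg.intros)

lemma smooth_on_add: "smooth_on S f \<Longrightarrow> smooth_on S g \<Longrightarrow> smooth_on S (\<lambda>x. f x + g x :: real)"
  by (rule smooth_on_closed_family[where G = "{}"]) (auto intro: alg.intros simp: smooth_on_open)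

lemma smooth_on_mult: "smooth_on S f \<Longrightarrow> smooth_on S g \<Longrightarrow> smooth_on S (\<lambda>x. f x * g x :: real)"
  by (rule smooth_on_closed_family[where G = "{}"]) (auto intro: alg.intros simp: smooth_on_open)

lemma smooth_on_sum: "open S \<Longrightarrow> finite I \<Longrightarrow> (\<And>i. i \<in> I \<Longrightarrow> smooth_on S (f i)) \<Longrightarrow>
   smooth_on S (\<lambda>x. \<Sum>i\<in>I. f i x :: real)"
  by (rule smooth_on_closed_family[where G = "{}"]) (auto intro!: alg_sum intro: alg.intros)

lemma smooth_on_linear:
  fixes f :: "'a::euclidean_space \<Rightarrow> real"
  assumes "open S" "bounded_linear f"
  shows "smooth_on S f"
proof (rule smooth_on_closed_family[where G = "{f}"])
  interpret f: bounded_linear f by fact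
  have eq: "f h = (\<Sum>i\<in>Basis. (h \<bullet> i) * f i)" for h
    using f.sum[of "\<lambda>i. (h \<bullet> i) *\<^sub>R i" Basis] by (simp add: euclidean_representation f.scaleR)
  have "(f has_derivative (\<lambda>h. \<Sum>i\<in>Basis. (h \<bullet> i) * f i)) (at x)" for x
    using bounded_linear_imp_has_derivative[OF assms(2), of "at x"]
    by (rule has_derivative_eq_rhs) (intro ext eq)
  then show "g \<in> {f} \<Longrightarrow> \<exists>g'. (\<forall>i\<in>Basis. g' i \<in> alg ({f} \<union> {g. smooth_on S g})) \<and>
       (\<forall>x\<in>S. (g has_derivative (\<lambda>h. \<Sum>i\<in>Basis. (h \<bullet> i) * g' i x)) (at x))" for g
    by (intro exI[of _ "\<lambda>i _. f i"]) (auto intro: alg.intros)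
qed (use assms in \<open>auto intro: alg.intros\<close>)

lemma smooth_on_inverse:
  fixes f :: "'a::euclidean_space \<Rightarrow> real"
  assumes f: "smooth_on S f" and nz: "\<And>x. x \<in> S \<Longrightarrow> f x \<noteq> 0"
  shows "smooth_on S (\<lambda>x. inverse (f x))"
proof (rule smooth_on_closed_family[where G = "{\<lambda>x. inverse (f x)}"])
  let ?G = "{\<lambda>x. inverse (f x)} \<union> {g. smooth_on S g}"
  have "((\<lambda>x. inverse (f x)) has_derivative (\<lambda>h. \<Sum>i\<in>Basis. (h \<bullet> i) *
     (((-1) * pd i f x) * (inverse (f x) * inverse (f x))))) (at x)" if "x \<in> S" for x
    using Deriv.has_derivative_inverse[OF nz[OF that] smooth_on_pd_sum[OF f that]]
    by (simp add: sum_distrib_left sum_distrib_right algebra_simps sum_negf)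
  moreover have "(\<lambda>x. ((-1) * pd i f x) * (inverse (f x) * inverse (f x))) \<in> alg ?G" for i
    using smooth_on_pd(2)[OF f] by (intro alg.mult alg.const alg.gen) auto
  ultimately show "g \<in> {\<lambda>x. inverse (f x)} \<Longrightarrow> \<exists>g'. (\<forall>i\<in>Basis. g' i \<in> alg ?G) \<and>
       (\<forall>x\<in>S. (g has_derivative (\<lambda>h. \<Sum>i\<in>Basis. (h \<bullet> i) * g' i x)) (at x))" for g
    by (intro exI[of _ "\<lambda>i x. ((-1) * pd i f x) * (inverse (f x) * inverse (f x))"]) auto
qed (use smooth_on_open[OF f] in \<open>auto intro: alg.intros\<close>)

lemma has_derivative_components:
  fixes g :: "'a::real_normed_vector \<Rightarrow> 'b::euclidean_space"
  assumes "\<And>j. j \<in> Basis \<Longrightarrow> (\<lambda>x. g x \<bullet> j) differentiable (at x)"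
  shows "g differentiable (at x)"
  using assms differentiable_componentwise_within[of g x UNIV] by simp

lemma pd_compose:
  fixes f :: "'b::euclidean_space \<Rightarrow> real" and g :: "'a::euclidean_space \<Rightarrow> 'b"
  assumes "f differentiable (at (g x))" "g differentiable (at x)"
  shows "pd v (\<lambda>x. f (g x)) x = pd (frechet_derivative g (at x) v) f (g x)"
  using pd_eq[OF has_derivative_compose[OF assms(2)[unfolded frechet_derivative_works]
     has_derivative_pd[OF assms(1)]]] by simp

lemma frechet_derivative_inner:
  fixes g :: "'a::euclidean_space \<Rightarrow> 'b::euclidean_space"
  assumes "g differentiable (at x)"
  shows "frechet_derivative g (at x) v \<bullet> j = pd v (\<lambda>x. g x \<bullet> j) x"
  using pd_eq[OF has_derivative_inner_left[OF assms[unfolded frechet_derivative_works]]] by simp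

lemma pd_compose_sum:
  fixes f :: "'b::euclidean_space \<Rightarrow> real" and g :: "'a::euclidean_space \<Rightarrow> 'b"
  assumes "f differentiable (at (g x))" "g differentiable (at x)"
  shows "pd v (\<lambda>x. f (g x)) x = (\<Sum>j\<in>Basis. pd v (\<lambda>x. g x \<bullet> j) x * pd j f (g x))"
  unfolding pd_compose[OF assms] pd_basis_sum[OF assms(1), of "frechet_derivative g (at x) v"]
  by (simp add: frechet_derivative_inner[OF assms(2)])

text \<open>The chain rule brings in \<open>pd j f\<close> composed with \<open>g\<close>, so the
  class to be closed must contain the compositions with all smooth outer functions, not only with
  \<open>f\<close>.\<close>

lemma smooth_on_compose:
  fixes f :: "'b::euclidean_space \<Rightarrow> real" and g :: "'a::euclidean_space \<Rightarrow> 'b"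
  assumes f: "smooth_on T f" and S: "open S"
    and g: "\<And>j. j \<in> Basis \<Longrightarrow> smooth_on S (\<lambda>x. g x \<bullet> j)"
    and gS: "\<And>x. x \<in> S \<Longrightarrow> g x \<in> T"
  shows "smooth_on S (\<lambda>x. f (g x))"
proof (rule smooth_on_closed_family[where G = "(\<lambda>(f::'b \<Rightarrow> real) x. f (g x)) ` {f. smooth_on T f}"])
  let ?G = "(\<lambda>(f::'b \<Rightarrow> real) x. f (g x)) ` {f. smooth_on T f} \<union> {u. smooth_on S u}"
  have gd: "g differentiable (at x)" if "x \<in> S" for x
    using smooth_on_differentiable[OF g that] by (rule has_derivative_components)
  fix u assume "u \<in> (\<lambda>(f::'b \<Rightarrow> real) x. f (g x)) ` {f. smooth_on T f}"
  then obtain f where u: "u = (\<lambda>x. f (g x))" and f: "smooth_on T f" by auto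
  show "\<exists>g'. (\<forall>i\<in>Basis. g' i \<in> alg ?G) \<and>
       (\<forall>x\<in>S. (u has_derivative (\<lambda>h. \<Sum>i\<in>Basis. (h \<bullet> i) * g' i x)) (at x))"
  proof (intro exI[of _ "\<lambda>i x. \<Sum>j\<in>Basis. pd i (\<lambda>x. g x \<bullet> j) x * pd j f (g x)"] conjI ballI)
    fix x assume x: "x \<in> S"
    have fd: "f differentiable (at (g x))" using smooth_on_differentiable[OF f gS[OF x]] .
    have "u differentiable (at x)"
      unfolding u using differentiable_chain_at[OF gd[OF x] fd] by (simp add: o_def)
    from has_derivative_pd_sum[OF this] show "(u has_derivative (\<lambda>h. \<Sum>i\<in>Basis. (h \<bullet> i) *
       (\<Sum>j\<in>Basis. pd i (\<lambda>x. g x \<bullet> j) x * pd j f (g x)))) (at x)"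
      unfolding u pd_compose_sum[OF fd gd[OF x]] .
  qed (use f g in \<open>auto intro!: alg_sum alg.mult intro: alg.gen smooth_on_pd(2)\<close>)
qed (use f S in \<open>auto intro: alg.gen\<close>)

lemma smooth_on_componentwise:
  fixes g :: "'a::euclidean_space \<Rightarrow> 'b::euclidean_space"
  assumes S: "open S" and g: "\<And>j. j \<in> Basis \<Longrightarrow> smooth_on S (\<lambda>x. g x \<bullet> j)"
  shows "smooth_on S g"
proof (rule smooth_on_coinduct[OF S, of _ "{g. \<forall>j\<in>Basis. smooth_on S (\<lambda>x. g x \<bullet> j)}"])
  fix g :: "'a \<Rightarrow> 'b" assume "g \<in> {g. \<forall>j\<in>Basis. smooth_on S (\<lambda>x. g x \<bullet> j)}"
  then have g: "\<And>j. j \<in> Basis \<Longrightarrow> smooth_on S (\<lambda>x. g x \<bullet> j)" by auto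
  show "\<exists>g'. (\<forall>i\<in>Basis. g' i \<in> {g. \<forall>j\<in>Basis. smooth_on S (\<lambda>x. g x \<bullet> j)}) \<and>
       (\<forall>x\<in>S. (g has_derivative (\<lambda>h. \<Sum>i\<in>Basis. (h \<bullet> i) *\<^sub>R g' i x)) (at x))"
  proof (intro exI[of _ "\<lambda>i x. \<Sum>j\<in>Basis. pd i (\<lambda>x. g x \<bullet> j) x *\<^sub>R j"] conjI ballI)
    fix x assume x: "x \<in> S"
    show "(g has_derivative (\<lambda>h. \<Sum>i\<in>Basis. (h \<bullet> i) *\<^sub>R (\<Sum>j\<in>Basis. pd i (\<lambda>x. g x \<bullet> j) x *\<^sub>R j))) (at x)"
      unfolding has_derivative_componentwise_within[of g]
    proof
      fix j :: 'b assume j: "j \<in> Basis"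
      from smooth_on_pd_sum[OF g[OF j] x]
      show "((\<lambda>x. g x \<bullet> j) has_derivative (\<lambda>h. (\<Sum>i\<in>Basis. (h \<bullet> i) *\<^sub>R (\<Sum>j\<in>Basis. pd i (\<lambda>x. g x \<bullet> j) x *\<^sub>R j)) \<bullet> j)) (at x)"
        using j by (simp add: inner_sum_left inner_Basis if_distrib cong: if_cong)
    qed
  next
    fix i :: 'a assume "i \<in> Basis"
    show "(\<lambda>x. \<Sum>j\<in>Basis. pd i (\<lambda>x. g x \<bullet> j) x *\<^sub>R j) \<in> {g. \<forall>j\<in>Basis. smooth_on S (\<lambda>x. g x \<bullet> j)}"
      using g by (auto simp: smooth_on_pd(2))
  qed
qed (use g in auto)

lemma smooth_on_inner:
  fixes g :: "'a::euclidean_space \<Rightarrow> 'b::euclidean_space"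
  assumes "smooth_on S g"
  shows "smooth_on S (\<lambda>x. g x \<bullet> j)"
proof (rule smooth_onE[OF assms])
  fix D assume D: "open S" "\<And>x. x \<in> S \<Longrightarrow> D [] x = g x"
    "\<And>ds x. set ds \<subseteq> Basis \<Longrightarrow> x \<in> S \<Longrightarrow>
       (D ds has_derivative (\<lambda>h. \<Sum>i\<in>Basis. (h \<bullet> i) *\<^sub>R D (i # ds) x)) (at x)"
  show ?thesis
    unfolding smooth_on_def
  proof (intro conjI exI[of _ "\<lambda>ds x. D ds x \<bullet> j"] allI impI ballI)
    fix ds x assume "set ds \<subseteq> (Basis::'a set)" "x \<in> S"
    from has_derivative_inner_left[OF D(3)[OF this], of j]
    show "((\<lambda>x. D ds x \<bullet> j) has_derivative (\<lambda>h. \<Sum>i\<in>Basis. (h \<bullet> i) *\<^sub>R (D (i # ds) x \<bullet> j))) (at x)"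
      by (simp add: inner_sum_left)
  qed (use D in auto)
qed

lemma smooth_on_cmult: "smooth_on S f \<Longrightarrow> smooth_on S (\<lambda>x. c * f x :: real)"
  by (intro smooth_on_mult smooth_on_const smooth_on_open)

lemma smooth_on_diff: "smooth_on S f \<Longrightarrow> smooth_on S g \<Longrightarrow> smooth_on S (\<lambda>x. f x - g x :: real)"
  using smooth_on_add[OF _ smooth_on_cmult[of S g "-1"], of f] by simp

subsection \<open>Mixed derivatives and antiderivatives\<close>

lemma pd_line:
  assumes "f differentiable (at (y + s *\<^sub>R v))"
  shows "((\<lambda>s. f (y + s *\<^sub>R v)) has_real_derivative pd v f (y + s *\<^sub>R v)) (at s)"
proof -
  have "((\<lambda>s. y + s *\<^sub>R v) has_derivative (\<lambda>h. h *\<^sub>R v)) (at s)"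
    by (auto intro!: derivative_eq_intros)
  from has_derivative_compose[OF this has_derivative_pd[OF assms]]
  have "((\<lambda>s. f (y + s *\<^sub>R v)) has_derivative (\<lambda>h. pd (h *\<^sub>R v) f (y + s *\<^sub>R v))) (at s)" .
  moreover have "pd (h *\<^sub>R v) f (y + s *\<^sub>R v) = pd v f (y + s *\<^sub>R v) * h" for h
    using linear_scale[OF pd_linear[OF assms], of h v] by simp
  ultimately show ?thesis by (simp add: has_field_derivative_def)
qed

text \<open>The mean value theorem is used twice: along \<open>v\<close> for the increment in
  direction \<open>w\<close>, and along \<open>w\<close> for the resulting difference of
  derivatives.\<close>

lemma second_difference:
  assumes f: "smooth_on S f" and t: "t > 0"
    and S: "\<And>a b. 0 \<le> a \<Longrightarrow> a \<le> t \<Longrightarrow> 0 \<le> b \<Longrightarrow> b \<le> t \<Longrightarrow> x + b *\<^sub>R w + a *\<^sub>R v \<in> S"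
  obtains a b where "0 \<le> a" "a \<le> t" "0 \<le> b" "b \<le> t"
    "f (x + t *\<^sub>R w + t *\<^sub>R v) - f (x + t *\<^sub>R v) - f (x + t *\<^sub>R w) + f x
       = t * t * pd w (pd v f) (x + a *\<^sub>R v + b *\<^sub>R w)"
proof -
  let ?h = "\<lambda>s. f (x + t *\<^sub>R w + s *\<^sub>R v) - f (x + s *\<^sub>R v)"
  have "\<exists>a>0. a < t \<and> ?h t - ?h 0 = (t - 0) * (pd v f (x + t *\<^sub>R w + a *\<^sub>R v) - pd v f (x + a *\<^sub>R v))"
  proof (rule MVT2[OF t])
    fix a assume a: "0 \<le> a" "a \<le> t"
    have "x + t *\<^sub>R w + a *\<^sub>R v \<in> S" "x + a *\<^sub>R v \<in> S"
      using S[OF a, of t] S[OF a, of 0] t by auto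
    then show "(?h has_real_derivative pd v f (x + t *\<^sub>R w + a *\<^sub>R v) - pd v f (x + a *\<^sub>R v)) (at a)"
      by (intro DERIV_diff pd_line smooth_on_differentiable[OF f])
  qed
  then obtain a where a: "0 < a" "a < t"
    "?h t - ?h 0 = t * (pd v f (x + t *\<^sub>R w + a *\<^sub>R v) - pd v f (x + a *\<^sub>R v))" by auto
  let ?k = "\<lambda>s. pd v f ((x + a *\<^sub>R v) + s *\<^sub>R w)"
  have "\<exists>b>0. b < t \<and> ?k t - ?k 0 = (t - 0) * pd w (pd v f) ((x + a *\<^sub>R v) + b *\<^sub>R w)"
  proof (rule MVT2[OF t])
    fix b assume b: "0 \<le> b" "b \<le> t"
    have "(x + a *\<^sub>R v) + b *\<^sub>R w \<in> S"
      using S[of a b] a b by (simp add: algebra_simps)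
    then show "(?k has_real_derivative pd w (pd v f) ((x + a *\<^sub>R v) + b *\<^sub>R w)) (at b)"
      by (intro pd_line smooth_on_differentiable[OF smooth_on_pd(2)[OF f]])
  qed
  then obtain b where b: "0 < b" "b < t" "?k t - ?k 0 = t * pd w (pd v f) ((x + a *\<^sub>R v) + b *\<^sub>R w)"
    by auto
  have "?h t - ?h 0 = t * (?k t - ?k 0)" using a(3) by (simp add: algebra_simps)
  then show ?thesis using a b by (intro that[of a b]) auto
qed

text \<open>Both mixed derivatives are limits of the same second difference quotient.\<close>
lemma pd_commute:
  assumes f: "smooth_on S f" and x: "x \<in> S"
  shows "pd v (pd w f) x = pd w (pd v f) x"
proof (rule ccontr)
  assume ne: "pd v (pd w f) x \<noteq> pd w (pd v f) x"
  define e where "e = \<bar>pd v (pd w f) x - pd w (pd v f) x\<bar> / 2"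
  have e: "e > 0" using ne by (simp add: e_def)
  have cont: "\<exists>d>0. \<forall>y. dist y x < d \<longrightarrow> y \<in> S \<and> dist (pd v (pd w f) y) (pd v (pd w f) x) < e" for v w
  proof -
    have "continuous_on S (pd v (pd w f))"
      by (intro smooth_on_continuous smooth_on_pd(2) f)
    then obtain d1 where d1: "d1 > 0" "\<And>y. y \<in> S \<Longrightarrow> dist y x < d1 \<Longrightarrow> dist (pd v (pd w f) y) (pd v (pd w f) x) < e"
      using x e unfolding continuous_on_iff by blast
    moreover obtain d2 where "d2 > 0" "\<And>y. dist y x < d2 \<Longrightarrow> y \<in> S"
      using smooth_on_open[OF f] x unfolding open_dist by blast
    ultimately show ?thesis by (intro exI[of _ "min d1 d2"]) auto
  qed
  obtain d1 d2 where d: "d1 > 0" "d2 > 0"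
    "\<And>y. dist y x < d1 \<Longrightarrow> y \<in> S \<and> dist (pd v (pd w f) y) (pd v (pd w f) x) < e"
    "\<And>y. dist y x < d2 \<Longrightarrow> y \<in> S \<and> dist (pd w (pd v f) y) (pd w (pd v f) x) < e"
    using cont[of v w] cont[of w v] by blast
  \<comment> \<open>All points \<open>x + a v + b w\<close> with \<open>a\<close>, \<open>b\<close>
    in \<open>[0, t]\<close> lie within \<open>t (norm v + norm w)\<close> of \<open>x\<close>,
    hence inside both balls. The 1 keeps the denominator positive, the 2 makes the inequality
    strict.\<close>
  define t where "t = min d1 d2 / (2 * (norm v + norm w + 1))"
  have nn: "norm v + norm w + 1 > 0" by (simp add: add_nonneg_pos)
  then have t: "t > 0" using d by (simp add: t_def)
  have near: "dist y x < min d1 d2" if "y = x + a *\<^sub>R v + b *\<^sub>R w" "0 \<le> a" "a \<le> t" "0 \<le> b" "b \<le> t" for a b y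
  proof -
    have "dist y x = norm (a *\<^sub>R v + b *\<^sub>R w)" using that by (simp add: dist_norm)
    also have "\<dots> \<le> a * norm v + b * norm w" using that by (metis abs_of_nonneg norm_scaleR norm_triangle_ineq)
    also have "\<dots> \<le> t * norm v + t * norm w" using that by (intro add_mono mult_right_mono) auto
    also have "\<dots> < 2 * (t * (norm v + norm w + 1))"
    proof -
      have "t * norm v \<ge> 0" "t * norm w \<ge> 0" using t by auto
      then show ?thesis using t unfolding distrib_left by linarith
    qed
    also have "\<dots> = min d1 d2" unfolding t_def using nn by (simp add: field_simps)
    finally show ?thesis .
  qed
  obtain a b where ab: "0 \<le> a" "a \<le> t" "0 \<le> b" "b \<le> t"
    "f (x + t *\<^sub>R w + t *\<^sub>R v) - f (x + t *\<^sub>R v) - f (x + t *\<^sub>R w) + f x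
       = t * t * pd w (pd v f) (x + a *\<^sub>R v + b *\<^sub>R w)"
  proof (rule second_difference[OF f t, of x w v])
    fix a b assume "0 \<le> a" "a \<le> t" "0 \<le> b" "b \<le> t"
    then show "x + b *\<^sub>R w + a *\<^sub>R v \<in> S"
      using near[of "x + b *\<^sub>R w + a *\<^sub>R v" a b] d(3) by (simp add: algebra_simps)
  qed
  obtain a' b' where ab': "0 \<le> a'" "a' \<le> t" "0 \<le> b'" "b' \<le> t"
    "f (x + t *\<^sub>R v + t *\<^sub>R w) - f (x + t *\<^sub>R w) - f (x + t *\<^sub>R v) + f x
       = t * t * pd v (pd w f) (x + a' *\<^sub>R w + b' *\<^sub>R v)"
  proof (rule second_difference[OF f t, of x v w])
    fix a b assume "0 \<le> a" "a \<le> t" "0 \<le> b" "b \<le> t"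
    then show "x + b *\<^sub>R v + a *\<^sub>R w \<in> S"
      using near[of "x + b *\<^sub>R v + a *\<^sub>R w" b a] d(3) by (simp add: algebra_simps)
  qed
  have "t * t * pd w (pd v f) (x + a *\<^sub>R v + b *\<^sub>R w) = t * t * pd v (pd w f) (x + a' *\<^sub>R w + b' *\<^sub>R v)"
    unfolding ab(5)[symmetric] ab'(5)[symmetric] by (simp add: algebra_simps)
  then have eq: "pd w (pd v f) (x + a *\<^sub>R v + b *\<^sub>R w) = pd v (pd w f) (x + a' *\<^sub>R w + b' *\<^sub>R v)"
    using t by simp
  have "dist (x + a *\<^sub>R v + b *\<^sub>R w) x < d2" "dist (x + a' *\<^sub>R w + b' *\<^sub>R v) x < d1"
    using near[of "x + a *\<^sub>R v + b *\<^sub>R w" a b] near[of "x + a' *\<^sub>R w + b' *\<^sub>R v" b' a'] ab ab'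
    by (auto simp: algebra_simps)
  then have "dist (pd w (pd v f) (x + a *\<^sub>R v + b *\<^sub>R w)) (pd w (pd v f) x) < e"
    "dist (pd v (pd w f) (x + a' *\<^sub>R w + b' *\<^sub>R v)) (pd v (pd w f) x) < e"
    using d(3,4) by blast+
  then have "\<bar>pd v (pd w f) x - pd w (pd v f) x\<bar> < 2 * e"
    using eq by (simp add: dist_real_def)
  then show False by (simp add: e_def)
qed

section \<open>Antiderivatives in a coordinate direction\<close>

lemma sum_inner_Basis:
  fixes e :: "'a::euclidean_space"
  assumes "e \<in> Basis"
  shows "(\<Sum>i\<in>Basis. (e \<bullet> i) * X i) = (X e :: real)"
proof -
  have "(\<Sum>i\<in>Basis. (e \<bullet> i) * X i) = (\<Sum>i\<in>Basis. if i = e then X i else 0)"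
    using assms by (intro sum.cong) (auto simp: inner_Basis)
  then show ?thesis using assms by simp
qed

definition rescale :: "real \<Rightarrow> 'a::euclidean_space \<Rightarrow> 'a \<Rightarrow> 'a" where
  "rescale t e z = z + ((t - 1) * (z \<bullet> e)) *\<^sub>R e"

text \<open>The class of these integrals is closed under differentiation; \<open>z \<bullet> e\<close> times the one with
  \<open>n = 0\<close> is the antiderivative of \<open>w\<close> in direction \<open>e\<close>.\<close>
definition ray_integral :: "nat \<Rightarrow> 'a::euclidean_space \<Rightarrow> ('a \<Rightarrow> real) \<Rightarrow> 'a \<Rightarrow> real" where
  "ray_integral n e w z = integral (cbox 0 1) (\<lambda>t. t ^ n * w (rescale t e z))"

lemma rescale_in_ball:
  assumes "e \<in> Basis" "t \<in> cbox 0 1" "z \<in> ball 0 r"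
  shows "rescale t e z \<in> ball 0 r"
proof -
  have "norm (rescale t e z) \<le> norm z"
  proof (rule norm_le_componentwise)
    fix b :: 'a assume b: "b \<in> Basis"
    have "\<bar>t * (z \<bullet> e)\<bar> \<le> \<bar>z \<bullet> e\<bar>"
      using assms(2) by (auto simp: abs_mult intro: mult_left_le_one_le)
    then show "\<bar>rescale t e z \<bullet> b\<bar> \<le> \<bar>z \<bullet> b\<bar>"
      using b assms(1) by (auto simp: rescale_def inner_add_left inner_Basis algebra_simps)
  qed
  then show ?thesis using assms(3) by auto
qed

lemma pd_rescale:
  assumes "f differentiable (at (rescale t e x))" "e \<in> Basis"
  shows "((\<lambda>x. f (rescale t e x)) has_derivative
     (\<lambda>h. \<Sum>i\<in>Basis. (h \<bullet> i) * ((if i = e then t else 1) * pd i f (rescale t e x)))) (at x)"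
proof -
  have "(rescale t e has_derivative rescale t e) (at x)"
    unfolding rescale_def[abs_def] by (auto intro!: derivative_eq_intros)
  from has_derivative_compose[OF this has_derivative_pd_sum[OF assms(1)]]
  have "((\<lambda>x. f (rescale t e x)) has_derivative
     (\<lambda>h. \<Sum>i\<in>Basis. (rescale t e h \<bullet> i) * pd i f (rescale t e x))) (at x)" .
  moreover have "(\<Sum>i\<in>Basis. (rescale t e h \<bullet> i) * pd i f (rescale t e x))
     = (\<Sum>i\<in>Basis. (h \<bullet> i) * ((if i = e then t else 1) * pd i f (rescale t e x)))" for h
    using assms(2) by (intro sum.cong) (auto simp: rescale_def inner_add_left inner_Basis algebra_simps)
  ultimately show ?thesis by simp
qed

lemma continuous_on_rescale:
  assumes "smooth_on (ball 0 r) w" "e \<in> Basis"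
  shows "continuous_on (ball 0 r \<times> cbox 0 1) (\<lambda>(z, t). w (rescale t e z))"
  unfolding split_beta
proof (rule continuous_on_compose2[OF smooth_on_continuous[OF assms(1)]])
  show "continuous_on (ball 0 r \<times> cbox 0 1) (\<lambda>p. rescale (snd p) e (fst p))"
    unfolding rescale_def by (intro continuous_intros)
  show "(\<lambda>p. rescale (snd p) e (fst p)) ` (ball 0 r \<times> cbox 0 1) \<subseteq> ball 0 r"
    using rescale_in_ball[OF assms(2)] by auto
qed

lemma continuous_on_rescale_ray:
  assumes "smooth_on (ball 0 r) w" "e \<in> Basis" "z \<in> ball 0 r"
  shows "continuous_on (cbox 0 1) (\<lambda>t. w (rescale t e z))"
proof -
  have "continuous_on (cbox 0 1) (\<lambda>t. case (z, t) of (z, t) \<Rightarrow> w (rescale t e z))"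
    by (rule continuous_on_compose2[OF continuous_on_rescale[OF assms(1,2)]])
       (use assms(3) in \<open>auto intro!: continuous_intros\<close>)
  then show ?thesis by simp
qed

text \<open>Differentiation under the integral sign. The inner map multiplies only the coordinate
  along \<open>e\<close> by \<open>t\<close>, so the exponent rises exactly for the partial
  derivative in direction \<open>e\<close>.\<close>

lemma has_derivative_ray_integral:
  assumes w: "smooth_on (ball 0 r) w" and e: "e \<in> Basis" and z: "z \<in> ball 0 r"
  shows "(ray_integral n e w has_derivative
    (\<lambda>h. \<Sum>i\<in>Basis. (h \<bullet> i) * ray_integral (if i = e then Suc n else n) e (pd i w) z)) (at z)"
proof -
  define fx where "fx x t = (\<Sum>i\<in>Basis. (t ^ (if i = e then Suc n else n) * pd i w (rescale t e x)) *\<^sub>R blinfun_inner_left i)" for x :: 'a and t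
  have fx_apply: "blinfun_apply (fx x t) h = (\<Sum>i\<in>Basis. (h \<bullet> i) * (t ^ (if i = e then Suc n else n) * pd i w (rescale t e x)))" for x t h
    by (simp add: fx_def blinfun.sum_left blinfun.scaleR_left mult.commute)
  have cont: "continuous_on (ball 0 r \<times> cbox 0 1) (\<lambda>(x, t). fx x t)"
    unfolding fx_def split_beta
    by (intro continuous_intros continuous_on_rescale[unfolded split_beta] smooth_on_pd(2)[OF w] e)
  have "((\<lambda>x. integral (cbox 0 1) (\<lambda>t. t ^ n * w (rescale t e x))) has_derivative
      blinfun_apply (integral (cbox 0 1) (fx z))) (at z within ball 0 r)"
  proof (rule leibniz_rule[OF _ _ cont z convex_ball])
    fix x :: 'a and t :: real assume x: "x \<in> ball 0 r" and t: "t \<in> cbox 0 1"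
    have d: "w differentiable (at (rescale t e x))"
      by (intro smooth_on_differentiable[OF w] rescale_in_ball e x t)
    have "((\<lambda>x. t ^ n * w (rescale t e x)) has_derivative blinfun_apply (fx x t)) (at x)"
      unfolding fx_apply
      by (rule has_derivative_eq_rhs[OF has_derivative_mult_right[OF pd_rescale[OF d e]]])
         (auto simp: sum_distrib_left fun_eq_iff intro!: sum.cong)
    then show "((\<lambda>x. t ^ n * w (rescale t e x)) has_derivative blinfun_apply (fx x t)) (at x within ball 0 r)"
      by (rule has_derivative_at_withinI)
  next
    fix x :: 'a assume x: "x \<in> ball 0 r"
    show "(\<lambda>t. t ^ n * w (rescale t e x)) integrable_on cbox 0 1"
      by (intro integrable_continuous continuous_intros continuous_on_rescale_ray[OF w e x])
  qed
  then have D1: "((\<lambda>x. integral (cbox 0 1) (\<lambda>t. t ^ n * w (rescale t e x))) has_derivative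
      blinfun_apply (integral (cbox 0 1) (fx z))) (at z)"
    by (simp only: at_within_open[OF z open_ball])
  have D2: "blinfun_apply (integral (cbox 0 1) (fx z)) h =
     (\<Sum>i\<in>Basis. (h \<bullet> i) * ray_integral (if i = e then Suc n else n) e (pd i w) z)" for h
  proof -
    have "continuous_on (cbox 0 1) (\<lambda>t. case (z, t) of (x, t) \<Rightarrow> fx x t)"
      by (rule continuous_on_compose2[OF cont]) (use z in \<open>auto intro!: continuous_intros\<close>)
    then have "continuous_on (cbox 0 1) (fx z)" unfolding prod.case .
    then have "blinfun_apply (integral (cbox 0 1) (fx z)) h = integral (cbox 0 1) (\<lambda>t. fx z t h)"
      by (intro blinfun_apply_integral integrable_continuous)
    also have "\<dots> = (\<Sum>i\<in>Basis. integral (cbox 0 1) (\<lambda>t. (h \<bullet> i) * (t ^ (if i = e then Suc n else n) * pd i w (rescale t e z))))"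
      unfolding fx_apply
      by (intro integral_sum finite_Basis integrable_continuous continuous_intros
           continuous_on_rescale_ray[OF smooth_on_pd(2)[OF w] e z])
    finally show ?thesis by (simp add: ray_integral_def)
  qed
  have D3: "ray_integral n e w = (\<lambda>x. integral (cbox 0 1) (\<lambda>t. t ^ n * w (rescale t e x)))"
    by (simp add: fun_eq_iff ray_integral_def)
  show ?thesis
    unfolding D3 by (rule has_derivative_eq_rhs[OF D1]) (intro ext D2)
qed

lemma smooth_on_ray_integral:
  assumes w: "smooth_on (ball 0 r) w" and e: "e \<in> Basis"
  shows "smooth_on (ball 0 r) (ray_integral n e w)"
proof (rule smooth_on_coinduct[where A = "{ray_integral n e w |n w. smooth_on (ball 0 r) w}"])
  fix g assume "g \<in> {ray_integral n e w |n w. smooth_on (ball 0 r) w}"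
  then obtain n w where g: "g = ray_integral n e w" and w: "smooth_on (ball 0 r) w" by blast
  show "\<exists>g'. (\<forall>i\<in>Basis. g' i \<in> {ray_integral n e w |n w. smooth_on (ball 0 r) w}) \<and>
     (\<forall>x\<in>ball 0 r. (g has_derivative (\<lambda>h. \<Sum>i\<in>Basis. (h \<bullet> i) *\<^sub>R g' i x)) (at x))"
    unfolding g
    using has_derivative_ray_integral[OF w e, of _ n] smooth_on_pd(2)[OF w]
    by (intro exI[of _ "\<lambda>i. ray_integral (if i = e then Suc n else n) e (pd i w)"] conjI)
       (auto simp del: if_split_asm)
qed (use w in auto)

lemma smooth_on_antiderivative:
  assumes w: "smooth_on (ball 0 r) w" and e: "e \<in> Basis"
  shows "smooth_on (ball 0 r) (\<lambda>z. (z \<bullet> e) * ray_integral 0 e w z)"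
  by (intro smooth_on_mult smooth_on_ray_integral[OF w e] smooth_on_linear) (auto intro: bounded_linear_intros)

lemma pd_antiderivative:
  assumes w: "smooth_on (ball 0 r) w" and e: "e \<in> Basis" and z: "z \<in> ball 0 r"
  shows "pd e (\<lambda>z. (z \<bullet> e) * ray_integral 0 e w z) z = w z"
proof -
  have "pd e (\<lambda>z. (z \<bullet> e) * ray_integral 0 e w z) z =
     ray_integral 0 e w z + (z \<bullet> e) * ray_integral (Suc 0) e (pd e w) z"
  proof -
    have "((\<lambda>z. (z \<bullet> e) * ray_integral 0 e w z) has_derivative (\<lambda>h. (z \<bullet> e) *
       (\<Sum>i\<in>Basis. (h \<bullet> i) * ray_integral (if i = e then Suc 0 else 0) e (pd i w) z) +
       (h \<bullet> e) * ray_integral 0 e w z)) (at z)"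
      by (intro has_derivative_mult has_derivative_ray_integral[OF w e z]) (auto intro!: derivative_eq_intros)
    from pd_eq[OF this, of e] show ?thesis using e by (simp add: sum_inner_Basis)
  qed
  also have "\<dots> = integral (cbox 0 1) (\<lambda>t. w (rescale t e z) + (z \<bullet> e) * (t * pd e w (rescale t e z)))"
    unfolding ray_integral_def
    by (subst integral_add)
       (auto intro!: integrable_continuous_real continuous_intros
         continuous_on_rescale_ray[OF w e z, simplified] continuous_on_rescale_ray[OF smooth_on_pd(2)[OF w] e z, simplified])
  \<comment> \<open>The integrand is the derivative of \<open>t * w (rescale t e z)\<close>; the
    factors 1 and 0 are the values of \<open>t\<close> at the ends of the interval.\<close>
  also have "\<dots> = 1 * w (rescale 1 e z) - 0 * w (rescale 0 e z)"
    unfolding cbox_interval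
  proof (intro integral_unique fundamental_theorem_of_calculus)
    fix t :: real assume t: "t \<in> {0..1}"
    have eq: "rescale t e z = (z - (z \<bullet> e) *\<^sub>R e) + t *\<^sub>R ((z \<bullet> e) *\<^sub>R e)" for t
      by (simp add: rescale_def algebra_simps)
    have d: "w differentiable (at (rescale t e z))"
      using t by (intro smooth_on_differentiable[OF w] rescale_in_ball e z) auto
    have "((\<lambda>t. w (rescale t e z)) has_real_derivative pd ((z \<bullet> e) *\<^sub>R e) w (rescale t e z)) (at t)"
      using pd_line[OF d[unfolded eq]] unfolding eq .
    moreover have "pd ((z \<bullet> e) *\<^sub>R e) w (rescale t e z) = (z \<bullet> e) * pd e w (rescale t e z)"
      using linear_scale[OF pd_linear[OF d], of "z \<bullet> e" e] by simp
    ultimately have "((\<lambda>t. t * w (rescale t e z)) has_real_derivative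
        w (rescale t e z) + (z \<bullet> e) * (t * pd e w (rescale t e z))) (at t)"
      by (auto intro!: derivative_eq_intros)
    then show "((\<lambda>t. t * w (rescale t e z)) has_vector_derivative
        w (rescale t e z) + (z \<bullet> e) * (t * pd e w (rescale t e z))) (at t within {0..1})"
      by (metis has_real_derivative_iff_has_vector_derivative has_vector_derivative_at_within)
  qed auto
  finally show ?thesis by (simp add: rescale_def)
qed

subsection \<open>Germs and their order of vanishing\<close>

text \<open>Germs at the origin are represented by total functions with arbitrary values far away;
  equality of germs is \<open>\<doteq>\<close>.\<close>

definition germ :: "('a::euclidean_space \<Rightarrow> real) \<Rightarrow> bool" where
  "germ f \<longleftrightarrow> (\<exists>S. 0 \<in> S \<and> smooth_on S f)"

abbreviation germ_eq :: "('a::euclidean_space \<Rightarrow> 'b) \<Rightarrow> ('a \<Rightarrow> 'b) \<Rightarrow> bool" (infix "\<doteq>" 50) where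
  "f \<doteq> g \<equiv> eventually (\<lambda>z. f z = g z) (nhds 0)"

lemma germ_eq_sym: "f \<doteq> g \<Longrightarrow> g \<doteq> f"
  by (erule eventually_mono) simp

lemma germ_eq_trans [trans]: "f \<doteq> g \<Longrightarrow> g \<doteq> h \<Longrightarrow> f \<doteq> h"
  by (erule (1) eventually_elim2) simp

lemma germ_eq_refl: "f \<doteq> f"
  by simp

lemma germI: "smooth_on S f \<Longrightarrow> 0 \<in> S \<Longrightarrow> germ f"
  unfolding germ_def by blast

lemma germ_ball:
  assumes "germ f"
  obtains r where "r > 0" "smooth_on (ball 0 r) f"
proof -
  obtain S where S: "0 \<in> S" "smooth_on S f" using assms unfolding germ_def by blast
  then obtain r where "r > 0" "ball 0 r \<subseteq> S"
    using smooth_on_open[OF S(2)] by (meson open_contains_ball)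
  then show ?thesis using that smooth_on_subset[OF S(2) open_ball] by blast
qed

lemma eventually_germ_smooth:
  assumes "germ f" "\<And>S z. smooth_on S f \<Longrightarrow> z \<in> S \<Longrightarrow> P z"
  shows "eventually P (nhds 0)"
proof -
  obtain S where S: "0 \<in> S" "smooth_on S f" using assms(1) unfolding germ_def by blast
  show ?thesis
    by (rule eventually_mono[OF eventually_nhds_in_open[OF smooth_on_open[OF S(2)] S(1)]])
       (rule assms(2)[OF S(2)])
qed

lemma germ_differentiable: "germ f \<Longrightarrow> eventually (\<lambda>z. f differentiable (at z)) (nhds 0)"
  by (erule eventually_germ_smooth) (rule smooth_on_differentiable)

lemma germ_binary:
  assumes "germ f" "germ g" "\<And>S. smooth_on S f \<Longrightarrow> smooth_on S g \<Longrightarrow> smooth_on S h"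
  shows "germ h"
proof -
  obtain S T where S: "0 \<in> S" "smooth_on S f" and T: "0 \<in> T" "smooth_on T g"
    using assms(1,2) unfolding germ_def by blast
  have "open (S \<inter> T)" using S T smooth_on_open by blast
  then have "smooth_on (S \<inter> T) h"
    using assms(3) smooth_on_subset[OF S(2)] smooth_on_subset[OF T(2)] by simp
  then show ?thesis using S T by (auto intro: germI)
qed

lemma germ_const [simp]: "germ (\<lambda>_. c)"
  by (rule germI[of UNIV]) auto

lemma germ_add: "germ f \<Longrightarrow> germ g \<Longrightarrow> germ (\<lambda>z. f z + g z)"
  by (erule (1) germ_binary) (rule smooth_on_add)

lemma germ_mult: "germ f \<Longrightarrow> germ g \<Longrightarrow> germ (\<lambda>z. f z * g z)"
  by (erule (1) germ_binary) (rule smooth_on_mult)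

lemma germ_cmult: "germ f \<Longrightarrow> germ (\<lambda>z. c * f z)"
  by (rule germ_mult) auto

lemma germ_diff: "germ f \<Longrightarrow> germ g \<Longrightarrow> germ (\<lambda>z. f z - g z)"
  by (erule (1) germ_binary) (rule smooth_on_diff)

lemma germ_sum: "finite I \<Longrightarrow> (\<And>i. i \<in> I \<Longrightarrow> germ (f i)) \<Longrightarrow> germ (\<lambda>z. \<Sum>i\<in>I. f i z)"
  by (induction I rule: finite_induct) (auto intro: germ_add)

lemma germ_linear: "bounded_linear f \<Longrightarrow> germ f"
  by (rule germI[OF smooth_on_linear[OF open_UNIV]]) auto

lemma germ_pd: "germ f \<Longrightarrow> germ (pd v f)"
  unfolding germ_def using smooth_on_pd(2) by blast

lemma germ_cong:
  assumes "germ f" "f \<doteq> g"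
  shows "germ g"
proof -
  obtain S where S: "0 \<in> S" "smooth_on S f" using assms(1) unfolding germ_def by blast
  obtain T where T: "open T" "0 \<in> T" "\<And>z. z \<in> T \<Longrightarrow> f z = g z"
    using assms(2) unfolding eventually_nhds by auto
  have "smooth_on (S \<inter> T) f"
    using smooth_on_subset[OF S(2)] smooth_on_open[OF S(2)] T(1) by auto
  then have "smooth_on (S \<inter> T) g" using T(3) by (rule smooth_on_cong) auto
  then show ?thesis using S T by (auto intro: germI)
qed

lemma smooth_on_Int_components:
  fixes g :: "'a::euclidean_space \<Rightarrow> 'b::euclidean_space"
  assumes "\<And>j. j \<in> Basis \<Longrightarrow> germ (\<lambda>z. g z \<bullet> j)"
  obtains S where "open S" "0 \<in> S" "\<And>j. j \<in> Basis \<Longrightarrow> smooth_on S (\<lambda>z. g z \<bullet> j)"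
proof -
  have "\<forall>j\<in>Basis. \<exists>S. 0 \<in> S \<and> smooth_on S (\<lambda>z. g z \<bullet> j)" using assms unfolding germ_def by simp
  then obtain S where "\<forall>j\<in>Basis. 0 \<in> S j \<and> smooth_on (S j) (\<lambda>z. g z \<bullet> j)"
    by (rule bchoice[THEN exE])
  then have S: "\<And>j. j \<in> Basis \<Longrightarrow> 0 \<in> S j" "\<And>j. j \<in> Basis \<Longrightarrow> smooth_on (S j) (\<lambda>z. g z \<bullet> j)"
    by auto
  have op: "open (\<Inter>j\<in>Basis. S j)" using S(2) by (intro open_INT) (auto dest: smooth_on_open)
  show ?thesis
    by (rule that[OF op]) (use S in \<open>auto intro!: smooth_on_subset[OF S(2) op]\<close>)
qed

lemma germ_compose:
  fixes g :: "'a::euclidean_space \<Rightarrow> 'b::euclidean_space"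
  assumes f: "germ f" and g: "\<And>j. j \<in> Basis \<Longrightarrow> germ (\<lambda>z. g z \<bullet> j)" and "g 0 = 0"
  shows "germ (\<lambda>z. f (g z))"
proof -
  obtain T where T: "0 \<in> T" "smooth_on T f" using f unfolding germ_def by blast
  obtain S where S: "open S" "0 \<in> S" "\<And>j. j \<in> Basis \<Longrightarrow> smooth_on S (\<lambda>z. g z \<bullet> j)"
    using smooth_on_Int_components[OF g] by blast
  have "continuous_on S g"
    by (rule smooth_on_continuous[OF smooth_on_componentwise[OF S(1,3)]])
  then have op: "open (S \<inter> g -` T)"
    using S(1) smooth_on_open[OF T(2)] by (rule continuous_open_preimage)
  have "smooth_on (S \<inter> g -` T) (\<lambda>z. f (g z))"
    by (rule smooth_on_compose[OF T(2) op]) (auto intro!: smooth_on_subset[OF S(3) op])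
  then show ?thesis using S(2) T(1) assms(3) by (auto intro: germI)
qed

lemma germ_inverse:
  assumes "germ f" "f 0 \<noteq> 0"
  shows "germ (\<lambda>z. inverse (f z))"
proof -
  obtain S where S: "0 \<in> S" "smooth_on S f" using assms(1) unfolding germ_def by blast
  have op: "open (S \<inter> f -` (- {0}))"
    using smooth_on_continuous[OF S(2)] smooth_on_open[OF S(2)] by (rule continuous_open_preimage) auto
  have "smooth_on (S \<inter> f -` (- {0})) (\<lambda>z. inverse (f z))"
    by (rule smooth_on_inverse[OF smooth_on_subset[OF S(2) op]]) auto
  then show ?thesis using S(1) assms(2) by (auto intro: germI)
qed

lemma germ_isCont:
  assumes "germ f"
  shows "eventually (\<lambda>z. isCont f z) (nhds 0)"
  using germ_differentiable[OF assms] by (rule eventually_mono) (rule differentiable_imp_continuous_within)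

lemma frechet_derivative_cong:
  assumes "eventually (\<lambda>x. f x = g x) (nhds z)"
  shows "frechet_derivative f (at z) = frechet_derivative g (at z)"
proof -
  obtain T where T: "open T" "z \<in> T" "\<And>z. z \<in> T \<Longrightarrow> f z = g z"
    using assms unfolding eventually_nhds by auto
  have "(f has_derivative D) (at z) \<longleftrightarrow> (g has_derivative D) (at z)" for D
    using has_derivative_transform_within_open[OF _ T(1,2)] T(3) by metis
  then show ?thesis unfolding frechet_derivative_def by simp
qed

lemma pd_cong_at: "eventually (\<lambda>x. f x = g x) (nhds z) \<Longrightarrow> pd v f z = pd v g z"
  unfolding pd_def by (simp add: frechet_derivative_cong)

lemma pd_cong:
  assumes "f \<doteq> g"
  shows "pd v f \<doteq> pd v g"
proof -
  \<comment> \<open>The derivative at \<open>z\<close> depends on a neighbourhood of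
    \<open>z\<close>, so agreement at nearby points has to be turned into agreement around nearby
    points.\<close>
  have "eventually (\<lambda>z. eventually (\<lambda>x. f x = g x) (nhds z)) (nhds 0)"
    using assms by (simp add: eventually_eventually)
  then show ?thesis by (rule eventually_mono) (rule pd_cong_at)
qed

lemma pd_add_at: "f differentiable (at z) \<Longrightarrow> g differentiable (at z) \<Longrightarrow>
    pd v (\<lambda>x. f x + g x) z = pd v f z + pd v g z"
  by (rule pd_eq[OF has_derivative_add[OF has_derivative_pd has_derivative_pd]])

lemma pd_mult_at: "f differentiable (at z) \<Longrightarrow> g differentiable (at z) \<Longrightarrow>
    pd v (\<lambda>x. f x * g x) z = pd v f z * g z + f z * pd v g z"
  using pd_eq[OF has_derivative_mult[OF has_derivative_pd[of f z] has_derivative_pd[of g z]]]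
  by (simp add: algebra_simps)

lemma pd_const [simp]: "pd v (\<lambda>_. c) z = 0"
  by (rule pd_eq[OF has_derivative_const])

lemma pd_cmult_at: "f differentiable (at z) \<Longrightarrow> pd v (\<lambda>x. c * f x) z = c * pd v f z"
  using pd_mult_at[of "\<lambda>_. c" z f] by simp

lemma pd_diff_at: "f differentiable (at z) \<Longrightarrow> g differentiable (at z) \<Longrightarrow>
    pd v (\<lambda>x. f x - g x) z = pd v f z - pd v g z"
  by (rule pd_eq[OF has_derivative_diff[OF has_derivative_pd has_derivative_pd]])

lemma pd_sum_at: "(\<And>i. i \<in> I \<Longrightarrow> f i differentiable (at z)) \<Longrightarrow>
    pd v (\<lambda>x. \<Sum>i\<in>I. f i x) z = (\<Sum>i\<in>I. pd v (f i) z)"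
  by (rule pd_eq[OF has_derivative_sum[OF has_derivative_pd]])

lemma pd_bounded_linear: "bounded_linear f \<Longrightarrow> pd v f z = f v"
  by (rule pd_eq[OF bounded_linear_imp_has_derivative])

lemma pd_add: "germ f \<Longrightarrow> germ g \<Longrightarrow> pd v (\<lambda>x. f x + g x) \<doteq> (\<lambda>z. pd v f z + pd v g z)"
  by (drule germ_differentiable, drule germ_differentiable, erule (1) eventually_elim2) (rule pd_add_at)

lemma pd_diff: "germ f \<Longrightarrow> germ g \<Longrightarrow> pd v (\<lambda>x. f x - g x) \<doteq> (\<lambda>z. pd v f z - pd v g z)"
  by (drule germ_differentiable, drule germ_differentiable, erule (1) eventually_elim2) (rule pd_diff_at)

lemma pd_mult: "germ f \<Longrightarrow> germ g \<Longrightarrow> pd v (\<lambda>x. f x * g x) \<doteq> (\<lambda>z. pd v f z * g z + f z * pd v g z)"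
  by (drule germ_differentiable, drule germ_differentiable, erule (1) eventually_elim2) (rule pd_mult_at)

lemma pd_cmult: "germ f \<Longrightarrow> pd v (\<lambda>x. c * f x) \<doteq> (\<lambda>z. c * pd v f z)"
  by (drule germ_differentiable, erule eventually_mono) (rule pd_cmult_at)

lemma pd_pd_commute: "germ f \<Longrightarrow> pd v (pd w f) \<doteq> pd w (pd v f)"
  by (erule eventually_germ_smooth) (rule pd_commute)

lemma pd_zero [simp]: "f differentiable (at z) \<Longrightarrow> pd 0 f z = 0"
  by (rule linear_0[OF pd_linear])

lemma germ_vector_differentiable:
  fixes g :: "'a::euclidean_space \<Rightarrow> 'b::euclidean_space"
  assumes "\<And>j. j \<in> Basis \<Longrightarrow> germ (\<lambda>z. g z \<bullet> j)"
  shows "eventually (\<lambda>z. g differentiable (at z)) (nhds 0)"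
proof -
  have "eventually (\<lambda>z. \<forall>j\<in>Basis. (\<lambda>z. g z \<bullet> j) differentiable (at z)) (nhds 0)"
    using assms by (intro eventually_ball_finite) (auto intro: germ_differentiable)
  then show ?thesis by (rule eventually_mono) (auto intro: has_derivative_components)
qed

lemma germ_vector_tendsto:
  fixes g :: "'a::euclidean_space \<Rightarrow> 'b::euclidean_space"
  assumes "\<And>j. j \<in> Basis \<Longrightarrow> germ (\<lambda>z. g z \<bullet> j)" and "g 0 = 0"
  shows "filterlim g (nhds 0) (nhds 0)"
proof -
  have "isCont g 0"
    using eventually_nhds_x_imp_x[OF germ_vector_differentiable[OF assms(1)]]
    by (rule differentiable_imp_continuous_within)
  then have "(g \<longlongrightarrow> g 0) (nhds 0)" unfolding isCont_def by (rule tendsto_at_iff_tendsto_nhds[THEN iffD1])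
  then show ?thesis by (simp only: assms(2))
qed

lemma eventually_compose_germ:
  fixes g :: "'a::euclidean_space \<Rightarrow> 'b::euclidean_space"
  assumes "\<And>j. j \<in> Basis \<Longrightarrow> germ (\<lambda>z. g z \<bullet> j)" and "g 0 = 0" and "eventually P (nhds 0)"
  shows "eventually (\<lambda>z. P (g z)) (nhds 0)"
  using germ_vector_tendsto[OF assms(1,2)] assms(3) unfolding filterlim_iff by blast

lemma pd_compose_germ:
  fixes g :: "'a::euclidean_space \<Rightarrow> 'b::euclidean_space"
  assumes f: "germ f" and g: "\<And>j. j \<in> Basis \<Longrightarrow> germ (\<lambda>z. g z \<bullet> j)" "g 0 = 0"
  shows "pd v (\<lambda>z. f (g z)) \<doteq> (\<lambda>z. \<Sum>j\<in>Basis. pd v (\<lambda>z. g z \<bullet> j) z * pd j f (g z))"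
proof (rule eventually_elim2)
  show "eventually (\<lambda>z. f differentiable (at (g z))) (nhds 0)"
    by (rule eventually_compose_germ[OF g germ_differentiable[OF f]])
  show "eventually (\<lambda>z. g differentiable (at z)) (nhds 0)"
    by (rule germ_vector_differentiable[OF g(1)])
qed (rule pd_compose_sum)

section \<open>Orders of vanishing\<close>

text \<open>All derivatives of order less than \<open>k\<close> vanish at the origin.  Defining this by recursion on
  derivatives makes it stable under differentiation, so that no Taylor polynomials are needed.\<close>
primrec flat :: "nat \<Rightarrow> ('a::euclidean_space \<Rightarrow> real) \<Rightarrow> bool" where
  "flat 0 f \<longleftrightarrow> germ f"
| "flat (Suc k) f \<longleftrightarrow> germ f \<and> f 0 = 0 \<and> (\<forall>v. flat k (pd v f))"

lemma flat_germ: "flat k f \<Longrightarrow> germ f"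
  by (cases k) auto

lemma flat_pd: "flat (Suc k) f \<Longrightarrow> flat k (pd v f)"
  by simp

lemma flat_1 [simp]: "flat 1 f \<longleftrightarrow> germ f \<and> f 0 = 0" "flat (Suc 0) f \<longleftrightarrow> germ f \<and> f 0 = 0"
  by (auto simp: germ_pd)

lemma flat_SucD: "flat (Suc k) f \<Longrightarrow> flat k f"
proof (induction k arbitrary: f)
  case (Suc k)
  then have "germ f" "f 0 = 0" "\<And>v. flat (Suc k) (pd v f)" by auto
  then show ?case using Suc.IH by simp
qed auto

lemma flat_cong: "flat k f \<Longrightarrow> f \<doteq> g \<Longrightarrow> flat k g"
proof (induction k arbitrary: f g)
  case 0 then show ?case by (auto intro: germ_cong)
next
  case (Suc k)
  have "g 0 = 0" using Suc.prems eventually_nhds_x_imp_x[OF Suc.prems(2)] by simp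
  then show ?case using Suc.prems Suc.IH[OF _ pd_cong[OF Suc.prems(2)]] germ_cong by auto
qed

lemma flat_zero [simp]: "flat k (\<lambda>_. 0)"
proof (induction k)
  case (Suc k)
  have "pd v (\<lambda>_. 0) = (\<lambda>_. 0)" for v :: 'a by (simp add: fun_eq_iff)
  then show ?case using Suc by simp
qed simp

lemma flat_add: "flat k f \<Longrightarrow> flat k g \<Longrightarrow> flat k (\<lambda>z. f z + g z)"
proof (induction k arbitrary: f g)
  case (Suc k)
  then have *: "germ f" "germ g" "f 0 = 0" "g 0 = 0" "\<And>v. flat k (pd v f)" "\<And>v. flat k (pd v g)" by auto
  have "flat k (pd v (\<lambda>z. f z + g z))" for v
    by (rule flat_cong[OF Suc.IH[OF *(5,6)] germ_eq_sym[OF pd_add[OF *(1,2)]]])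
  then show ?case using * by (simp add: germ_add)
qed (simp add: germ_add)

lemma flat_sum: "finite I \<Longrightarrow> (\<And>i. i \<in> I \<Longrightarrow> flat k (f i)) \<Longrightarrow> flat k (\<lambda>z. \<Sum>i\<in>I. f i z)"
  by (induction I rule: finite_induct) (auto intro: flat_add)

text \<open>Induction on the total order: each term of the product rule lowers the order of one
  factor by one. If that factor had order 0, its derivative is still a germ, and the missing order
  is taken from the other factor.\<close>

lemma flat_mult_aux: "j + k = n \<Longrightarrow> flat j f \<Longrightarrow> flat k g \<Longrightarrow> flat n (\<lambda>z. f z * g z)"
proof (induction n arbitrary: j k f g)
  case 0 then show ?case by (simp add: germ_mult)
next
  case (Suc n)
  have gf: "germ f" "germ g" using Suc.prems flat_germ by blast+
  have z: "f 0 * g 0 = 0" using Suc.prems by (cases j; cases k) auto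
  have 1: "flat n (\<lambda>z. pd v f z * g z)" for v
  proof (cases j)
    case 0
    then have "flat n g" using Suc.prems flat_SucD by auto
    then show ?thesis using gf by (intro Suc.IH[of 0 n]) (auto simp: germ_pd)
  next
    case (Suc j')
    then show ?thesis using Suc.prems by (intro Suc.IH[of j' k]) auto
  qed
  have 2: "flat n (\<lambda>z. f z * pd v g z)" for v
  proof (cases k)
    case 0
    then have "flat n f" using Suc.prems flat_SucD by auto
    then show ?thesis using gf by (intro Suc.IH[of n 0]) (auto simp: germ_pd)
  next
    case (Suc k')
    then show ?thesis using Suc.prems by (intro Suc.IH[of j k']) auto
  qed
  have "flat n (pd v (\<lambda>z. f z * g z))" for v
    by (rule flat_cong[OF flat_add[OF 1 2] germ_eq_sym[OF pd_mult[OF gf]]])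
  then show ?case using z gf by (auto simp: germ_mult)
qed

lemma flat_mult: "flat j f \<Longrightarrow> flat k g \<Longrightarrow> flat (j + k) (\<lambda>z. f z * g z)"
  by (rule flat_mult_aux) auto

lemma flat_mult_left: "germ f \<Longrightarrow> flat k g \<Longrightarrow> flat k (\<lambda>z. f z * g z)"
  using flat_mult[of 0 f k g] by simp

lemma flat_mult_right: "flat k f \<Longrightarrow> germ g \<Longrightarrow> flat k (\<lambda>z. f z * g z)"
  using flat_mult[of k f 0 g] by simp

lemma flat_cmult: "flat k f \<Longrightarrow> flat k (\<lambda>z. c * f z)"
  by (rule flat_mult_left) auto

lemma flat_diff: "flat k f \<Longrightarrow> flat k g \<Longrightarrow> flat k (\<lambda>z. f z - g z)"
  using flat_add[OF _ flat_cmult[of k g "-1"]] by simp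

text \<open>By the chain rule the derivatives of the composition are combinations of the derivatives
  of \<open>f\<close>, evaluated at \<open>g z\<close>, which vanish to one order less.\<close>

lemma flat_compose:
  fixes g :: "'a::euclidean_space \<Rightarrow> 'b::euclidean_space"
  assumes "flat k f" and g: "\<And>j. j \<in> Basis \<Longrightarrow> germ (\<lambda>z. g z \<bullet> j)" "g 0 = 0"
  shows "flat k (\<lambda>z. f (g z))"
  using assms(1)
proof (induction k arbitrary: f)
  case 0 then show ?case using g by (simp add: germ_compose)
next
  case (Suc k)
  then have *: "germ f" "f 0 = 0" "\<And>v. flat k (pd v f)" by auto
  have "flat k (\<lambda>z. \<Sum>j\<in>Basis. pd v (\<lambda>z. g z \<bullet> j) z * pd j f (g z))" for v
    by (intro flat_sum finite_Basis flat_mult_left germ_pd g(1) Suc.IH *(3))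
  then have "flat k (pd v (\<lambda>z. f (g z)))" for v
    by (rule flat_cong) (rule germ_eq_sym[OF pd_compose_germ[OF *(1) g]])
  then show ?case using * g by (simp add: germ_compose)
qed

text \<open>Links the recursive notion to the estimate in the theorem. The mean value theorem on the
  segment from the origin to \<open>z\<close> gains one factor \<open>norm z\<close> over the bound
  for the derivatives.\<close>

lemma flat_bound:
  assumes "flat k f"
  shows "\<exists>C\<ge>0. eventually (\<lambda>z. \<bar>f z\<bar> \<le> C * norm z ^ k) (nhds 0)"
  using assms
proof (induction k arbitrary: f)
  case 0
  then have "isCont f 0" using germ_isCont[of f] eventually_nhds_x_imp_x by auto
  then have "eventually (\<lambda>z. dist (f z) (f 0) < 1) (nhds 0)"
    by (simp add: continuous_at tendsto_at_iff_tendsto_nhds tendstoD)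
  then have "eventually (\<lambda>z. \<bar>f z\<bar> \<le> (\<bar>f 0\<bar> + 1) * norm z ^ 0) (nhds 0)"
    by (rule eventually_mono) (auto simp: dist_real_def)
  then show ?case by (intro exI[of _ "\<bar>f 0\<bar> + 1"]) auto
next
  case (Suc k)
  then have *: "germ f" "f 0 = 0" "\<And>v. flat k (pd v f)" by auto
  have "\<forall>i\<in>Basis. \<exists>C. C \<ge> 0 \<and> eventually (\<lambda>z. \<bar>pd i f z\<bar> \<le> C * norm z ^ k) (nhds 0)"
    using Suc.IH[OF *(3)] by blast
  then obtain C where "\<forall>i\<in>Basis. C i \<ge> 0 \<and> eventually (\<lambda>z. \<bar>pd i f z\<bar> \<le> C i * norm z ^ k) (nhds 0)"
    by (rule bchoice[THEN exE])
  then have C: "\<And>i. i \<in> Basis \<Longrightarrow> C i \<ge> 0"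
    "\<And>i. i \<in> Basis \<Longrightarrow> eventually (\<lambda>z. \<bar>pd i f z\<bar> \<le> C i * norm z ^ k) (nhds 0)" by auto
  have "eventually (\<lambda>z. f differentiable (at z) \<and> (\<forall>i\<in>Basis. \<bar>pd i f z\<bar> \<le> C i * norm z ^ k)) (nhds 0)"
    using C(2) by (intro eventually_conj germ_differentiable[OF *(1)] eventually_ball_finite) auto
  then obtain r where r: "r > 0" "\<And>z. dist z 0 < r \<Longrightarrow> f differentiable (at z)"
    "\<And>z i. dist z 0 < r \<Longrightarrow> i \<in> Basis \<Longrightarrow> \<bar>pd i f z\<bar> \<le> C i * norm z ^ k"
    unfolding eventually_nhds_metric by blast
  define K where "K = (\<Sum>i\<in>Basis. C i)"
  have "\<bar>f z\<bar> \<le> K * norm z ^ Suc k" if z: "dist z 0 < r" for z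
  proof -
    have nb: "dist (0 + s *\<^sub>R z) 0 < r" if "0 \<le> s" "s \<le> 1" for s
    proof -
      have "norm (s *\<^sub>R z) \<le> norm z" using that by (simp add: mult_left_le_one_le)
      then show ?thesis using z by simp
    qed
    have "\<exists>s>0. s < 1 \<and> f (0 + 1 *\<^sub>R z) - f (0 + 0 *\<^sub>R z) = (1 - 0) * pd z f (0 + s *\<^sub>R z)"
      by (rule MVT2) (auto intro!: pd_line r(2) nb simp del: add_0_left scaleR_one)
    then obtain s where s: "0 < s" "s < 1" "f z = pd z f (s *\<^sub>R z)" using *(2) by auto
    have d: "dist (s *\<^sub>R z) 0 < r" using nb[of s] s by simp
    have "norm (s *\<^sub>R z) \<le> norm z" using s by (simp add: mult_left_le_one_le)
    then have p: "norm (s *\<^sub>R z) ^ k \<le> norm z ^ k" by (rule power_mono) simp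
    have "\<bar>f z\<bar> = \<bar>\<Sum>i\<in>Basis. (z \<bullet> i) * pd i f (s *\<^sub>R z)\<bar>"
      unfolding s(3) pd_basis_sum[OF r(2)[OF d], of z] ..
    also have "\<dots> \<le> (\<Sum>i\<in>Basis. norm z * (C i * norm z ^ k))"
    proof (rule order_trans[OF sum_abs], rule sum_mono)
      fix i :: 'a assume i: "i \<in> Basis"
      have "\<bar>pd i f (s *\<^sub>R z)\<bar> \<le> C i * norm z ^ k"
        using r(3)[OF d i] mult_left_mono[OF p C(1)[OF i]] by linarith
      then show "\<bar>(z \<bullet> i) * pd i f (s *\<^sub>R z)\<bar> \<le> norm z * (C i * norm z ^ k)"
        unfolding abs_mult using Basis_le_norm[OF i] by (intro mult_mono) auto
    qed
    also have "\<dots> = K * norm z ^ Suc k" by (simp add: K_def sum_distrib_right sum_distrib_left mult_ac)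
    finally show ?thesis .
  qed
  then have "eventually (\<lambda>z. \<bar>f z\<bar> \<le> K * norm z ^ Suc k) (nhds 0)"
    unfolding eventually_nhds_metric using r(1) by blast
  moreover have "K \<ge> 0" unfolding K_def using C(1) by (rule sum_nonneg)
  ultimately show ?case by blast
qed

lemma flat_ray_integral:
  assumes r: "r > 0" and e: "e \<in> Basis"
  shows "smooth_on (ball 0 r) w \<Longrightarrow> flat k w \<Longrightarrow> flat k (ray_integral n e w)"
proof (induction k arbitrary: n w)
  case 0 then show ?case using r by (auto intro!: germI[OF smooth_on_ray_integral[OF _ e]])
next
  case (Suc k)
  have g: "germ (ray_integral n e w)"
    using r by (intro germI[OF smooth_on_ray_integral[OF Suc.prems(1) e]]) auto
  have z: "ray_integral n e w 0 = 0"
    using Suc.prems by (simp add: ray_integral_def rescale_def)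
  have "flat k (\<lambda>z. \<Sum>i\<in>Basis. (v \<bullet> i) * ray_integral (if i = e then Suc n else n) e (pd i w) z)" for v
    using Suc.prems by (intro flat_sum finite_Basis flat_cmult Suc.IH smooth_on_pd(2)) auto
  moreover have "(\<lambda>z. \<Sum>i\<in>Basis. (v \<bullet> i) * ray_integral (if i = e then Suc n else n) e (pd i w) z)
      \<doteq> pd v (ray_integral n e w)" for v
    unfolding eventually_nhds using r
    by (intro exI[of _ "ball 0 r"]) (auto simp: pd_eq[OF has_derivative_ray_integral[OF Suc.prems(1) e]])
  ultimately have "flat k (pd v (ray_integral n e w))" for v by (rule flat_cong)
  then show ?case using g z by simp
qed

text \<open>Integration starts at the hyperplane orthogonal to \<open>e\<close>. The factor
  \<open>z \<bullet> e\<close> of the solution makes it vanish there and raises its order of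
  vanishing by one.\<close>

lemma antiderivative:
  fixes w :: "'a::euclidean_space \<Rightarrow> real"
  assumes w: "germ w" and e: "e \<in> Basis"
  obtains u where "germ u" "pd e u \<doteq> w" "\<And>z. z \<bullet> e = 0 \<Longrightarrow> u z = 0"
    "\<And>k. flat k w \<Longrightarrow> flat (Suc k) u"
proof -
  obtain r where r: "r > 0" "smooth_on (ball 0 r) w" using germ_ball[OF w] .
  let ?u = "\<lambda>z. (z \<bullet> e) * ray_integral 0 e w z"
  have "germ ?u" using r by (intro germI[OF smooth_on_antiderivative[OF r(2) e]]) auto
  moreover have "pd e ?u \<doteq> w"
    unfolding eventually_nhds using r
    by (intro exI[of _ "ball 0 r"]) (auto simp: pd_antiderivative[OF r(2) e])
  moreover have "flat (Suc k) ?u" if "flat k w" for k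
  proof -
    have "flat (1 + k) ?u"
      by (rule flat_mult[OF _ flat_ray_integral[OF r(1) e r(2) that]], unfold flat_1)
         (auto intro!: germ_linear bounded_linear_inner_left)
    then show ?thesis by simp
  qed
  ultimately show ?thesis using that[of ?u] by simp
qed

subsection \<open>The homological operator\<close>

text \<open>Equality of Taylor polynomials of degree below \<open>k\<close> at the origin, for
  germs.\<close>

definition feq :: "nat \<Rightarrow> ('a::euclidean_space \<Rightarrow> real) \<Rightarrow> ('a \<Rightarrow> real) \<Rightarrow> bool" where
  "feq k f g \<longleftrightarrow> flat k (\<lambda>z. f z - g z)"

lemma feq_refl: "feq k f f"
  by (simp add: feq_def)

lemma feq_trans [trans]: "feq k f g \<Longrightarrow> feq k g h \<Longrightarrow> feq k f h"
  unfolding feq_def by (drule (1) flat_add) simp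

lemma feq_add: "feq k f g \<Longrightarrow> feq k f' g' \<Longrightarrow> feq k (\<lambda>z. f z + f' z) (\<lambda>z. g z + g' z)"
  unfolding feq_def by (drule (1) flat_add) (simp add: algebra_simps)

lemma feq_cmult: "feq k f g \<Longrightarrow> feq k (\<lambda>z. c * f z) (\<lambda>z. c * g z)"
  unfolding feq_def by (drule flat_cmult[where c = c]) (simp add: algebra_simps)

lemma feq_germ_eq:
  assumes "f \<doteq> g"
  shows "feq k f g"
proof -
  have "(\<lambda>_. 0) \<doteq> (\<lambda>z. f z - g z)" using assms by (rule eventually_mono) simp
  then show ?thesis unfolding feq_def by (rule flat_cong[OF flat_zero])
qed

lemma feq_flat: "feq k f g \<Longrightarrow> flat k g \<Longrightarrow> flat k f"
  unfolding feq_def by (drule (1) flat_add) simp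

lemma flat_feq_0: "flat k f \<longleftrightarrow> feq k f (\<lambda>_. 0)"
  by (simp add: feq_def)

lemmas germ_intros = germ_const germ_add germ_mult germ_diff germ_pd

text \<open>Covers the Lie derivative along a field (\<open>s = 0\<close>) and \<open>D u = u \<circ> f - u\<close> for a map \<open>f\<close>
  (\<open>s = 1\<close>); \<open>M\<close> is the linear part of the field, respectively of \<open>f - id\<close>.\<close>
locale shift_operator =
  fixes D :: "('a::euclidean_space \<Rightarrow> real) \<Rightarrow> 'a \<Rightarrow> real" and s :: real
    and M :: "'a \<Rightarrow> 'a" and ex ey ez :: 'a
  assumes D_cong: "u \<doteq> v \<Longrightarrow> D u \<doteq> D v"
    and D_lin: "germ u \<Longrightarrow> germ v \<Longrightarrow> D (\<lambda>z. u z + c * v z) \<doteq> (\<lambda>z. D u z + c * D v z)"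
    and D_flat: "flat k u \<Longrightarrow> flat k (D u)"
    and D_zero: "germ u \<Longrightarrow> D u 0 = 0"
    and pd_D: "flat (Suc k) u \<Longrightarrow>
       feq (Suc k) (pd d (D u)) (\<lambda>z. D (pd d u) z + (pd (M d) u z + s * D (pd (M d) u) z))"
    and M_ex: "M ex = 0" and M_ey: "M ey = ex" and M_ez: "M ez = ey"
    and M_nilpotent: "(M ^^ 4) d = 0"
    and ex_Basis: "ex \<in> Basis"
begin

text \<open>The identity for a Lie derivative and composition with the map for a difference
  operator, so that one set of formulas serves both cases.\<close>

definition S :: "('a \<Rightarrow> real) \<Rightarrow> 'a \<Rightarrow> real" where
  "S u z = u z + s * D u z"

lemma D_germ: "germ u \<Longrightarrow> germ (D u)"
  using D_flat[of 0] by simp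

lemma Dn_flat: "flat k u \<Longrightarrow> flat k ((D ^^ n) u)"
  by (induction n) (auto intro: D_flat)

lemma Dn_germ: "germ u \<Longrightarrow> germ ((D ^^ n) u)"
  using Dn_flat[of 0] by simp

lemma S_germ: "germ u \<Longrightarrow> germ (S u)"
  unfolding S_def[abs_def] by (intro germ_intros D_germ)

lemma S_flat: "flat k u \<Longrightarrow> flat k (S u)"
  unfolding S_def[abs_def] by (intro flat_add flat_cmult D_flat)

lemma D_0: "D (\<lambda>_. 0) \<doteq> (\<lambda>_. 0)"
  using D_lin[of "\<lambda>_. 0" "\<lambda>_. 0" "-1"] by simp

lemma D_add: "germ u \<Longrightarrow> germ v \<Longrightarrow> D (\<lambda>z. u z + v z) \<doteq> (\<lambda>z. D u z + D v z)"
  using D_lin[of u v 1] by simp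

lemma D_diff: "germ u \<Longrightarrow> germ v \<Longrightarrow> D (\<lambda>z. u z - v z) \<doteq> (\<lambda>z. D u z - D v z)"
  using D_lin[of u v "-1"] by simp

lemma Dn_cong: "u \<doteq> v \<Longrightarrow> (D ^^ n) u \<doteq> (D ^^ n) v"
  by (induction n) (auto intro: D_cong)

lemma Dn_lin: "germ u \<Longrightarrow> germ v \<Longrightarrow> (D ^^ n) (\<lambda>z. u z + c * v z) \<doteq> (\<lambda>z. (D ^^ n) u z + c * (D ^^ n) v z)"
proof (induction n)
  case (Suc n)
  have "D ((D ^^ n) (\<lambda>z. u z + c * v z)) \<doteq> D (\<lambda>z. (D ^^ n) u z + c * (D ^^ n) v z)"
    by (rule D_cong[OF Suc.IH[OF Suc.prems]])
  also have "D (\<lambda>z. (D ^^ n) u z + c * (D ^^ n) v z) \<doteq> (\<lambda>z. D ((D ^^ n) u) z + c * D ((D ^^ n) v) z)"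
    using Suc.prems by (intro D_lin Dn_germ)
  finally show ?case by simp
qed simp

lemma feq_D:
  assumes "feq k f g" "germ f" "germ g"
  shows "feq k (D f) (D g)"
proof -
  have "flat k (D (\<lambda>z. f z - g z))" using assms(1) unfolding feq_def by (rule D_flat)
  then show ?thesis unfolding feq_def using D_diff[OF assms(2,3)] by (rule flat_cong)
qed

lemma feq_Dn: "feq k f g \<Longrightarrow> germ f \<Longrightarrow> germ g \<Longrightarrow> feq k ((D ^^ n) f) ((D ^^ n) g)"
  by (induction n) (auto intro: feq_D Dn_germ)

lemma D_S:
  assumes "germ u"
  shows "D (S u) \<doteq> S (D u)"
  unfolding S_def[abs_def] using assms by (intro D_lin D_germ)

lemma Dn_S:
  assumes "germ u"
  shows "(D ^^ n) (S u) \<doteq> S ((D ^^ n) u)"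
  using Dn_lin[of u "D u" n s] assms by (simp add: S_def[abs_def] D_germ funpow_swap1)

text \<open>The commutation rule \<open>[pd v, D] = S (pd (M v))\<close> on functions of order
  \<open>Suc k\<close>. The nonlinear part of the field or map contributes only products of a
  function vanishing at the origin with one of order \<open>k\<close>.\<close>

lemma pd_D_S: "flat (Suc k) u \<Longrightarrow>
    feq (Suc k) (pd v (D u)) (\<lambda>z. D (pd v u) z + S (pd (M v) u) z)"
  unfolding S_def by (rule pd_D)

section \<open>Nilpotence on each order of vanishing\<close>

lemma pd_0: "germ u \<Longrightarrow> pd 0 u \<doteq> (\<lambda>_. 0)"
  by (drule germ_differentiable, erule eventually_mono) simp

lemma flat_pd_0: "germ u \<Longrightarrow> flat k (pd 0 u)"
  by (rule flat_cong[OF flat_zero germ_eq_sym[OF pd_0]])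

text \<open>Moving \<open>pd v\<close> to the right past one \<open>D\<close> either keeps that
  \<open>D\<close> on the left or spends it to replace \<open>v\<close> by \<open>M v\<close>. After
  \<open>j\<close> losses the direction is zero, so every surviving term has at least
  \<open>N\<close> copies of \<open>D\<close> in front of a derivative of \<open>w\<close>, which is
  of order \<open>k\<close>.\<close>

lemma Dn_flat_Suc_step:
  assumes N: "\<And>w n. flat k w \<Longrightarrow> N \<le> n \<Longrightarrow> flat (Suc k) ((D ^^ n) w)" and w: "flat (Suc k) w"
  shows "(M ^^ j) v = 0 \<Longrightarrow> N + j \<le> a + n \<Longrightarrow> flat (Suc k) ((D ^^ a) (pd v ((D ^^ n) w)))"
proof (induction n arbitrary: a j v)
  case 0
  have "flat k (pd v w)" using w by (rule flat_pd)
  then show ?case using 0 N[of "pd v w" a] by (simp del: flat.simps)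
next
  case (Suc n)
  have gw: "germ ((D ^^ n) w)" by (intro Dn_germ flat_germ[OF w])
  show ?case
  proof (cases j)
    case 0
    then have "v = 0" using Suc.prems by simp
    then show ?thesis by (simp only:) (intro Dn_flat flat_pd_0 Dn_germ flat_germ[OF w])
  next
    case (Suc j')
    let ?f = "D (pd v ((D ^^ n) w))" and ?g = "S (pd (M v) ((D ^^ n) w))"
    have g: "germ ?f" "germ ?g" "germ (pd (M v) ((D ^^ n) w))" by (intro D_germ S_germ germ_pd gw)+
    have "feq (Suc k) ((D ^^ a) (pd v ((D ^^ Suc n) w))) ((D ^^ a) (\<lambda>z. ?f z + ?g z))"
      using pd_D_S[OF Dn_flat[OF w], of v n] g gw by (intro feq_Dn) (auto intro!: germ_intros D_germ)
    also have "feq (Suc k) \<dots> (\<lambda>z. (D ^^ a) ?f z + (D ^^ a) ?g z)"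
      using Dn_lin[OF g(1,2), of a 1] by (intro feq_germ_eq) simp
    finally have eq: "feq (Suc k) ((D ^^ a) (pd v ((D ^^ Suc n) w))) (\<lambda>z. (D ^^ a) ?f z + (D ^^ a) ?g z)" .
    have "flat (Suc k) ((D ^^ Suc a) (pd v ((D ^^ n) w)))"
      using Suc.prems by (intro Suc.IH[of j]) auto
    then have 1: "flat (Suc k) ((D ^^ a) ?f)" by (simp only: funpow_Suc_right o_apply)
    have "flat (Suc k) ((D ^^ a) (pd (M v) ((D ^^ n) w)))"
      using Suc.prems \<open>j = Suc j'\<close> by (intro Suc.IH[of j']) (auto simp: funpow_swap1)
    then have 2: "flat (Suc k) ((D ^^ a) ?g)"
      by (intro flat_cong[OF S_flat germ_eq_sym[OF Dn_S[OF g(3)]]])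
    show ?thesis by (rule feq_flat[OF eq flat_add[OF 1 2]])
  qed
qed

text \<open>The number of iterations is uniform in \<open>w\<close>: it is 1 for order 0, because
  \<open>D w\<close> vanishes at the origin, and grows by 4 with each order, the price of
  differentiating once.\<close>

lemma Dn_flat_Suc: "\<exists>N. \<forall>w n. flat k w \<longrightarrow> N \<le> n \<longrightarrow> flat (Suc k) ((D ^^ n) w)"
proof (induction k)
  case 0
  show ?case
  proof (intro exI[of _ 1] allI impI)
    fix w :: "'a \<Rightarrow> real" and n :: nat assume w: "flat 0 w" and "1 \<le> n"
    then obtain m where "n = Suc m" by (cases n) auto
    then show "flat (Suc 0) ((D ^^ n) w)"
      using w by (simp only: flat_1) (auto intro!: D_germ Dn_germ D_zero)
  qed
next
  case (Suc k)
  then obtain N where N: "\<And>w n. flat k w \<Longrightarrow> N \<le> n \<Longrightarrow> flat (Suc k) ((D ^^ n) w)" by blast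
  show ?case
  proof (intro exI[of _ "N + 4"] allI impI)
    fix w :: "'a \<Rightarrow> real" and n :: nat assume w: "flat (Suc k) w" and n: "N + 4 \<le> n"
    have "flat (Suc k) ((D ^^ 0) (pd v ((D ^^ n) w)))" for v
      by (rule Dn_flat_Suc_step[where N = N and j = 4, OF N w M_nilpotent]) (use n in auto)
    moreover have "((D ^^ n) w) 0 = 0" using Dn_flat[OF w, of n] by simp
    ultimately show "flat (Suc (Suc k)) ((D ^^ n) w)"
      using Dn_germ[OF flat_germ[OF w], of n] by simp
  qed
qed

section \<open>Leading terms under commutation\<close>

text \<open>\<open>f\<close> is \<open>a D\<^sup>n w\<close> up to the range of \<open>D\<^sup>n\<^sup>+\<^sup>1\<close> and modulo order \<open>k + 1\<close>.\<close>
definition lead :: "nat \<Rightarrow> nat \<Rightarrow> real \<Rightarrow> ('a \<Rightarrow> real) \<Rightarrow> ('a \<Rightarrow> real) \<Rightarrow> bool" where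
  "lead k n a f w \<longleftrightarrow> germ f \<and> (\<exists>r. flat k r \<and> feq (Suc k) f (\<lambda>z. a * (D ^^ n) w z + (D ^^ Suc n) r z))"

lemma leadI: "germ f \<Longrightarrow> flat k r \<Longrightarrow> feq (Suc k) f (\<lambda>z. a * (D ^^ n) w z + (D ^^ Suc n) r z) \<Longrightarrow> lead k n a f w"
  unfolding lead_def by blast

lemma lead_feq: "lead k n a f w \<Longrightarrow> feq (Suc k) g f \<Longrightarrow> germ g \<Longrightarrow> lead k n a g w"
  unfolding lead_def using feq_trans by blast

lemma lead_add:
  assumes "lead k n a f w" "lead k n b g w"
  shows "lead k n (a + b) (\<lambda>z. f z + g z) w"
proof -
  obtain r q where r: "germ f" "flat k r" "feq (Suc k) f (\<lambda>z. a * (D ^^ n) w z + (D ^^ Suc n) r z)"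
    and q: "germ g" "flat k q" "feq (Suc k) g (\<lambda>z. b * (D ^^ n) w z + (D ^^ Suc n) q z)"
    using assms unfolding lead_def by blast
  have gg: "germ r" "germ q" using r q flat_germ by blast+
  have "feq (Suc k) (\<lambda>z. f z + g z) (\<lambda>z. (a * (D ^^ n) w z + (D ^^ Suc n) r z) + (b * (D ^^ n) w z + (D ^^ Suc n) q z))"
    by (rule feq_add[OF r(3) q(3)])
  also have "feq (Suc k) \<dots> (\<lambda>z. (a + b) * (D ^^ n) w z + (D ^^ Suc n) (\<lambda>z. r z + q z) z)"
  proof (rule feq_germ_eq)
    have "(D ^^ Suc n) (\<lambda>z. r z + q z) \<doteq> (\<lambda>z. (D ^^ Suc n) r z + (D ^^ Suc n) q z)"
      using Dn_lin[OF gg, of "Suc n" 1] by (simp only: mult_1_left)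
    then show "(\<lambda>z. (a * (D ^^ n) w z + (D ^^ Suc n) r z) + (b * (D ^^ n) w z + (D ^^ Suc n) q z))
      \<doteq> (\<lambda>z. (a + b) * (D ^^ n) w z + (D ^^ Suc n) (\<lambda>z. r z + q z) z)"
      by (rule eventually_mono) (simp only: distrib_right)
  qed
  finally have eq: "feq (Suc k) (\<lambda>z. f z + g z) (\<lambda>z. (a + b) * (D ^^ n) w z + (D ^^ Suc n) (\<lambda>z. r z + q z) z)" .
  show ?thesis by (rule leadI[OF germ_add[OF r(1) q(1)] flat_add[OF r(2) q(2)] eq])
qed

lemma lead_D:
  assumes "lead k n a f w" "germ w"
  shows "lead k (Suc n) a (D f) w"
proof -
  obtain r where r: "germ f" "flat k r" "feq (Suc k) f (\<lambda>z. a * (D ^^ n) w z + (D ^^ Suc n) r z)"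
    using assms unfolding lead_def by blast
  have g: "germ ((D ^^ n) w)" "germ ((D ^^ Suc n) r)" "germ r"
    using assms(2) flat_germ[OF r(2)] by (auto intro: Dn_germ simp del: funpow.simps)
  have "feq (Suc k) (D f) (D (\<lambda>z. a * (D ^^ n) w z + (D ^^ Suc n) r z))"
    by (intro feq_D r germ_intros g)
  also have "D (\<lambda>z. (D ^^ Suc n) r z + a * (D ^^ n) w z) \<doteq> (\<lambda>z. D ((D ^^ Suc n) r) z + a * D ((D ^^ n) w) z)"
    by (intro D_lin g)
  then have "feq (Suc k) (D (\<lambda>z. a * (D ^^ n) w z + (D ^^ Suc n) r z)) (\<lambda>z. a * (D ^^ Suc n) w z + (D ^^ Suc (Suc n)) r z)"
    by (intro feq_germ_eq) (simp add: add.commute)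
  finally have eq: "feq (Suc k) (D f) (\<lambda>z. a * (D ^^ Suc n) w z + (D ^^ Suc (Suc n)) r z)" .
  show ?thesis by (rule leadI[OF D_germ[OF r(1)] r(2) eq])
qed

text \<open>A leading term with \<open>D^(n+1)\<close> already lies in the range that counts as
  remainder: the new remainder is \<open>D r + a w\<close>.\<close>

lemma lead_Suc_0:
  assumes "lead k (Suc n) a f w" "flat k w"
  shows "lead k n 0 f w"
proof -
  obtain r where r: "germ f" "flat k r" "feq (Suc k) f (\<lambda>z. a * (D ^^ Suc n) w z + (D ^^ Suc (Suc n)) r z)"
    using assms unfolding lead_def by blast
  note r(3)
  also have "feq (Suc k) (\<lambda>z. a * (D ^^ Suc n) w z + (D ^^ Suc (Suc n)) r z) (\<lambda>z. 0 * (D ^^ n) w z + (D ^^ Suc n) (\<lambda>z. D r z + a * w z) z)"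
  proof (rule feq_germ_eq)
    have "(D ^^ Suc n) (\<lambda>z. D r z + a * w z) \<doteq> (\<lambda>z. (D ^^ Suc n) (D r) z + a * (D ^^ Suc n) w z)"
      using flat_germ[OF r(2)] flat_germ[OF assms(2)] by (intro Dn_lin D_germ)
    then show "(\<lambda>z. a * (D ^^ Suc n) w z + (D ^^ Suc (Suc n)) r z)
      \<doteq> (\<lambda>z. 0 * (D ^^ n) w z + (D ^^ Suc n) (\<lambda>z. D r z + a * w z) z)"
      by (rule eventually_mono) (simp add: funpow_swap1)
  qed
  finally have eq: "feq (Suc k) f (\<lambda>z. 0 * (D ^^ n) w z + (D ^^ Suc n) (\<lambda>z. D r z + a * w z) z)" .
  show ?thesis by (rule leadI[OF r(1) flat_add[OF D_flat[OF r(2)] flat_cmult[OF assms(2)]] eq])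
qed

lemma lead_0_cmult:
  assumes "lead k n 0 f w"
  shows "lead k n 0 (\<lambda>z. c * f z) w"
proof -
  obtain r where r: "germ f" "flat k r" "feq (Suc k) f (\<lambda>z. 0 * (D ^^ n) w z + (D ^^ Suc n) r z)"
    using assms unfolding lead_def by blast
  have "feq (Suc k) (\<lambda>z. c * f z) (\<lambda>z. c * (0 * (D ^^ n) w z + (D ^^ Suc n) r z))"
    by (rule feq_cmult[OF r(3)])
  also have "feq (Suc k) \<dots> (\<lambda>z. 0 * (D ^^ n) w z + (D ^^ Suc n) (\<lambda>z. 0 + c * r z) z)"
  proof (rule feq_germ_eq)
    have "(D ^^ Suc n) (\<lambda>z. 0 + c * r z) \<doteq> (\<lambda>z. (D ^^ Suc n) (\<lambda>_. 0) z + c * (D ^^ Suc n) r z)"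
      by (intro Dn_lin germ_const flat_germ[OF r(2)])
    moreover have "(D ^^ Suc n) (\<lambda>_. 0) \<doteq> (\<lambda>_. 0)"
      using Dn_lin[of "\<lambda>_. 0" "\<lambda>_. 0" "Suc n" "-1"] by (simp del: funpow.simps)
    ultimately show "(\<lambda>z. c * (0 * (D ^^ n) w z + (D ^^ Suc n) r z)) \<doteq> (\<lambda>z. 0 * (D ^^ n) w z + (D ^^ Suc n) (\<lambda>z. 0 + c * r z) z)"
      by (rule eventually_elim2) (simp del: funpow.simps)
  qed
  finally have eq: "feq (Suc k) (\<lambda>z. c * f z) (\<lambda>z. 0 * (D ^^ n) w z + (D ^^ Suc n) (\<lambda>z. 0 + c * r z) z)" .
  show ?thesis by (rule leadI[OF germ_cmult[OF r(1)] flat_add[OF flat_zero flat_cmult[OF r(2)]] eq])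
qed

text \<open>\<open>S f\<close> differs from \<open>f\<close> by a multiple of \<open>D f\<close>,
  which only affects the remainder. Hence the map case has the same leading coefficients as the
  field case.\<close>

lemma lead_S:
  assumes "lead k n a f w" "flat k w"
  shows "lead k n a (S f) w"
proof -
  have "lead k n (a + 0) (\<lambda>z. f z + s * D f z) w"
    using assms by (intro lead_add lead_0_cmult lead_Suc_0[OF lead_D]) (auto intro: flat_germ)
  then show ?thesis by (simp add: S_def[abs_def])
qed

context
  fixes k :: nat and u :: "'a \<Rightarrow> real"
  assumes u: "flat (Suc k) u"
begin

lemma u_germ: "germ u" "germ ((D ^^ n) u)" "flat k (pd v u)" "germ (pd v u)"
proof -
  show g: "germ u" using u by simp
  then show "germ ((D ^^ n) u)" by (rule Dn_germ)
  show "flat k (pd v u)" using u by simp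
  show "germ (pd v u)" using g by (rule germ_pd)
qed

text \<open>As \<open>M ex = 0\<close>, the derivative along \<open>ex\<close> commutes with
  \<open>D\<close> to the order considered, so the coefficient stays 1.\<close>

lemma lead_pd_x: "lead k n 1 (pd ex ((D ^^ n) u)) (pd ex u)"
proof (induction n)
  case 0
  have "pd ex u \<doteq> (\<lambda>z. 1 * (D ^^ 0) (pd ex u) z + (D ^^ Suc 0) (\<lambda>_. 0) z)"
    using D_0 by (rule eventually_mono) simp
  then show ?case using u_germ(4) by (intro leadI[of _ _ "\<lambda>_. 0"] feq_germ_eq) simp_all
next
  case (Suc n)
  have "feq (Suc k) (pd ex (D ((D ^^ n) u))) (\<lambda>z. D (pd ex ((D ^^ n) u)) z + S (pd 0 ((D ^^ n) u)) z)"
    using pd_D_S[OF Dn_flat[OF u], of ex n] by (simp only: M_ex)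
  also have "feq (Suc k) \<dots> (\<lambda>z. D (pd ex ((D ^^ n) u)) z + 0)"
    by (intro feq_add feq_refl flat_feq_0[THEN iffD1] S_flat flat_pd_0 u_germ)
  finally have "feq (Suc k) (pd ex ((D ^^ Suc n) u)) (D (pd ex ((D ^^ n) u)))" by simp
  with lead_D[OF Suc.IH u_germ(4)] show ?case
    by (rule lead_feq) (intro germ_pd u_germ)
qed

text \<open>The outer \<open>D\<close> starts the recursion: \<open>pd ey u\<close> has no relation
  to \<open>pd ex u\<close>, but \<open>D (pd ey u)\<close> lies in the range of \<open>D\<close>
  and so has coefficient 0. Each commutation adds one copy of \<open>D^n (pd ex u)\<close>; the
  recursion gives \<open>n\<close> with the outer \<open>D\<close>, and \<open>n + 1\<close> for
  \<open>lead_pd_y\<close>.\<close>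

lemma lead_D_pd_y: "\<exists>a\<ge>0. lead k n a (D (pd ey ((D ^^ n) u))) (pd ex u)"
  and lead_pd_y: "\<exists>a\<ge>0. lead k n a (pd ey ((D ^^ Suc n) u)) (pd ex u)"
proof -
  have step: "\<exists>a\<ge>0. lead k n a (pd ey ((D ^^ Suc n) u)) (pd ex u)"
    if ih: "\<exists>a\<ge>0. lead k n a (D (pd ey ((D ^^ n) u))) (pd ex u)" for n
  proof -
    obtain a where a: "a \<ge> 0" "lead k n a (D (pd ey ((D ^^ n) u))) (pd ex u)" using ih by blast
    have "lead k n (a + 1) (\<lambda>z. D (pd ey ((D ^^ n) u)) z + S (pd ex ((D ^^ n) u)) z) (pd ex u)"
      by (rule lead_add[OF a(2) lead_S[OF lead_pd_x u_germ(3)]])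
    moreover have "feq (Suc k) (pd ey ((D ^^ Suc n) u)) (\<lambda>z. D (pd ey ((D ^^ n) u)) z + S (pd ex ((D ^^ n) u)) z)"
      using pd_D_S[OF Dn_flat[OF u], of ey n] by (simp add: M_ey)
    ultimately have "lead k n (a + 1) (pd ey ((D ^^ Suc n) u)) (pd ex u)"
      by (rule lead_feq) (intro germ_pd u_germ)
    then show ?thesis using a(1) by (intro exI[of _ "a + 1"]) auto
  qed
  show 1: "\<exists>a\<ge>0. lead k n a (D (pd ey ((D ^^ n) u))) (pd ex u)" for n
  proof (induction n)
    case 0
    have "lead k 0 0 (D (pd ey u)) (pd ex u)"
      by (rule leadI[of _ _ "pd ey u"]) (auto intro!: feq_refl D_germ u_germ)
    then show ?case by auto
  next
    case (Suc n)
    from step[OF this] show ?case using lead_D u_germ(4) by blast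
  qed
  show "\<exists>a\<ge>0. lead k n a (pd ey ((D ^^ Suc n) u)) (pd ex u)" by (rule step[OF 1])
qed

text \<open>Commuting \<open>pd ez\<close> past \<open>D\<close> leaves a derivative along
  \<open>ey\<close>, which is controlled only behind a \<open>D\<close>; hence one more outer
  \<open>D\<close> than before. The coefficients \<open>0, 1, 2, ...\<close> of
  \<open>lead_D_pd_y\<close> accumulate to \<open>n (n + 1) / 2\<close>.\<close>

lemma lead_D_D_pd_z: "\<exists>a\<ge>0. lead k n a (D (D (pd ez ((D ^^ n) u)))) (pd ex u)"
  and lead_D_pd_z: "\<exists>a\<ge>0. lead k n a (D (pd ez ((D ^^ Suc n) u))) (pd ex u)"
proof -
  have step: "\<exists>a\<ge>0. lead k n a (D (pd ez ((D ^^ Suc n) u))) (pd ex u)"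
    if ih: "\<exists>a\<ge>0. lead k n a (D (D (pd ez ((D ^^ n) u)))) (pd ex u)" for n
  proof -
    let ?f = "D (pd ez ((D ^^ n) u))" and ?g = "pd ey ((D ^^ n) u)"
    obtain a where a: "a \<ge> 0" "lead k n a (D ?f) (pd ex u)" using ih by blast
    obtain b where b: "b \<ge> 0" "lead k n b (D ?g) (pd ex u)" using lead_D_pd_y by blast
    have g: "germ ?f" "germ ?g" by (intro D_germ germ_pd u_germ)+
    have "lead k n (a + b) (\<lambda>z. D ?f z + S (D ?g) z) (pd ex u)"
      by (rule lead_add[OF a(2) lead_S[OF b(2) u_germ(3)]])
    moreover have "feq (Suc k) (D (pd ez ((D ^^ Suc n) u))) (\<lambda>z. D ?f z + S (D ?g) z)"
    proof -
      have "feq (Suc k) (pd ez (D ((D ^^ n) u))) (\<lambda>z. ?f z + S ?g z)"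
        using pd_D_S[OF Dn_flat[OF u], of ez n] by (simp add: M_ez)
      then have "feq (Suc k) (D (pd ez (D ((D ^^ n) u)))) (D (\<lambda>z. ?f z + S ?g z))"
        by (rule feq_D) (intro germ_intros S_germ D_germ g u_germ)+
      also have "D (\<lambda>z. ?f z + S ?g z) \<doteq> (\<lambda>z. D ?f z + D (S ?g) z)"
        by (intro D_add g S_germ)
      then have "feq (Suc k) (D (\<lambda>z. ?f z + S ?g z)) (\<lambda>z. D ?f z + D (S ?g) z)"
        by (rule feq_germ_eq)
      also have "feq (Suc k) \<dots> (\<lambda>z. D ?f z + S (D ?g) z)"
        by (intro feq_add feq_refl feq_germ_eq D_S g)
      finally show ?thesis by simp
    qed
    ultimately have "lead k n (a + b) (D (pd ez ((D ^^ Suc n) u))) (pd ex u)"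
      by (rule lead_feq) (intro D_germ germ_pd u_germ)
    then show ?thesis using a(1) b(1) by (intro exI[of _ "a + b"]) auto
  qed
  show 1: "\<exists>a\<ge>0. lead k n a (D (D (pd ez ((D ^^ n) u)))) (pd ex u)" for n
  proof (induction n)
    case 0
    have "lead k 0 0 (D (D (pd ez u))) (pd ex u)"
      by (rule leadI[of _ _ "D (pd ez u)"]) (auto intro!: feq_refl D_germ D_flat u_germ)
    then show ?case by auto
  next
    case (Suc n)
    from step[OF this] show ?case using lead_D u_germ(4) by blast
  qed
  show "\<exists>a\<ge>0. lead k n a (D (pd ez ((D ^^ Suc n) u))) (pd ex u)" by (rule step[OF 1])
qed

text \<open>The last commutation produces \<open>pd ey\<close> of \<open>D^(n+1) u\<close>, for
  which a leading term is known without an outer \<open>D\<close>. The coefficient becomes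
  \<open>(n + 1) (n + 2) / 2\<close>.\<close>

lemma lead_pd_z: "\<exists>a\<ge>0. lead k n a (pd ez ((D ^^ Suc (Suc n)) u)) (pd ex u)"
proof -
  let ?f = "D (pd ez ((D ^^ Suc n) u))" and ?g = "pd ey ((D ^^ Suc n) u)"
  obtain a where a: "a \<ge> 0" "lead k n a ?f (pd ex u)" using lead_D_pd_z by blast
  obtain b where b: "b \<ge> 0" "lead k n b ?g (pd ex u)" using lead_pd_y by blast
  have "lead k n (a + b) (\<lambda>z. ?f z + S ?g z) (pd ex u)"
    by (rule lead_add[OF a(2) lead_S[OF b(2) u_germ(3)]])
  moreover have "feq (Suc k) (pd ez ((D ^^ Suc (Suc n)) u)) (\<lambda>z. ?f z + S ?g z)"
    using pd_D_S[OF Dn_flat[OF u], of ez "Suc n"] by (simp add: M_ez)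
  ultimately have "lead k n (a + b) (pd ez ((D ^^ Suc (Suc n)) u)) (pd ex u)"
    by (rule lead_feq) (intro germ_pd u_germ)
  then show ?thesis using a(1) b(1) by (intro exI[of _ "a + b"]) auto
qed

end

section \<open>Surjectivity of the linearised volume equation\<close>

definition T :: "('a \<Rightarrow> real) \<Rightarrow> 'a \<Rightarrow> real" where
  "T h z = pd ex (S h) z + pd ey (D (S h)) z + pd ez (D (D h)) z"


lemma pd_S:
  assumes "germ h"
  shows "pd v (S h) \<doteq> (\<lambda>z. pd v h z + s * pd v (D h) z)"
proof -
  have "pd v (S h) \<doteq> (\<lambda>z. pd v h z + pd v (\<lambda>z. s * D h z) z)"
    unfolding S_def[abs_def] using assms by (intro pd_add germ_cmult D_germ)
  then show ?thesis using pd_cmult[OF D_germ[OF assms], of v s] by (rule eventually_elim2) simp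
qed

lemma T_expand:
  assumes "germ h"
  shows "T h \<doteq> (\<lambda>z. (pd ex h z + s * pd ex (D h) z) + (pd ey (D h) z + s * pd ey (D (D h)) z) + pd ez (D (D h)) z)"
proof -
  have "pd ey (D (S h)) \<doteq> pd ey (S (D h))" by (intro pd_cong D_S assms)
  also have "pd ey (S (D h)) \<doteq> (\<lambda>z. pd ey (D h) z + s * pd ey (D (D h)) z)"
    by (intro pd_S D_germ assms)
  finally have "pd ey (D (S h)) \<doteq> (\<lambda>z. pd ey (D h) z + s * pd ey (D (D h)) z)" .
  with pd_S[OF assms, of ex] show ?thesis by (rule eventually_elim2) (simp add: T_def)
qed

lemma T_germ: "germ h \<Longrightarrow> germ (T h)"
  unfolding T_def[abs_def] by (intro germ_add germ_pd S_germ D_germ)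

lemma T_flat: "flat (Suc k) h \<Longrightarrow> flat k (T h)"
  unfolding T_def[abs_def] by (intro flat_add flat_pd S_flat D_flat)

lemma S_lin:
  assumes "germ f" "germ g"
  shows "S (\<lambda>z. f z + c * g z) \<doteq> (\<lambda>z. S f z + c * S g z)"
  using D_lin[OF assms, of c] by (rule eventually_mono) (simp add: S_def algebra_simps)

lemma pd_lin:
  assumes "germ f" "germ g"
  shows "pd v (\<lambda>z. f z + c * g z) \<doteq> (\<lambda>z. pd v f z + c * pd v g z)"
proof -
  have "pd v (\<lambda>z. f z + c * g z) \<doteq> (\<lambda>z. pd v f z + pd v (\<lambda>z. c * g z) z)"
    by (intro pd_add germ_cmult assms)
  then show ?thesis using pd_cmult[OF assms(2), of v c] by (rule eventually_elim2) simp
qed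

lemma components_lin:
  assumes "germ f" "germ g"
  shows "S (\<lambda>z. f z + c * g z) \<doteq> (\<lambda>z. S f z + c * S g z)"
    "D (S (\<lambda>z. f z + c * g z)) \<doteq> (\<lambda>z. D (S f) z + c * D (S g) z)"
    "D (D (\<lambda>z. f z + c * g z)) \<doteq> (\<lambda>z. D (D f) z + c * D (D g) z)"
proof -
  show "S (\<lambda>z. f z + c * g z) \<doteq> (\<lambda>z. S f z + c * S g z)" by (rule S_lin[OF assms])
  from D_cong[OF this] D_lin[OF S_germ[OF assms(1)] S_germ[OF assms(2)]]
  show "D (S (\<lambda>z. f z + c * g z)) \<doteq> (\<lambda>z. D (S f) z + c * D (S g) z)" by (rule germ_eq_trans)
  from D_cong[OF D_lin[OF assms]] D_lin[OF D_germ[OF assms(1)] D_germ[OF assms(2)]]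
  show "D (D (\<lambda>z. f z + c * g z)) \<doteq> (\<lambda>z. D (D f) z + c * D (D g) z)" by (rule germ_eq_trans)
qed

lemma T_lin:
  assumes "germ f" "germ g"
  shows "T (\<lambda>z. f z + c * g z) \<doteq> (\<lambda>z. T f z + c * T g z)"
proof -
  have "pd ex (S (\<lambda>z. f z + c * g z)) \<doteq> (\<lambda>z. pd ex (S f) z + c * pd ex (S g) z)"
    by (rule germ_eq_trans[OF pd_cong[OF components_lin(1)[OF assms]] pd_lin]) (intro S_germ assms)+
  moreover have "pd ey (D (S (\<lambda>z. f z + c * g z))) \<doteq> (\<lambda>z. pd ey (D (S f)) z + c * pd ey (D (S g)) z)"
    by (rule germ_eq_trans[OF pd_cong[OF components_lin(2)[OF assms]] pd_lin]) (intro D_germ S_germ assms)+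
  moreover have "pd ez (D (D (\<lambda>z. f z + c * g z))) \<doteq> (\<lambda>z. pd ez (D (D f)) z + c * pd ez (D (D g)) z)"
    by (rule germ_eq_trans[OF pd_cong[OF components_lin(3)[OF assms]] pd_lin]) (intro D_germ assms)+
  ultimately have "\<forall>\<^sub>F z in nhds 0.
      pd ex (S (\<lambda>z. f z + c * g z)) z = pd ex (S f) z + c * pd ex (S g) z \<and>
      pd ey (D (S (\<lambda>z. f z + c * g z))) z = pd ey (D (S f)) z + c * pd ey (D (S g)) z \<and>
      pd ez (D (D (\<lambda>z. f z + c * g z))) z = pd ez (D (D f)) z + c * pd ez (D (D g)) z"
    by (intro eventually_conj)
  then show ?thesis by (rule eventually_mono) (simp add: T_def algebra_simps)
qed

text \<open>The three main terms contribute 1 and two nonnegative numbers, so nothing can cancel.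
  The terms with factor \<open>s\<close> carry one more \<open>D\<close> than their main terms and
  join the remainder.\<close>

lemma lead_T:
  assumes u: "flat (Suc k) u"
  shows "\<exists>a\<ge>1. lead k n a (T ((D ^^ n) u)) (pd ex u)"
proof -
  let ?h = "(D ^^ n) u"
  have w: "flat k (pd ex u)" using u by (rule flat_pd)
  have h: "germ ?h" by (intro Dn_germ flat_germ[OF u])
  obtain a where a: "a \<ge> 0" "lead k n a (pd ey ((D ^^ Suc n) u)) (pd ex u)" using lead_pd_y[OF u] by blast
  obtain a' where a': "lead k (Suc n) a' (pd ey ((D ^^ Suc (Suc n)) u)) (pd ex u)" using lead_pd_y[OF u] by blast
  obtain b where b: "b \<ge> 0" "lead k n b (pd ez ((D ^^ Suc (Suc n)) u)) (pd ex u)" using lead_pd_z[OF u] by blast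
  note x0 = lead_0_cmult[OF lead_Suc_0[OF lead_pd_x[OF u, of "Suc n"] w], of s]
  note y0 = lead_0_cmult[OF lead_Suc_0[OF a' w], of s]
  have "lead k n ((1 + 0) + (a + 0) + b) (\<lambda>z. (pd ex ?h z + s * pd ex ((D ^^ Suc n) u) z) +
     (pd ey ((D ^^ Suc n) u) z + s * pd ey ((D ^^ Suc (Suc n)) u) z) + pd ez ((D ^^ Suc (Suc n)) u) z) (pd ex u)"
    by (rule lead_add[OF lead_add[OF lead_add[OF lead_pd_x[OF u] x0] lead_add[OF a(2) y0]] b(2)])
  moreover have "feq (Suc k) (T ?h) (\<lambda>z. (pd ex ?h z + s * pd ex ((D ^^ Suc n) u) z) +
     (pd ey ((D ^^ Suc n) u) z + s * pd ey ((D ^^ Suc (Suc n)) u) z) + pd ez ((D ^^ Suc (Suc n)) u) z)"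
    using T_expand[OF h] by (intro feq_germ_eq) simp
  ultimately have "lead k n ((1 + 0) + (a + 0) + b) (T ?h) (pd ex u)"
    by (rule lead_feq) (rule T_germ[OF h])
  then show ?thesis using a(1) b(1) by (intro exI[of _ "(1 + 0) + (a + 0) + b"]) auto
qed

lemma T_surj_step:
  fixes w :: "'a \<Rightarrow> real"
  assumes ih: "\<And>w :: 'a \<Rightarrow> real. flat k w \<Longrightarrow> \<exists>h. flat (Suc k) h \<and> feq (Suc k) (T h) ((D ^^ Suc n) w)"
    and w: "flat k w"
  shows "\<exists>h. flat (Suc k) h \<and> feq (Suc k) (T h) ((D ^^ n) w)"
proof (rule antiderivative[OF flat_germ[OF w] ex_Basis])
  fix u assume u: "pd ex u \<doteq> w" and u3: "\<And>k. flat k w \<Longrightarrow> flat (Suc k) u"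
  note u2 = u3[OF w]
  obtain a where a: "a \<ge> 1" "lead k n a (T ((D ^^ n) u)) (pd ex u)" using lead_T[OF u2] by blast
  obtain r where r: "flat k r"
    "feq (Suc k) (T ((D ^^ n) u)) (\<lambda>z. a * (D ^^ n) (pd ex u) z + (D ^^ Suc n) r z)"
    using a(2) unfolding lead_def by blast
  obtain h where h: "flat (Suc k) h" "feq (Suc k) (T h) ((D ^^ Suc n) r)" using ih[OF r(1)] by blast
  \<comment> \<open>\<open>T\<close> sends \<open>D^n u\<close> to \<open>a D^n w\<close> plus an
    element of the range of \<open>D^(n+1)\<close>, which \<open>h\<close> cancels. The initial
    \<open>0 +\<close> and the factor \<open>-1\<close> give the expression the shape
    \<open>f + c g\<close> of \<open>T_lin\<close>.\<close>
  let ?h = "\<lambda>z. 0 + (1/a) * ((D ^^ n) u z + (-1) * h z)"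
  have g: "germ ((D ^^ n) u)" "germ h" using Dn_germ flat_germ[OF u2] flat_germ[OF h(1)] by auto
  have "T ?h \<doteq> (\<lambda>z. T (\<lambda>_. 0) z + (1/a) * T (\<lambda>z. (D ^^ n) u z + (-1) * h z) z)"
    by (intro T_lin germ_const germ_add germ_cmult g)
  moreover have "T (\<lambda>_. 0) \<doteq> (\<lambda>_. 0)" using T_lin[of "\<lambda>_. 0" "\<lambda>_. 0" "-1"] by simp
  moreover have "T (\<lambda>z. (D ^^ n) u z + (-1) * h z) \<doteq> (\<lambda>z. T ((D ^^ n) u) z + (-1) * T h z)"
    by (intro T_lin g)
  ultimately have "\<forall>\<^sub>F z in nhds 0. T ?h z = T (\<lambda>_. 0) z + (1/a) * T (\<lambda>z. (D ^^ n) u z + (-1) * h z) z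
     \<and> T (\<lambda>_. 0) z = 0 \<and> T (\<lambda>z. (D ^^ n) u z + (-1) * h z) z = T ((D ^^ n) u) z + (-1) * T h z"
    by (intro eventually_conj)
  then have "T ?h \<doteq> (\<lambda>z. (1/a) * (T ((D ^^ n) u) z + (-1) * T h z))"
    by (rule eventually_mono) simp
  then have "feq (Suc k) (T ?h) (\<lambda>z. (1/a) * (T ((D ^^ n) u) z + (-1) * T h z))" by (rule feq_germ_eq)
  also have "feq (Suc k) \<dots> (\<lambda>z. (1/a) * ((a * (D ^^ n) (pd ex u) z + (D ^^ Suc n) r z) + (-1) * (D ^^ Suc n) r z))"
    by (intro feq_cmult feq_add r(2) h(2))
  also have "\<dots> = (D ^^ n) (pd ex u)" using a(1) by (auto simp: fun_eq_iff)
  also have "feq (Suc k) \<dots> ((D ^^ n) w)" by (intro feq_germ_eq Dn_cong u)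
  finally have "feq (Suc k) (T ?h) ((D ^^ n) w)" .
  moreover have "flat (Suc k) ?h" by (intro flat_add flat_zero flat_cmult Dn_flat u2 h(1))
  ultimately show ?thesis by blast
qed

lemma T_surj:
  assumes "flat k w"
  shows "\<exists>h. flat (Suc k) h \<and> feq (Suc k) (T h) w"
proof -
  obtain N where N: "\<And>(w :: 'a \<Rightarrow> real) n. flat k w \<Longrightarrow> N \<le> n \<Longrightarrow> flat (Suc k) ((D ^^ n) w)"
    using Dn_flat_Suc by blast
  \<comment> \<open>Descending induction on \<open>n\<close>, written as induction on the distance
    \<open>m\<close> to \<open>N\<close>. For \<open>n\<close> at least \<open>N\<close> the target
    already vanishes to order \<open>Suc k\<close>, so 0 is a solution; the claim itself is
    \<open>n = 0\<close>.\<close>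
  have "\<forall>n (w :: 'a \<Rightarrow> real). N \<le> n + m \<longrightarrow> flat k w \<longrightarrow> (\<exists>h. flat (Suc k) h \<and> feq (Suc k) (T h) ((D ^^ n) w))" for m
  proof (induction m)
    case 0
    show ?case
    proof (intro allI impI)
      fix n :: nat and w :: "'a \<Rightarrow> real" assume "N \<le> n + 0" "flat k w"
      then have "flat (Suc k) ((D ^^ n) w)" using N by simp
      moreover have "flat (Suc k) (T (\<lambda>_. 0))" by (intro T_flat flat_zero)
      ultimately have "feq (Suc k) (T (\<lambda>_. 0)) ((D ^^ n) w)" unfolding feq_def by (intro flat_diff)
      then show "\<exists>h. flat (Suc k) h \<and> feq (Suc k) (T h) ((D ^^ n) w)" using flat_zero by blast
    qed
  next
    case (Suc m)
    show ?case
    proof (intro allI impI)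
      fix n :: nat and w :: "'a \<Rightarrow> real" assume n: "N \<le> n + Suc m" and w: "flat k w"
      then have "N \<le> Suc n + m" by simp
      note ih = Suc.IH[rule_format, OF this]
      show "\<exists>h. flat (Suc k) h \<and> feq (Suc k) (T h) ((D ^^ n) w)"
        by (rule T_surj_step[OF ih w])
    qed
  qed
  from this[of N, rule_format, of 0 w] show ?thesis using assms by simp
qed

section \<open>Solving the volume equation order by order\<close>

definition jac :: "('a \<Rightarrow> real) \<Rightarrow> ('a \<Rightarrow> real) \<Rightarrow> ('a \<Rightarrow> real) \<Rightarrow> 'a \<Rightarrow> real" where
  "jac u v w z = pd ex u z * (pd ey v z * pd ez w z - pd ez v z * pd ey w z)
     - pd ey u z * (pd ex v z * pd ez w z - pd ez v z * pd ex w z)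
     + pd ez u z * (pd ex v z * pd ey w z - pd ey v z * pd ex w z)"

definition unit_gradients :: "('a \<Rightarrow> real) \<Rightarrow> ('a \<Rightarrow> real) \<Rightarrow> ('a \<Rightarrow> real) \<Rightarrow> bool" where
  "unit_gradients u v w \<longleftrightarrow> pd ex u 0 = 1 \<and> pd ey u 0 = 0 \<and> pd ez u 0 = 0 \<and>
     pd ex v 0 = 0 \<and> pd ey v 0 = 1 \<and> pd ez v 0 = 0 \<and>
     pd ex w 0 = 0 \<and> pd ey w 0 = 0 \<and> pd ez w 0 = 1"

lemma jac_germ: "germ u \<Longrightarrow> germ v \<Longrightarrow> germ w \<Longrightarrow> germ (jac u v w)"
  unfolding jac_def[abs_def] by (intro germ_add germ_diff germ_mult germ_pd)

lemma jac_cong_at: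
  assumes "\<And>d. pd d u z = pd d u' z" "\<And>d. pd d v z = pd d v' z" "\<And>d. pd d w z = pd d w' z"
  shows "jac u v w z = jac u' v' w' z"
  unfolding jac_def assms ..

lemma jac_cong:
  assumes "u \<doteq> u'" "v \<doteq> v'" "w \<doteq> w'"
  shows "jac u v w \<doteq> jac u' v' w'"
proof -
  have "\<forall>\<^sub>F z in nhds 0. (\<forall>\<^sub>F x in nhds z. u x = u' x) \<and> (\<forall>\<^sub>F x in nhds z. v x = v' x) \<and> (\<forall>\<^sub>F x in nhds z. w x = w' x)"
    using assms by (intro eventually_conj) (simp_all add: eventually_eventually)
  then show ?thesis by (rule eventually_mono) (auto intro!: jac_cong_at pd_cong_at)
qed

text \<open>The determinant at the identity linearises to the trace; expanding it one row at a time,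
  every remaining term is an entry of the perturbation times a cofactor vanishing at the origin.\<close>
lemma jac_perturb:
  assumes g: "germ u" "germ v" "germ w" and un: "unit_gradients u v w"
    and fl: "flat (Suc (Suc k)) f" "flat (Suc (Suc k)) g" "flat (Suc (Suc k)) h"
  shows "feq (Suc (Suc k)) (jac (\<lambda>z. u z + f z) (\<lambda>z. v z + g z) (\<lambda>z. w z + h z))
     (\<lambda>z. jac u v w z + (pd ex f z + pd ey g z + pd ez h z))"
proof -
  define u1 u2 u3 where "u1 = pd ex u" and "u2 = pd ey u" and "u3 = pd ez u"
  define v1 v2 v3 where "v1 = pd ex v" and "v2 = pd ey v" and "v3 = pd ez v"
  define w1 w2 w3 where "w1 = pd ex w" and "w2 = pd ey w" and "w3 = pd ez w"
  define f1 f2 f3 where "f1 = pd ex f" and "f2 = pd ey f" and "f3 = pd ez f"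
  define g1 g2 g3 where "g1 = pd ex g" and "g2 = pd ey g" and "g3 = pd ez g"
  define h1 h2 h3 where "h1 = pd ex h" and "h2 = pd ey h" and "h3 = pd ez h"
  note uvw = u1_def u2_def u3_def v1_def v2_def v3_def w1_def w2_def w3_def
  note fgh = f1_def f2_def f3_def g1_def g2_def g3_def h1_def h2_def h3_def
  have gu: "germ u1" "germ u2" "germ u3" "germ v1" "germ v2" "germ v3" "germ w1" "germ w2" "germ w3"
    unfolding uvw by (intro germ_pd g)+
  have gf: "germ f" "germ g" "germ h" using fl flat_germ by blast+
  have fk: "flat (Suc k) f1" "flat (Suc k) f2" "flat (Suc k) f3" "flat (Suc k) g1" "flat (Suc k) g2" "flat (Suc k) g3"
    "flat (Suc k) h1" "flat (Suc k) h2" "flat (Suc k) h3"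
    unfolding fgh by (intro flat_pd fl)+
  note gfk = fk[THEN flat_germ]
  have f0: "f1 0 = 0" "f2 0 = 0" "f3 0 = 0" "g1 0 = 0" "g2 0 = 0" "g3 0 = 0" "h1 0 = 0" "h2 0 = 0" "h3 0 = 0"
    using fk by simp_all
  have u0: "u1 0 = 1" "u2 0 = 0" "u3 0 = 0" "v1 0 = 0" "v2 0 = 1" "v3 0 = 0" "w1 0 = 0" "w2 0 = 0" "w3 0 = 1"
    using un unfolding unit_gradients_def uvw by auto
  have mult: "flat (Suc (Suc k)) (\<lambda>z. b z * c z)" if "flat (Suc k) b" "germ c" "c 0 = 0" for b c :: "'a \<Rightarrow> real"
  proof -
    have "flat 1 c" using that(2,3) by (simp only: flat_1)
    from flat_mult[OF that(1) this] show ?thesis by (simp del: flat.simps)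
  qed
  let ?V1 = "\<lambda>z. v1 z + g1 z" and ?V2 = "\<lambda>z. v2 z + g2 z" and ?V3 = "\<lambda>z. v3 z + g3 z"
  let ?W1 = "\<lambda>z. w1 z + h1 z" and ?W2 = "\<lambda>z. w2 z + h2 z" and ?W3 = "\<lambda>z. w3 z + h3 z"
  let ?E = "\<lambda>z. f1 z * (?V2 z * ?W3 z - ?V3 z * ?W2 z - 1) + f2 z * (?V3 z * ?W1 z - ?V1 z * ?W3 z)
    + f3 z * (?V1 z * ?W2 z - ?V2 z * ?W1 z)
    + (g1 z * (u3 z * ?W2 z - u2 z * ?W3 z) + g2 z * (u1 z * ?W3 z - u3 z * ?W1 z - 1)
    + g3 z * (u2 z * ?W1 z - u1 z * ?W2 z))
    + (h1 z * (u2 z * v3 z - u3 z * v2 z) + h2 z * (u3 z * v1 z - u1 z * v3 z) + h3 z * (u1 z * v2 z - u2 z * v1 z - 1))"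
  have E: "flat (Suc (Suc k)) ?E"
    by (intro flat_add mult fk germ_diff germ_mult germ_add germ_const gu gfk) (simp_all add: f0 u0)
  have "\<forall>\<^sub>F z in nhds 0. ((u differentiable (at z) \<and> v differentiable (at z)) \<and> w differentiable (at z)) \<and>
      ((f differentiable (at z) \<and> g differentiable (at z)) \<and> h differentiable (at z))"
    by (intro eventually_conj germ_differentiable g gf)
  then have "?E \<doteq> (\<lambda>z. jac (\<lambda>z. u z + f z) (\<lambda>z. v z + g z) (\<lambda>z. w z + h z) z
      - (jac u v w z + (pd ex f z + pd ey g z + pd ez h z)))"
  proof (rule eventually_mono)
    fix z assume d: "((u differentiable (at z) \<and> v differentiable (at z)) \<and> w differentiable (at z)) \<and>
      ((f differentiable (at z) \<and> g differentiable (at z)) \<and> h differentiable (at z))"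
    show "?E z = jac (\<lambda>z. u z + f z) (\<lambda>z. v z + g z) (\<lambda>z. w z + h z) z
      - (jac u v w z + (pd ex f z + pd ey g z + pd ez h z))"
      unfolding jac_def using d by (simp add: pd_add_at fgh[symmetric] uvw[symmetric], simp add: algebra_simps)
  qed
  then show ?thesis unfolding feq_def by (rule flat_cong[OF E])
qed

lemma unit_gradients_perturb:
  assumes g: "germ u" "germ v" "germ w" and un: "unit_gradients u v w"
    and fl: "flat (Suc (Suc k)) f" "flat (Suc (Suc k)) g" "flat (Suc (Suc k)) h"
  shows "unit_gradients (\<lambda>z. u z + f z) (\<lambda>z. v z + g z) (\<lambda>z. w z + h z)"
proof -
  have d: "u differentiable (at 0)" "v differentiable (at 0)" "w differentiable (at 0)"
    "f differentiable (at 0)" "g differentiable (at 0)" "h differentiable (at 0)"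
    using germ_differentiable eventually_nhds_x_imp_x g fl flat_germ by blast+
  have "pd a f 0 = 0" "pd a g 0 = 0" "pd a h 0 = 0" for a using fl by simp_all
  then show ?thesis using un d unfolding unit_gradients_def by (simp add: pd_add_at)
qed

lemma unit_gradients_cong:
  assumes "unit_gradients u v w" "u \<doteq> u'" "v \<doteq> v'" "w \<doteq> w'"
  shows "unit_gradients u' v' w'"
  using assms(1) pd_cong_at[OF assms(2)] pd_cong_at[OF assms(3)] pd_cong_at[OF assms(4)]
  unfolding unit_gradients_def by simp

lemma unit_gradients_jac: "unit_gradients u v w \<Longrightarrow> jac u v w 0 = 1"
  unfolding unit_gradients_def jac_def by simp

text \<open>A Newton step: \<open>h\<close> solves \<open>T h = 1 - J\<close> to the next order. As
  \<open>h\<close> has order \<open>k + 2\<close>, its gradients have order \<open>k + 1\<close>,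
  and their products with quantities vanishing at the origin fall into the order that is
  discarded.\<close>

lemma approximate_volume_step:
  assumes X: "germ X" and un: "unit_gradients (S X) (D (S X)) (D (D X))"
    and fl: "flat (Suc k) (\<lambda>z. jac (S X) (D (S X)) (D (D X)) z - 1)"
  obtains h where "flat (Suc (Suc k)) h"
    "unit_gradients (S (\<lambda>z. X z + h z)) (D (S (\<lambda>z. X z + h z))) (D (D (\<lambda>z. X z + h z)))"
    "flat (Suc (Suc k)) (\<lambda>z. jac (S (\<lambda>z. X z + h z)) (D (S (\<lambda>z. X z + h z))) (D (D (\<lambda>z. X z + h z))) z - 1)"
proof -
  let ?J = "jac (S X) (D (S X)) (D (D X))"
  obtain h where h: "flat (Suc (Suc k)) h" "feq (Suc (Suc k)) (T h) (\<lambda>z. (-1) * (?J z - 1))"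
    using T_surj[OF flat_cmult[OF fl, of "-1"]] by blast
  have gh: "germ h" using h(1) by simp
  have g: "germ (S X)" "germ (D (S X))" "germ (D (D X))" by (intro S_germ D_germ X)+
  have f: "flat (Suc (Suc k)) (S h)" "flat (Suc (Suc k)) (D (S h))" "flat (Suc (Suc k)) (D (D h))"
    by (intro S_flat D_flat h)+
  let ?u = "\<lambda>z. S X z + S h z" and ?v = "\<lambda>z. D (S X) z + D (S h) z" and ?w = "\<lambda>z. D (D X) z + D (D h) z"
  have eq: "?u \<doteq> S (\<lambda>z. X z + h z)" "?v \<doteq> D (S (\<lambda>z. X z + h z))" "?w \<doteq> D (D (\<lambda>z. X z + h z))"
    using components_lin[OF X gh, of 1] by (auto intro: germ_eq_sym)
  have "feq (Suc (Suc k)) (jac (S (\<lambda>z. X z + h z)) (D (S (\<lambda>z. X z + h z))) (D (D (\<lambda>z. X z + h z)))) (jac ?u ?v ?w)"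
    by (rule feq_germ_eq[OF jac_cong[OF eq[THEN germ_eq_sym]]])
  also have "feq (Suc (Suc k)) (jac ?u ?v ?w) (\<lambda>z. ?J z + (pd ex (S h) z + pd ey (D (S h)) z + pd ez (D (D h)) z))"
    by (rule jac_perturb[OF g un f])
  also have "\<dots> = (\<lambda>z. ?J z + T h z)" by (simp add: T_def)
  also have "feq (Suc (Suc k)) \<dots> (\<lambda>z. ?J z + (-1) * (?J z - 1))"
    by (intro feq_add feq_refl h(2))
  finally have "feq (Suc (Suc k)) (jac (S (\<lambda>z. X z + h z)) (D (S (\<lambda>z. X z + h z))) (D (D (\<lambda>z. X z + h z)))) (\<lambda>z. 1)"
    by simp
  then show ?thesis
    unfolding feq_def by (rule that[OF h(1) unit_gradients_cong[OF unit_gradients_perturb[OF g un f] eq]])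
qed

lemma approximate_volume:
  assumes "germ X0" "X0 0 = 0" "unit_gradients (S X0) (D (S X0)) (D (D X0))"
  shows "\<exists>X. germ X \<and> X 0 = 0 \<and> unit_gradients (S X) (D (S X)) (D (D X)) \<and>
    flat (Suc k) (\<lambda>z. jac (S X) (D (S X)) (D (D X)) z - 1)"
proof (induction k)
  case 0
  have "germ (\<lambda>z. jac (S X0) (D (S X0)) (D (D X0)) z - 1)"
    by (intro germ_diff germ_const jac_germ S_germ D_germ assms)
  then show ?case
    using assms unit_gradients_jac[OF assms(3)] by (intro exI[of _ X0]) (simp only: flat_1, simp)
next
  case (Suc k)
  then obtain X where X: "germ X" "X 0 = 0" "unit_gradients (S X) (D (S X)) (D (D X))"
    "flat (Suc k) (\<lambda>z. jac (S X) (D (S X)) (D (D X)) z - 1)" by blast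
  show ?case
  proof (rule approximate_volume_step[OF X(1,3,4)])
    fix h assume h: "flat (Suc (Suc k)) h"
      "unit_gradients (S (\<lambda>z. X z + h z)) (D (S (\<lambda>z. X z + h z))) (D (D (\<lambda>z. X z + h z)))"
      "flat (Suc (Suc k)) (\<lambda>z. jac (S (\<lambda>z. X z + h z)) (D (S (\<lambda>z. X z + h z))) (D (D (\<lambda>z. X z + h z))) z - 1)"
    have "germ h" "h 0 = 0" using h(1) by simp_all
    with X h show ?thesis by (intro exI[of _ "\<lambda>z. X z + h z"] conjI germ_add) simp_all
  qed
qed


lemma pd_D_0:
  assumes "germ u" "u 0 = 0"
  shows "pd d (D u) 0 = pd (M d) u 0"
proof -
  have "flat (Suc 0) u" using assms by (simp only: flat_1)
  from pd_D[OF this, of d] have "pd d (D u) 0 - (D (pd d u) 0 + (pd (M d) u 0 + s * D (pd (M d) u) 0)) = 0"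
    unfolding feq_def by simp
  then show ?thesis using D_zero[OF germ_pd[OF assms(1)]] by simp
qed

lemma pd_S_0:
  assumes "germ u" "u 0 = 0"
  shows "pd d (S u) 0 = pd d u 0 + s * pd (M d) u 0"
  using eventually_nhds_x_imp_x[OF pd_S[OF assms(1), of d]] pd_D_0[OF assms] by simp

text \<open>The linear start \<open>X = x - s y + s\<^sup>2 z\<close> is determined by the requirement that the gradients
  of \<open>S X\<close>, \<open>D (S X)\<close>, \<open>D (D X)\<close> at the origin are the unit vectors.\<close>
lemma approximate_volume_exists:
  assumes "ey \<in> Basis" "ez \<in> Basis" "ex \<noteq> ey" "ex \<noteq> ez" "ey \<noteq> ez"
  shows "\<exists>X. germ X \<and> X 0 = 0 \<and> unit_gradients (S X) (D (S X)) (D (D X)) \<and>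
    flat (Suc k) (\<lambda>z. jac (S X) (D (S X)) (D (D X)) z - 1)"
proof (rule approximate_volume)
  define X where "X z = z \<bullet> (ex - s *\<^sub>R ey + (s * s) *\<^sub>R ez)" for z :: 'a
  have bl: "bounded_linear X"
    unfolding X_def by (rule bounded_linear_inner_left)
  show X: "germ X" "X 0 = 0" by (auto intro: germ_linear[OF bl] simp: X_def)
  have pdX: "pd d X z = X d" for d z by (rule pd_bounded_linear[OF bl])
  have X3: "X ex = 1" "X ey = - s" "X ez = s * s" "X 0 = 0"
    using assms ex_Basis by (auto simp: X_def inner_Basis inner_add_right inner_diff_right)
  have SX: "germ (S X)" "S X 0 = 0" "germ (D X)" "D X 0 = 0"
    using X D_zero[OF X(1)] by (auto intro: S_germ D_germ simp: S_def)
  have "pd d (S X) 0 = X d + s * X (M d)" for d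
    using pd_S_0[OF X] by (simp add: pdX)
  moreover have "pd d (D (S X)) 0 = X (M d) + s * X (M (M d))" for d
    using pd_D_0[OF SX(1,2)] pd_S_0[OF X] by (simp add: pdX)
  moreover have "pd d (D (D X)) 0 = X (M (M d))" for d
    using pd_D_0[OF SX(3,4)] pd_D_0[OF X] by (simp add: pdX)
  moreover have "M 0 = 0" using M_nilpotent[of ez] M_ez M_ey M_ex by (simp add: numeral_eq_Suc)
  ultimately show "unit_gradients (S X) (D (S X)) (D (D X))"
    unfolding unit_gradients_def by (simp add: M_ex M_ey M_ez X3)
qed

end

subsection \<open>Lie derivatives and difference operators\<close>

lemma frechet_derivative_inner_0:
  fixes g :: "'a::euclidean_space \<Rightarrow> 'b::euclidean_space"
  assumes "\<And>j. j \<in> Basis \<Longrightarrow> germ (\<lambda>z. g z \<bullet> j)"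
  shows "frechet_derivative g (at 0) d \<bullet> j = pd d (\<lambda>z. g z \<bullet> j) 0"
  by (rule frechet_derivative_inner)
     (rule eventually_nhds_x_imp_x[OF germ_vector_differentiable[OF assms]])

lemma pd_basis_sum_germ: "germ u \<Longrightarrow> pd v u \<doteq> (\<lambda>z. \<Sum>j\<in>Basis. (v \<bullet> j) * pd j u z)"
  by (drule germ_differentiable, erule eventually_mono) (rule pd_basis_sum)

lemma flat_pd_minus_0:
  assumes "germ u"
  shows "flat (Suc 0) (\<lambda>z. pd d u z - pd d u 0)"
  unfolding flat_1 using assms by (auto intro!: germ_diff germ_pd)

text \<open>Freezing the coefficients at the origin costs a factor of order 1 in front of functions
  of order \<open>k\<close>. This is how only the linear part of a field or map survives in the
  commutation rule.\<close>

lemma feq_sum_products: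
  assumes c: "\<And>j. j \<in> Basis \<Longrightarrow> germ (c j)" and q: "\<And>j. j \<in> Basis \<Longrightarrow> flat k (q j)"
  shows "feq (Suc k) (\<lambda>z. \<Sum>j\<in>Basis. pd d (c j) z * q j z) (\<lambda>z. \<Sum>j\<in>Basis. pd d (c j) 0 * q j z)"
proof -
  have "flat (Suc 0 + k) (\<lambda>z. \<Sum>j\<in>Basis. (pd d (c j) z - pd d (c j) 0) * q j z)"
    by (intro flat_sum finite_Basis flat_mult flat_pd_minus_0 c q)
  then show ?thesis
    unfolding feq_def by (simp add: sum_subtractf left_diff_distrib del: flat.simps)
qed

lemma lie_expand:
  assumes "germ u"
  shows "(\<lambda>z. pd (V z) u z) \<doteq> (\<lambda>z. \<Sum>j\<in>Basis. (V z \<bullet> j) * pd j u z)"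
  using germ_differentiable[OF assms] by (rule eventually_mono) (rule pd_basis_sum)

lemma pd_lie:
  assumes V: "\<And>j. j \<in> Basis \<Longrightarrow> germ (\<lambda>z. V z \<bullet> j)" and gu: "germ u"
  shows "pd d (\<lambda>z. pd (V z) u z) \<doteq>
    (\<lambda>z. pd (V z) (pd d u) z + (\<Sum>j\<in>Basis. pd d (\<lambda>z. V z \<bullet> j) z * pd j u z))"
proof -
  let ?A = "\<lambda>z. \<Sum>j\<in>Basis. pd d (\<lambda>z. V z \<bullet> j) z * pd j u z"
  have "\<forall>\<^sub>F z in nhds 0. ((\<forall>\<^sub>F x in nhds z. pd (V x) u x = (\<Sum>j\<in>Basis. (V x \<bullet> j) * pd j u x)) \<and>
     (\<forall>j\<in>Basis. (\<lambda>z. V z \<bullet> j) differentiable (at z))) \<and>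
     ((\<forall>j\<in>Basis. pd j u differentiable (at z)) \<and> (\<forall>j\<in>Basis. pd d (pd j u) z = pd j (pd d u) z)) \<and>
     pd d u differentiable (at z)"
    using lie_expand[OF gu, of V] V
    by (intro eventually_conj eventually_ball_finite ballI finite_Basis germ_differentiable germ_pd pd_pd_commute gu)
       (simp_all add: eventually_eventually)
  then show ?thesis
  proof (rule eventually_mono, elim conjE)
    fix z assume 1: "\<forall>\<^sub>F x in nhds z. pd (V x) u x = (\<Sum>j\<in>Basis. (V x \<bullet> j) * pd j u x)"
      and 2: "\<forall>j\<in>Basis. (\<lambda>z. V z \<bullet> j) differentiable (at z)" "\<forall>j\<in>Basis. pd j u differentiable (at z)"
      and 3: "\<forall>j\<in>Basis. pd d (pd j u) z = pd j (pd d u) z" and 4: "pd d u differentiable (at z)"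
    have "pd d (\<lambda>z. pd (V z) u z) z = pd d (\<lambda>z. \<Sum>j\<in>Basis. (V z \<bullet> j) * pd j u z) z"
      by (rule pd_cong_at[OF 1])
    also have "\<dots> = (\<Sum>j\<in>Basis. pd d (\<lambda>z. (V z \<bullet> j) * pd j u z) z)"
      using 2 by (intro pd_sum_at differentiable_mult) auto
    also have "\<dots> = (\<Sum>j\<in>Basis. (V z \<bullet> j) * pd j (pd d u) z + pd d (\<lambda>z. V z \<bullet> j) z * pd j u z)"
      using 2 3 by (intro sum.cong) (auto simp: pd_mult_at)
    also have "\<dots> = pd (V z) (pd d u) z + ?A z"
      by (simp add: sum.distrib pd_basis_sum[OF 4, of "V z"])
    finally show "pd d (\<lambda>z. pd (V z) u z) z = pd (V z) (pd d u) z + ?A z" .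
  qed
qed

text \<open>One derivative is lost in the Lie derivative, but the field vanishes at the origin and
  restores the order. The commutator with \<open>pd d\<close> is differentiation along the
  \<open>d\<close>-derivative of the field; frozen at the origin, that vector is
  \<open>M d\<close>.\<close>

lemma shift_operator_lie:
  fixes V :: "'a::euclidean_space \<Rightarrow> 'a"
  assumes V: "\<And>j. j \<in> Basis \<Longrightarrow> germ (\<lambda>z. V z \<bullet> j)" "V 0 = 0"
    and M: "M = frechet_derivative V (at 0)"
    and MM: "M ex = 0" "M ey = ex" "M ez = ey" "\<And>d. (M ^^ 4) d = 0" "ex \<in> Basis"
  shows "shift_operator (\<lambda>u z. pd (V z) u z) 0 M ex ey ez"
proof
  fix u v :: "'a \<Rightarrow> real" assume "u \<doteq> v"
  then have "\<forall>\<^sub>F z in nhds 0. \<forall>\<^sub>F x in nhds z. u x = v x" by (simp add: eventually_eventually)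
  then show "(\<lambda>z. pd (V z) u z) \<doteq> (\<lambda>z. pd (V z) v z)" by (rule eventually_mono) (rule pd_cong_at)
next
  fix u v :: "'a \<Rightarrow> real" and c assume "germ u" "germ v"
  then have "\<forall>\<^sub>F z in nhds 0. u differentiable (at z) \<and> v differentiable (at z)"
    by (intro eventually_conj germ_differentiable)
  then show "(\<lambda>z. pd (V z) (\<lambda>z. u z + c * v z) z) \<doteq> (\<lambda>z. pd (V z) u z + c * pd (V z) v z)"
    by (rule eventually_mono) (simp add: pd_add_at pd_cmult_at)
next
  fix k and u :: "'a \<Rightarrow> real" assume u: "flat k u"
  have "flat k (\<lambda>z. \<Sum>j\<in>Basis. (V z \<bullet> j) * pd j u z)"
  proof (cases k)
    case 0
    then show ?thesis using u V(1) by (auto intro!: germ_sum germ_mult germ_pd)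
  next
    case (Suc m)
    have V1: "flat (Suc 0) (\<lambda>z. V z \<bullet> j)" if "j \<in> Basis" for j
      unfolding flat_1 using V that by simp
    have "flat (Suc 0 + m) (\<lambda>z. \<Sum>j\<in>Basis. (V z \<bullet> j) * pd j u z)"
      using u Suc by (intro flat_sum finite_Basis flat_mult V1) auto
    then show ?thesis using Suc by simp
  qed
  then show "flat k (\<lambda>z. pd (V z) u z)"
    by (rule flat_cong) (rule germ_eq_sym[OF lie_expand[OF flat_germ[OF u]]])
next
  fix u :: "'a \<Rightarrow> real" assume "germ u"
  then have "u differentiable (at 0)" using germ_differentiable eventually_nhds_x_imp_x by blast
  then show "pd (V 0) u 0 = 0" using V(2) by simp
next
  fix k d and u :: "'a \<Rightarrow> real" assume u: "flat (Suc k) u"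
  have gu: "germ u" by (rule flat_germ[OF u])
  let ?A = "\<lambda>z. \<Sum>j\<in>Basis. pd d (\<lambda>z. V z \<bullet> j) z * pd j u z"
  have eq1: "pd d (\<lambda>z. pd (V z) u z) \<doteq> (\<lambda>z. pd (V z) (pd d u) z + ?A z)"
    by (rule pd_lie[OF V(1) gu])
  have "M d \<bullet> j = pd d (\<lambda>z. V z \<bullet> j) 0" for j
    unfolding M by (rule frechet_derivative_inner_0[OF V(1)])
  then have "pd (M d) u \<doteq> (\<lambda>z. \<Sum>j\<in>Basis. pd d (\<lambda>z. V z \<bullet> j) 0 * pd j u z)"
    using pd_basis_sum_germ[OF gu, of "M d"] by simp
  then have eq2: "feq (Suc k) (\<lambda>z. \<Sum>j\<in>Basis. pd d (\<lambda>z. V z \<bullet> j) 0 * pd j u z) (pd (M d) u)"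
    by (intro feq_germ_eq) (rule germ_eq_sym)
  have "feq (Suc k) ?A (\<lambda>z. \<Sum>j\<in>Basis. pd d (\<lambda>z. V z \<bullet> j) 0 * pd j u z)"
    using u V(1) by (intro feq_sum_products) auto
  from feq_trans[OF this eq2]
  have "feq (Suc k) (\<lambda>z. pd (V z) (pd d u) z + ?A z) (\<lambda>z. pd (V z) (pd d u) z + pd (M d) u z)"
    by (intro feq_add feq_refl)
  with feq_germ_eq[OF eq1] have "feq (Suc k) (pd d (\<lambda>z. pd (V z) u z)) (\<lambda>z. pd (V z) (pd d u) z + pd (M d) u z)"
    by (rule feq_trans)
  then show "feq (Suc k) (pd d (\<lambda>z. pd (V z) u z)) (\<lambda>z. pd (V z) (pd d u) z + (pd (M d) u z + 0 * pd (V z) (pd (M d) u) z))"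
    by simp
qed (use MM in auto)

text \<open>By the chain rule, with the derivative of \<open>g\<close> frozen at the origin,
  \<open>pd d\<close> of the composition is \<open>pd d u + pd (M d) u\<close> evaluated at
  \<open>g z\<close>. The second summand is evaluated at \<open>g z\<close> and not at
  \<open>z\<close>, which is \<open>S (pd (M d) u)\<close> with \<open>s = 1\<close>.\<close>

lemma shift_operator_difference:
  fixes g :: "'a::euclidean_space \<Rightarrow> 'a"
  assumes g: "\<And>j. j \<in> Basis \<Longrightarrow> germ (\<lambda>z. g z \<bullet> j)" "g 0 = 0"
    and M: "M = (\<lambda>d. frechet_derivative g (at 0) d - d)"
    and MM: "M ex = 0" "M ey = ex" "M ez = ey" "\<And>d. (M ^^ 4) d = 0" "ex \<in> Basis"
  shows "shift_operator (\<lambda>u z. u (g z) - u z) 1 M ex ey ez"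
proof
  fix u v :: "'a \<Rightarrow> real" assume uv: "u \<doteq> v"
  have "(\<lambda>z. u (g z)) \<doteq> (\<lambda>z. v (g z))" by (rule eventually_compose_germ[OF g uv])
  then show "(\<lambda>z. u (g z) - u z) \<doteq> (\<lambda>z. v (g z) - v z)"
    using uv by (rule eventually_elim2) simp
next
  fix u v :: "'a \<Rightarrow> real" and c
  show "(\<lambda>z. u (g z) + c * v (g z) - (u z + c * v z)) \<doteq> (\<lambda>z. u (g z) - u z + c * (v (g z) - v z))"
    by (simp add: algebra_simps)
next
  fix k and u :: "'a \<Rightarrow> real" assume u: "flat k u"
  show "flat k (\<lambda>z. u (g z) - u z)" by (rule flat_diff[OF flat_compose[OF u g] u])
next
  fix k d and u :: "'a \<Rightarrow> real" assume u: "flat (Suc k) u"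
  have gu: "germ u" by (rule flat_germ[OF u])
  let ?A = "\<lambda>z. \<Sum>j\<in>Basis. pd d (\<lambda>z. g z \<bullet> j) z * pd j u (g z)"
  let ?B = "\<lambda>z. \<Sum>j\<in>Basis. pd d (\<lambda>z. g z \<bullet> j) 0 * pd j u (g z)"
  have gc: "germ (\<lambda>z. u (g z))" by (rule germ_compose[OF gu g])
  have fl: "flat k (\<lambda>z. pd j u (g z))" for j by (rule flat_compose[OF flat_pd[OF u] g])
  have "pd d (\<lambda>z. u (g z) - u z) \<doteq> (\<lambda>z. pd d (\<lambda>z. u (g z)) z - pd d u z)"
    by (rule pd_diff[OF gc gu])
  moreover have "pd d (\<lambda>z. u (g z)) \<doteq> ?A" by (rule pd_compose_germ[OF gu g])
  ultimately have "pd d (\<lambda>z. u (g z) - u z) \<doteq> (\<lambda>z. ?A z + (-1) * pd d u z)"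
    by (rule eventually_elim2) simp
  then have "feq (Suc k) (pd d (\<lambda>z. u (g z) - u z)) (\<lambda>z. ?A z + (-1) * pd d u z)"
    by (rule feq_germ_eq)
  also have "feq (Suc k) \<dots> (\<lambda>z. ?B z + (-1) * pd d u z)"
    by (intro feq_add feq_refl feq_sum_products g fl)
  also have "(\<lambda>z. ?B z + (-1) * pd d u z) \<doteq> (\<lambda>z. pd d u (g z) - pd d u z + pd (M d) u (g z))"
  proof -
    have "\<forall>\<^sub>F z in nhds 0. u differentiable (at (g z))"
      by (rule eventually_compose_germ[OF g germ_differentiable[OF gu]])
    then show ?thesis
    proof (rule eventually_mono)
      fix z assume d: "u differentiable (at (g z))"
      interpret linear "\<lambda>v. pd v u (g z)" by (rule pd_linear[OF d])
      have "frechet_derivative g (at 0) d \<bullet> j = pd d (\<lambda>z. g z \<bullet> j) 0" for j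
        by (rule frechet_derivative_inner_0[OF g(1)])
      then have "?B z = pd (frechet_derivative g (at 0) d) u (g z)"
        unfolding pd_basis_sum[OF d, of "frechet_derivative g (at 0) d"] by simp
      also have "\<dots> = pd d u (g z) + pd (M d) u (g z)"
        unfolding M by (simp add: diff)
      finally show "?B z + (-1) * pd d u z = pd d u (g z) - pd d u z + pd (M d) u (g z)" by simp
    qed
  qed
  then have "feq (Suc k) (\<lambda>z. ?B z + (-1) * pd d u z) (\<lambda>z. pd d u (g z) - pd d u z + pd (M d) u (g z))"
    by (rule feq_germ_eq)
  finally show "feq (Suc k) (pd d (\<lambda>z. u (g z) - u z))
     (\<lambda>z. pd d u (g z) - pd d u z + (pd (M d) u z + 1 * (pd (M d) u (g z) - pd (M d) u z)))"
    by simp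
qed (use MM g in auto)

text \<open>Differentiating the difference gives a term with the derivative of \<open>g - h\<close>
  and a term with the same kind of difference for \<open>pd j u\<close>; the induction is therefore
  over all \<open>u\<close> at once.\<close>

lemma flat_compose_diff:
  fixes g h :: "'a::euclidean_space \<Rightarrow> 'b::euclidean_space"
  assumes g: "\<And>j. j \<in> Basis \<Longrightarrow> germ (\<lambda>z. g z \<bullet> j)" "g 0 = 0"
    and h: "\<And>j. j \<in> Basis \<Longrightarrow> germ (\<lambda>z. h z \<bullet> j)" "h 0 = 0"
  shows "(\<And>j. j \<in> Basis \<Longrightarrow> flat k (\<lambda>z. g z \<bullet> j - h z \<bullet> j)) \<Longrightarrow> germ u \<Longrightarrow>
    flat k (\<lambda>z. u (g z) - u (h z))"
proof (induction k arbitrary: u)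
  case 0
  show ?case
    using germ_diff[OF germ_compose[OF \<open>germ u\<close> g] germ_compose[OF \<open>germ u\<close> h]] by simp
next
  case (Suc k)
  have gc1: "germ (\<lambda>z. u (g z))" by (rule germ_compose[OF Suc.prems(2) g])
  have gc2: "germ (\<lambda>z. u (h z))" by (rule germ_compose[OF Suc.prems(2) h])
  note gc = gc1 gc2
  have gpc: "germ (\<lambda>z. pd j u (g z))" for j by (rule germ_compose[OF germ_pd[OF Suc.prems(2)] g])
  have ih: "flat k (\<lambda>z. pd j u (g z) - pd j u (h z))" for j
    by (rule Suc.IH[OF flat_SucD[OF Suc.prems(1)] germ_pd[OF Suc.prems(2)]])
  have d1: "flat k (\<lambda>z. pd d (\<lambda>z. g z \<bullet> j) z - pd d (\<lambda>z. h z \<bullet> j) z)" if "j \<in> Basis" for d j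
    by (rule flat_cong[OF flat_pd[OF Suc.prems(1)[OF that]] pd_diff[OF g(1)[OF that] h(1)[OF that]]])
  have "flat k (\<lambda>z. \<Sum>j\<in>Basis. (pd d (\<lambda>z. g z \<bullet> j) z - pd d (\<lambda>z. h z \<bullet> j) z) * pd j u (g z)
       + pd d (\<lambda>z. h z \<bullet> j) z * (pd j u (g z) - pd j u (h z)))" (is "flat k (?s d)") for d
    by (intro flat_sum finite_Basis flat_add flat_mult_right[OF d1] flat_mult_left[OF _ ih] gpc germ_pd h(1))
  moreover have "?s d \<doteq> pd d (\<lambda>z. u (g z) - u (h z))" for d
  proof -
    have "\<forall>\<^sub>F z in nhds 0. pd d (\<lambda>z. u (g z) - u (h z)) z = pd d (\<lambda>z. u (g z)) z - pd d (\<lambda>z. u (h z)) z \<and>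
      pd d (\<lambda>z. u (g z)) z = (\<Sum>j\<in>Basis. pd d (\<lambda>z. g z \<bullet> j) z * pd j u (g z)) \<and>
      pd d (\<lambda>z. u (h z)) z = (\<Sum>j\<in>Basis. pd d (\<lambda>z. h z \<bullet> j) z * pd j u (h z))"
      by (intro eventually_conj pd_diff gc pd_compose_germ[OF Suc.prems(2) g] pd_compose_germ[OF Suc.prems(2) h])
    moreover have "?s d z = (\<Sum>j\<in>Basis. pd d (\<lambda>z. g z \<bullet> j) z * pd j u (g z)) -
        (\<Sum>j\<in>Basis. pd d (\<lambda>z. h z \<bullet> j) z * pd j u (h z))" for z
      unfolding sum_subtractf[symmetric] by (intro sum.cong refl) (simp add: algebra_simps)
    ultimately show ?thesis by (elim eventually_mono) simp
  qed
  ultimately have "flat k (pd d (\<lambda>z. u (g z) - u (h z)))" for d by (rule flat_cong)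
  then show ?case using gc g(2) h(2) by (simp add: germ_diff)
qed

text \<open>If the derivative along \<open>e\<close> is small, the function agrees to one order more
  with its values on the hyperplane orthogonal to \<open>e\<close>. Derivatives along the hyperplane
  reproduce the situation by symmetry of mixed derivatives, and the component along \<open>e\<close>
  is the hypothesis.\<close>

lemma flat_minus_projection:
  fixes e :: "'a::euclidean_space"
  assumes e: "e \<in> Basis"
  shows "germ a \<Longrightarrow> flat k (pd e a) \<Longrightarrow> flat (Suc k) (\<lambda>z. a z - a (z - (z \<bullet> e) *\<^sub>R e))"
proof (induction k arbitrary: a)
  let ?p = "\<lambda>z. z - (z \<bullet> e) *\<^sub>R e"
  have p: "germ (\<lambda>z. ?p z \<bullet> j)" "?p 0 = 0" for j
    by (auto intro!: germ_linear bounded_linear_intros bounded_linear_compose[OF bounded_linear_inner_left])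
  {
    case 0
    show ?case
      using germ_diff[OF 0(1) germ_compose[OF 0(1) p]] by (simp only: flat_1) simp
  next
    case (Suc k)
    have gc: "germ (\<lambda>z. a (?p z))" by (rule germ_compose[OF Suc.prems(1) p])
    have "flat (Suc k) (\<lambda>z. (pd (?p d) a z - pd (?p d) a (?p z)) + (d \<bullet> e) * pd e a z)" for d
    proof -
      have "flat k (pd (?p d) (pd e a))" by (rule flat_pd[OF Suc.prems(2)])
      then have "flat k (pd e (pd (?p d) a))" by (rule flat_cong) (rule pd_pd_commute[OF Suc.prems(1)])
      then show ?thesis
        by (intro flat_add Suc.IH[OF germ_pd[OF Suc.prems(1)]] flat_cmult Suc.prems(2))
    qed
    moreover have "(\<lambda>z. (pd (?p d) a z - pd (?p d) a (?p z)) + (d \<bullet> e) * pd e a z) \<doteq> pd d (\<lambda>z. a z - a (?p z))" for d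
    proof -
      have "\<forall>\<^sub>F z in nhds 0. a differentiable (at z) \<and> a differentiable (at (?p z))"
        by (intro eventually_conj germ_differentiable[OF Suc.prems(1)]
            eventually_compose_germ[OF p germ_differentiable[OF Suc.prems(1)]])
      then show ?thesis
      proof (rule eventually_mono, elim conjE)
        fix z assume d1: "a differentiable (at z)" and d2: "a differentiable (at (?p z))"
        interpret linear "\<lambda>v. pd v a z" by (rule pd_linear[OF d1])
        have hp: "(?p has_derivative ?p) (at z)" by (auto intro!: derivative_eq_intros)
        have "pd d (\<lambda>z. a z - a (?p z)) z = pd d a z - pd (?p d) a (?p z)"
          by (rule pd_eq[OF has_derivative_diff[OF has_derivative_pd[OF d1]
                has_derivative_compose[OF hp has_derivative_pd[OF d2]]]])
        moreover have "pd d a z = pd (?p d) a z + (d \<bullet> e) * pd e a z"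
          by (simp add: diff scale)
        ultimately show "(pd (?p d) a z - pd (?p d) a (?p z)) + (d \<bullet> e) * pd e a z = pd d (\<lambda>z. a z - a (?p z)) z"
          by simp
      qed
    qed
    ultimately have "flat (Suc k) (pd d (\<lambda>z. a z - a (?p z)))" for d by (rule flat_cong)
    then show ?case using gc Suc.prems(1)
      by (simp add: germ_diff del: flat.simps(2)[of k])
  }
qed

section \<open>Smooth local inverses\<close>

lemma smooth_on_blinfun_derivative:
  fixes g :: "'a::euclidean_space \<Rightarrow> 'b::euclidean_space"
  assumes "smooth_on S g"
  obtains g' :: "'a \<Rightarrow> 'a \<Rightarrow>\<^sub>L 'b" where "\<And>x. x \<in> S \<Longrightarrow> (g has_derivative blinfun_apply (g' x)) (at x)"
    "continuous_on S g'"
proof (rule smooth_on_derivative[OF assms])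
  fix f' assume f': "\<And>x. x \<in> S \<Longrightarrow> (g has_derivative (\<lambda>h. \<Sum>i\<in>Basis. (h \<bullet> i) *\<^sub>R f' i x)) (at x)"
    "\<And>v. smooth_on S (\<lambda>x. \<Sum>i\<in>Basis. (v \<bullet> i) *\<^sub>R f' i x)"
  define g' where "g' x = (\<Sum>i\<in>Basis. blinfun_scaleR_left (f' i x) o\<^sub>L blinfun_inner_left i)" for x
  have cont: "continuous_on S (f' i)" if i: "i \<in> Basis" for i
  proof -
    have "(\<Sum>j\<in>Basis. (i \<bullet> j) *\<^sub>R f' j x) = f' i x" for x
    proof -
      have "(\<Sum>j\<in>Basis. (i \<bullet> j) *\<^sub>R f' j x) = (\<Sum>j\<in>Basis. if j = i then f' j x else 0)"
        using i by (intro sum.cong) (auto simp: inner_Basis)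
      then show ?thesis using i by simp
    qed
    then show ?thesis using smooth_on_continuous[OF f'(2)[of i]] by simp
  qed
  show ?thesis
  proof (rule that[of g'])
    show "(g has_derivative blinfun_apply (g' x)) (at x)" if "x \<in> S" for x
      by (rule has_derivative_eq_rhs[OF f'(1)[OF that]])
         (simp add: g'_def fun_eq_iff blinfun.sum_left)
    show "continuous_on S g'"
      unfolding g'_def
      by (intro continuous_on_sum bounded_bilinear.continuous_on[OF bounded_bilinear_blinfun_compose]
          bounded_linear.continuous_on[OF bounded_linear_blinfun_scaleR_left] continuous_on_const cont)
  qed
qed

text \<open>The columns \<open>W j\<close> of the inverse derivative turn every partial derivative of \<open>q \<circ> h\<close>
  into a function of the same form, so smoothness of \<open>h\<close> follows by coinduction.\<close>
lemma smooth_local_inverse: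
  fixes g :: "'a::euclidean_space \<Rightarrow> 'a" and W :: "'a \<Rightarrow> 'a \<Rightarrow> 'a"
  assumes S: "open S" "0 \<in> S" and g: "\<And>i. i \<in> Basis \<Longrightarrow> smooth_on S (\<lambda>x. g x \<bullet> i)" "g 0 = 0"
    and W: "\<And>i j. i \<in> Basis \<Longrightarrow> j \<in> Basis \<Longrightarrow> smooth_on S (\<lambda>x. W j x \<bullet> i)"
    and gW: "\<And>x j. x \<in> S \<Longrightarrow> j \<in> Basis \<Longrightarrow> frechet_derivative g (at x) (W j x) = j"
  obtains U V h where "open U" "U \<subseteq> S" "0 \<in> U" "open V" "0 \<in> V" "homeomorphism U V g h"
    "\<And>q :: 'a \<Rightarrow> real. smooth_on U q \<Longrightarrow> smooth_on V (\<lambda>y. q (h y))"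
    "\<And>(q :: 'a \<Rightarrow> real) y j. smooth_on U q \<Longrightarrow> y \<in> V \<Longrightarrow> j \<in> Basis \<Longrightarrow> pd j (\<lambda>y. q (h y)) y = pd (W j (h y)) q (h y)"
proof (rule smooth_on_blinfun_derivative[OF smooth_on_componentwise[OF S(1) g(1)]])
  fix g' :: "'a \<Rightarrow> 'a \<Rightarrow>\<^sub>L 'a"
  assume g': "\<And>x. x \<in> S \<Longrightarrow> (g has_derivative blinfun_apply (g' x)) (at x)" "continuous_on S g'"
  have g'W: "blinfun_apply (g' x) (W j x) = j" if "x \<in> S" "j \<in> Basis" for x j
    using gW[OF that] frechet_derivative_at[OF g'(1)[OF that(1)]] by simp
  \<comment> \<open>The matrix with columns \<open>W j 0\<close> is a right inverse of the
    derivative at 0; in finite dimension it is also the left inverse that the inverse function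
    theorem asks for.\<close>
  define R where "R = (\<Sum>j\<in>Basis. blinfun_scaleR_left (W j 0) o\<^sub>L blinfun_inner_left j)"
  have R: "blinfun_apply R y = (\<Sum>j\<in>Basis. (y \<bullet> j) *\<^sub>R W j 0)" for y
    by (simp add: R_def blinfun.sum_left)
  have "blinfun_apply (g' 0) (blinfun_apply R y) = y" for y
    using S(2) by (simp add: R blinfun.sum_right blinfun.scaleR_right g'W euclidean_representation)
  then have "blinfun_apply (g' 0) \<circ> blinfun_apply R = id" by (simp add: fun_eq_iff)
  then have "blinfun_apply R \<circ> blinfun_apply (g' 0) = id"
    using linear_inverse_left[of "blinfun_apply (g' 0)" "blinfun_apply R"]
    by (simp add: blinfun.bounded_linear_right bounded_linear.linear)
  then have inv: "R o\<^sub>L g' 0 = id_blinfun"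
    by (intro blinfun_eqI) (simp add: fun_eq_iff)
  show ?thesis
  proof (rule inverse_function_theorem[OF S(1) g' S(2) inv])
    fix U V h h'
    assume UV: "open U" "U \<subseteq> S" "0 \<in> U" "open V" "g 0 \<in> V" "homeomorphism U V g h"
      and h': "\<And>y. y \<in> V \<Longrightarrow> (h has_derivative h' y) (at y)"
        "\<And>y. y \<in> V \<Longrightarrow> h' y = Hilbert_Choice.inv (blinfun_apply (g' (h y)))"
        "\<And>y. y \<in> V \<Longrightarrow> bij (blinfun_apply (g' (h y)))"
    have hU: "h y \<in> U" if "y \<in> V" for y using UV(6) that unfolding homeomorphism_def by blast
    have h'W: "h' y j = W j (h y)" if "y \<in> V" "j \<in> Basis" for y j
      using h'(2)[OF that(1)] h'(3)[OF that(1)] g'W[of "h y" j] hU[OF that(1)] UV(2) that(2)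
      by (metis bij_is_inj inv_f_f subsetD)
    have der: "((\<lambda>y. q (h y)) has_derivative (\<lambda>k. pd (h' y k) q (h y))) (at y)"
      if "smooth_on U q" "y \<in> V" for q :: "'a \<Rightarrow> real" and y
      by (rule has_derivative_compose[OF h'(1)[OF that(2)] smooth_on_pd(1)[OF that(1) hU[OF that(2)]]])
    have pdj: "pd j (\<lambda>y. q (h y)) y = pd (W j (h y)) q (h y)"
      if "smooth_on U q" "y \<in> V" "j \<in> Basis" for q :: "'a \<Rightarrow> real" and y j
      using pd_eq[OF der[OF that(1,2)]] h'W[OF that(2,3)] by simp
    have "smooth_on V (\<lambda>y. q (h y))" if "smooth_on U q" for q :: "'a \<Rightarrow> real"
    proof (rule smooth_on_coinduct[OF UV(4), of _ "(\<lambda>(q :: 'a \<Rightarrow> real) y. q (h y)) ` {q. smooth_on U q}"])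
      fix f assume "f \<in> (\<lambda>(q :: 'a \<Rightarrow> real) y. q (h y)) ` {q. smooth_on U q}"
      then obtain q where q: "smooth_on U q" "f = (\<lambda>y. q (h y))" by auto
      let ?f = "\<lambda>j x. \<Sum>i\<in>Basis. (W j x \<bullet> i) * pd i q x"
      have "smooth_on U (?f j)" if "j \<in> Basis" for j
        using that UV(1,2) W smooth_on_pd(2)[OF q(1)]
        by (intro smooth_on_sum smooth_on_mult) (auto intro: smooth_on_subset)
      moreover have "(f has_derivative (\<lambda>k. \<Sum>j\<in>Basis. (k \<bullet> j) *\<^sub>R ?f j (h y))) (at y)" if "y \<in> V" for y
      proof -
        have "f differentiable (at y)" unfolding q(2) using der[OF q(1) that] by (rule differentiableI)
        from has_derivative_pd_sum[OF this] show ?thesis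
        proof (rule has_derivative_eq_rhs, intro ext sum.cong refl)
          fix k j :: 'a assume "j \<in> Basis"
          then show "(k \<bullet> j) * pd j f y = (k \<bullet> j) *\<^sub>R ?f j (h y)"
            unfolding q(2) pdj[OF q(1) that \<open>j \<in> Basis\<close>]
              pd_basis_sum[OF smooth_on_differentiable[OF q(1) hU[OF that]], of "W j (h y)"] by simp
        qed
      qed
      ultimately show "\<exists>g'. (\<forall>i\<in>Basis. g' i \<in> (\<lambda>(q :: 'a \<Rightarrow> real) y. q (h y)) ` {q. smooth_on U q}) \<and>
         (\<forall>x\<in>V. (f has_derivative (\<lambda>k. \<Sum>i\<in>Basis. (k \<bullet> i) *\<^sub>R g' i x)) (at x))"
        by (intro exI[of _ "\<lambda>j y. ?f j (h y)"]) auto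
    qed (use that in auto)
    then show ?thesis using that[OF UV(1-4) _ UV(6)] UV(5) g(2) pdj by simp
  qed
qed

subsection \<open>Inverting the straightening map\<close>

type_synonym 'm space = "(real^3) \<times> (real^'m)"

definition ei :: "3 \<Rightarrow> 'm::finite space" where
  "ei i = (axis i 1, 0)"

lemma ei_Basis [simp]: "ei i \<in> Basis"
  by (auto simp: ei_def Basis_prod_def Basis_vec_def)

lemma ei_eq_iff [simp]: "ei i = ei j \<longleftrightarrow> i = j"
  by (simp add: ei_def axis_eq_axis)

lemma inner_ei [simp]: "z \<bullet> ei i = fst z $ i"
  by (cases z) (simp add: ei_def inner_axis)

definition mk3 :: "real \<Rightarrow> real \<Rightarrow> real \<Rightarrow> real^3" where
  "mk3 a b c = a *\<^sub>R axis 1 1 + b *\<^sub>R axis 2 1 + c *\<^sub>R axis 3 1"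

lemma mk3_nth [simp]: "mk3 a b c $ 1 = a" "mk3 a b c $ 2 = b" "mk3 a b c $ 3 = c"
  by (simp_all add: mk3_def axis_def)

lemma mk3_expand: "mk3 (v $ 1) (v $ 2) (v $ 3) = v"
  by (simp add: vec_eq_iff forall_3)

lemma mk3_0 [simp]: "mk3 0 0 0 = 0"
  by (simp add: vec_eq_iff forall_3)

lemma inner_mk3: "mk3 a b c \<bullet> d = a * d $ 1 + b * d $ 2 + c * d $ 3"
  by (simp add: inner_vec_def sum_3)

lemma fst_ei [simp]: "fst (ei i) = axis i 1" and snd_ei [simp]: "snd (ei i) = 0"
  by (simp_all add: ei_def)

lemma pd_fst:
  fixes q :: "'m::finite space \<Rightarrow> real"
  assumes "q differentiable (at z)"
  shows "pd (v, 0) q z = v $ 1 * pd (ei 1) q z + v $ 2 * pd (ei 2) q z + v $ 3 * pd (ei 3) q z"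
proof -
  interpret linear "\<lambda>v. pd v q z" by (rule pd_linear[OF assms])
  have "(v, 0) = v $ 1 *\<^sub>R ei 1 + v $ 2 *\<^sub>R ei 2 + v $ 3 *\<^sub>R (ei 3 :: 'm space)"
    using mk3_expand[of v] by (simp add: ei_def mk3_def)
  then show ?thesis by (simp add: add scale)
qed

lemma jacobian_nth:
  fixes G :: "'m::finite space \<Rightarrow> real^3"
  assumes "G differentiable (at (\<xi>, l))"
  shows "jacobian (\<lambda>\<xi>'. G (\<xi>', l)) (at \<xi>) $ i $ j = pd (ei j) (\<lambda>z. G z $ i) (\<xi>, l)"
proof -
  have 1: "(G has_derivative frechet_derivative G (at (\<xi>, l))) (at (\<xi>, l))"
    using assms by (simp add: frechet_derivative_works)
  have 2: "((\<lambda>\<xi>'. (\<xi>', l)) has_derivative (\<lambda>h. (h, 0))) (at \<xi>)"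
    by (auto intro!: derivative_eq_intros)
  have "frechet_derivative (\<lambda>\<xi>'. G (\<xi>', l)) (at \<xi>) = (\<lambda>h. frechet_derivative G (at (\<xi>, l)) (h, 0))"
    by (rule frechet_derivative_at[symmetric, OF has_derivative_compose[OF 2 1]])
  moreover have "pd (ei j) (\<lambda>z. G z $ i) (\<xi>, l) = frechet_derivative G (at (\<xi>, l)) (ei j) $ i"
    by (rule pd_eq[OF bounded_linear.has_derivative[OF bounded_linear_vec_nth 1]])
  ultimately show ?thesis by (simp add: jacobian_def matrix_def ei_def)
qed

text \<open>The determinant \<open>jac\<close> for the concrete state directions, stated
  independently of any shift operator.\<close>

definition jac3 :: "('m::finite space \<Rightarrow> real) \<Rightarrow> _ \<Rightarrow> _ \<Rightarrow> 'm space \<Rightarrow> real" where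
  "jac3 u v w z = pd (ei 1) u z * (pd (ei 2) v z * pd (ei 3) w z - pd (ei 3) v z * pd (ei 2) w z)
     - pd (ei 2) u z * (pd (ei 1) v z * pd (ei 3) w z - pd (ei 3) v z * pd (ei 1) w z)
     + pd (ei 3) u z * (pd (ei 1) v z * pd (ei 2) w z - pd (ei 2) v z * pd (ei 1) w z)"

text \<open>Cross product of the gradients in the state directions. Paired with a third gradient it
  yields \<open>jac3\<close>, so it is tangent to the level sets of both \<open>p\<close> and
  \<open>q\<close>.\<close>

definition grad_cross :: "('m::finite space \<Rightarrow> real) \<Rightarrow> ('m space \<Rightarrow> real) \<Rightarrow>
    'm space \<Rightarrow> real^3" where
  "grad_cross p q z = mk3 (pd (ei 2) p z * pd (ei 3) q z - pd (ei 3) p z * pd (ei 2) q z)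
     (pd (ei 3) p z * pd (ei 1) q z - pd (ei 1) p z * pd (ei 3) q z)
     (pd (ei 1) p z * pd (ei 2) q z - pd (ei 2) p z * pd (ei 1) q z)"

lemma pd_grad_cross:
  assumes "q differentiable (at z)"
  shows "pd (c *\<^sub>R grad_cross u v z, 0) q z = c * jac3 u v q z"
  unfolding pd_fst[OF assms] by (simp add: grad_cross_def jac3_def algebra_simps)

lemma jac3_cyclic: "jac3 u v u z = 0" "jac3 u v v z = 0" "jac3 v w u z = jac3 u v w z" "jac3 w u v z = jac3 u v w z"
  by (simp_all add: jac3_def algebra_simps)

lemma germ_common_ball:
  assumes "finite Q" "\<And>q. q \<in> Q \<Longrightarrow> germ q"
  shows "\<exists>r>0. \<forall>q\<in>Q. smooth_on (ball 0 r) q"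
  using assms
proof (induction Q rule: finite_induct)
  case empty
  then show ?case by (intro exI[of _ 1]) auto
next
  case (insert q Q)
  then obtain r where r: "r > 0" "\<forall>q\<in>Q. smooth_on (ball 0 r) q" by blast
  obtain r' where r': "r' > 0" "smooth_on (ball 0 r') q" using germ_ball[of q] insert.prems by blast
  show ?case
    using r r' by (intro exI[of _ "min r r'"]) (auto intro: smooth_on_subset)
qed

lemma jac3_germ: "germ u \<Longrightarrow> germ v \<Longrightarrow> germ w \<Longrightarrow> germ (jac3 u v w)"
  unfolding jac3_def[abs_def] by (intro germ_add germ_diff germ_mult germ_pd)

locale coordinates =
  fixes u v w :: "'m::finite space \<Rightarrow> real"
  assumes germs: "germ u" "germ v" "germ w" and origin: "u 0 = 0" "v 0 = 0" "w 0 = 0"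
    and unit: "pd (ei 1) u 0 = 1" "pd (ei 2) u 0 = 0" "pd (ei 3) u 0 = 0"
      "pd (ei 1) v 0 = 0" "pd (ei 2) v 0 = 1" "pd (ei 3) v 0 = 0"
      "pd (ei 1) w 0 = 0" "pd (ei 2) w 0 = 0" "pd (ei 3) w 0 = 1"
begin

definition \<Psi> :: "'m space \<Rightarrow> 'm space" where
  "\<Psi> z = (mk3 (u z) (v z) (w z), snd z)"

text \<open>The preimage of \<open>j\<close> under the derivative of \<open>\<Psi>\<close>, by Cramer's rule.\<close>
definition dual :: "'m space \<Rightarrow> 'm space \<Rightarrow> 'm space" where
  "dual j z = (0, snd j) +
     (((fst j $ 1 - pd (0, snd j) u z) * inverse (jac3 u v w z)) *\<^sub>R grad_cross v w z +
      ((fst j $ 2 - pd (0, snd j) v z) * inverse (jac3 u v w z)) *\<^sub>R grad_cross w u z +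
      ((fst j $ 3 - pd (0, snd j) w z) * inverse (jac3 u v w z)) *\<^sub>R grad_cross u v z, 0)"

lemma dual_pd:
  assumes d: "q differentiable (at z)"
  shows "pd (dual j z) q z = pd (0, snd j) q z +
     ((fst j $ 1 - pd (0, snd j) u z) * inverse (jac3 u v w z)) * jac3 v w q z +
     ((fst j $ 2 - pd (0, snd j) v z) * inverse (jac3 u v w z)) * jac3 w u q z +
     ((fst j $ 3 - pd (0, snd j) w z) * inverse (jac3 u v w z)) * jac3 u v q z"
proof -
  interpret linear "\<lambda>v. pd v q z" by (rule pd_linear[OF d])
  have "pd (a + b + c, 0) q z = pd (a, 0) q z + pd (b, 0) q z + pd (c, 0) q z" for a b c
    using add[of "(a + b, 0)" "(c, 0)"] add[of "(a, 0)" "(b, 0)"] by simp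
  then show ?thesis unfolding dual_def add by (simp add: pd_grad_cross[OF d])
qed

lemma \<Psi>_has_derivative:
  assumes "u differentiable (at z)" "v differentiable (at z)" "w differentiable (at z)"
  shows "(\<Psi> has_derivative (\<lambda>d. (mk3 (pd d u z) (pd d v z) (pd d w z), snd d))) (at z)"
  unfolding \<Psi>_def[abs_def] mk3_def
  by (auto intro!: derivative_eq_intros has_derivative_pd assms)

lemma \<Psi>_dual:
  assumes d: "u differentiable (at z)" "v differentiable (at z)" "w differentiable (at z)"
    and J: "jac3 u v w z \<noteq> 0"
  shows "frechet_derivative \<Psi> (at z) (dual j z) = j"
proof -
  have 1: "pd (dual j z) u z = fst j $ 1" "pd (dual j z) v z = fst j $ 2" "pd (dual j z) w z = fst j $ 3"
    using J by (simp_all add: dual_pd d jac3_cyclic mult.assoc)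
  have "snd (dual j z) = snd j" by (simp add: dual_def)
  then show ?thesis
    using frechet_derivative_at[OF \<Psi>_has_derivative[OF d], symmetric] by (simp add: 1 mk3_expand)
qed

lemma inner_prod_alt: "x \<bullet> y = fst x \<bullet> fst y + snd x \<bullet> snd y"
  by (cases x; cases y) simp

lemma smooth_on_dual:
  assumes "smooth_on S u" "smooth_on S v" "smooth_on S w" "smooth_on S (\<lambda>z. inverse (jac3 u v w z))"
  shows "smooth_on S (\<lambda>z. dual j z \<bullet> i)"
proof -
  have op: "open S" by (rule smooth_on_open[OF assms(1)])
  have p: "smooth_on S (pd d u)" "smooth_on S (pd d v)" "smooth_on S (pd d w)" for d
    using assms by (auto intro: smooth_on_pd(2))
  have eq: "(\<lambda>z. dual j z \<bullet> i) = (\<lambda>z. snd j \<bullet> snd i +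
     (((fst j $ 1 - pd (0, snd j) u z) * inverse (jac3 u v w z)) * (grad_cross v w z \<bullet> fst i) +
      ((fst j $ 2 - pd (0, snd j) v z) * inverse (jac3 u v w z)) * (grad_cross w u z \<bullet> fst i) +
      ((fst j $ 3 - pd (0, snd j) w z) * inverse (jac3 u v w z)) * (grad_cross u v z \<bullet> fst i)))"
    by (simp add: fun_eq_iff dual_def inner_prod_alt inner_add_left)
  show ?thesis
    unfolding eq grad_cross_def inner_mk3
    by (intro smooth_on_add smooth_on_mult smooth_on_diff smooth_on_const p op assms(4))
qed

lemma jac3_0: "jac3 u v w 0 = 1"
  by (simp add: jac3_def unit)

lemma dual_ei_0: "dual (ei i) 0 = ei i"
proof -
  have d: "u differentiable (at 0)" "v differentiable (at 0)" "w differentiable (at 0)"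
    using germs germ_differentiable eventually_nhds_x_imp_x by blast+
  have "(0, 0) = (0 :: 'm space)" by (simp add: zero_prod_def)
  then have "pd (0, 0) u 0 = 0" "pd (0, 0) v 0 = 0" "pd (0, 0) w 0 = 0"
    using d by simp_all
  then show ?thesis
    unfolding dual_def grad_cross_def jac3_0 using exhaust_3[of i]
    by (intro prod_eqI) (auto simp: unit vec_eq_iff forall_3 axis_def)
qed

end

text \<open>The part of the theorem's conclusion shared by fields and diffeomorphisms: everything
  except the error estimate.\<close>

definition normalizing where
  "normalizing V \<phi> W \<epsilon> \<mu>1 \<mu>2 P p \<longleftrightarrow>
     (0, 0) \<in> V \<and> smooth_on V (\<lambda>z. \<phi> (fst z) (snd z)) \<and>
     \<phi> 0 0 = 0 \<and> jacobian (\<lambda>\<eta>. \<phi> \<eta> 0) (at 0) = mat 1 \<and>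
     (\<forall>\<eta> l. (\<eta>, l) \<in> V \<longrightarrow> det (jacobian (\<lambda>\<eta>'. \<phi> \<eta>' l) (at \<eta>)) = 1) \<and>
     0 \<in> W \<and> smooth_on W \<epsilon> \<and> smooth_on W \<mu>1 \<and> smooth_on W \<mu>2 \<and>
     \<epsilon> 0 = 0 \<and> \<mu>1 0 = 0 \<and> \<mu>2 0 = 0 \<and>
     (0, 0, 0) \<in> P \<and> smooth_on P (\<lambda>(l, x, y). p l x y) \<and>
     (\<forall>l. (l, 0, 0) \<in> P \<longrightarrow> p l 0 0 = 0 \<and>
        ((\<lambda>(x, y). p l x y) has_derivative (\<lambda>_. 0)) (at (0, 0)))"
  for V :: "('m::finite space) set" and \<phi> :: "real^3 \<Rightarrow> real^'m \<Rightarrow> real^3"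
    and W :: "(real^'m) set" and \<epsilon> \<mu>1 \<mu>2 :: "real^'m \<Rightarrow> real"
    and P :: "((real^'m) \<times> real \<times> real) set" and p :: "real^'m \<Rightarrow> real \<Rightarrow> real \<Rightarrow> real"

lemma pd_fst_nth: "pd d (\<lambda>z. fst z $ i) x = fst d $ i"
  by (rule pd_bounded_linear)
     (rule bounded_linear_compose[OF bounded_linear_vec_nth bounded_linear_fst])

lemma smooth_on_fst_nth: "open S \<Longrightarrow> smooth_on S (\<lambda>z. fst z $ i)"
  for S :: "('m::finite space) set"
  by (rule smooth_on_linear) (auto intro: bounded_linear_compose[OF bounded_linear_vec_nth bounded_linear_fst])

lemma germ_fst_nth: "germ (\<lambda>z::'m::finite space. fst z $ i)"
  by (rule germI[OF smooth_on_fst_nth[OF open_UNIV]]) simp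

lemma inner_Pair_alt: "(a, b) \<bullet> j = a \<bullet> fst j + b \<bullet> snd j"
  by (cases j) simp

lemma smooth_on_inner_linear:
  fixes f :: "'a::euclidean_space \<Rightarrow> 'b::euclidean_space"
  assumes "open S" "bounded_linear f"
  shows "smooth_on S (\<lambda>x. f x \<bullet> j)"
  using assms by (intro smooth_on_linear bounded_linear_compose[OF bounded_linear_inner_left])

lemma bounded_linear_mk3:
  assumes "bounded_linear f" "bounded_linear g" "bounded_linear h"
  shows "bounded_linear (\<lambda>x. mk3 (f x) (g x) (h x))"
  unfolding mk3_def
  by (intro bounded_linear_add bounded_linear_compose[OF bounded_linear_scaleR_left] assms)

lemma germ_nonzero:
  assumes "germ f" "f 0 \<noteq> 0"
  shows "eventually (\<lambda>z. f z \<noteq> 0) (nhds 0)"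
proof -
  have "isCont f 0" by (rule eventually_nhds_x_imp_x[OF germ_isCont[OF assms(1)]])
  then have "(f \<longlongrightarrow> f 0) (nhds 0)" unfolding isCont_def by (rule tendsto_at_iff_tendsto_nhds[THEN iffD1])
  then show ?thesis using assms(2) by (rule tendsto_imp_eventually_ne)
qed

section \<open>The exactly volume-preserving transformation\<close>

context coordinates
begin

lemma \<Psi>_0: "\<Psi> 0 = 0"
  by (intro prod_eqI) (simp_all add: \<Psi>_def origin)

lemma \<Psi>_inner: "\<Psi> z \<bullet> i = u z * fst i $ 1 + v z * fst i $ 2 + w z * fst i $ 3 + snd z \<bullet> snd i"
  by (simp add: \<Psi>_def inner_Pair_alt inner_mk3)

lemma smooth_on_\<Psi>:
  assumes "smooth_on S u" "smooth_on S v" "smooth_on S w"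
  shows "smooth_on S (\<lambda>z. \<Psi> z \<bullet> i)"
proof -
  have "open S" by (rule smooth_on_open[OF assms(1)])
  then show ?thesis
    unfolding \<Psi>_inner
    by (intro smooth_on_add smooth_on_mult smooth_on_const assms smooth_on_inner_linear bounded_linear_snd)
qed

lemma germ_\<Psi>: "germ (\<lambda>z. \<Psi> z \<bullet> i)"
  unfolding \<Psi>_inner
  by (intro germ_add germ_mult germ_const germs germ_linear
      bounded_linear_compose[OF bounded_linear_inner_left bounded_linear_snd])

lemma dual_ei:
  assumes "u differentiable (at z)" "v differentiable (at z)" "w differentiable (at z)"
  shows "dual (ei 1) z = (inverse (jac3 u v w z) *\<^sub>R grad_cross v w z, 0)"
    "dual (ei 2) z = (inverse (jac3 u v w z) *\<^sub>R grad_cross w u z, 0)"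
    "dual (ei 3) z = (inverse (jac3 u v w z) *\<^sub>R grad_cross u v z, 0)"
proof -
  have "(0, 0) = (0 :: 'm space)" by (simp add: zero_prod_def)
  then have "pd (0, 0) u z = 0" "pd (0, 0) v z = 0" "pd (0, 0) w z = 0"
    using assms by simp_all
  then show "dual (ei 1) z = (inverse (jac3 u v w z) *\<^sub>R grad_cross v w z, 0)"
    "dual (ei 2) z = (inverse (jac3 u v w z) *\<^sub>R grad_cross w u z, 0)"
    "dual (ei 3) z = (inverse (jac3 u v w z) *\<^sub>R grad_cross u v z, 0)"
    unfolding dual_def by (simp_all add: axis_def)
qed

lemma jac3_grad_cross:
  "jac3 q f g z = grad_cross f g z $ 1 * pd (ei 1) q z + grad_cross f g z $ 2 * pd (ei 2) q z + grad_cross f g z $ 3 * pd (ei 3) q z"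
  by (simp add: jac3_def grad_cross_def algebra_simps)

text \<open>\<open>A\<close> is the Jacobian matrix of \<open>(x, y, q)\<close> composed with the
  inverse of \<open>\<Psi>\<close>, the inverse being given by Cramer's rule. The three factors
  \<open>1 / J\<close>, the determinant \<open>J^2\<close> of the cofactor matrix and the factor
  \<open>pd (ei 3) q = J\<close> multiply to 1.\<close>

lemma det_dual:
  assumes J: "jac3 u v w z \<noteq> 0" and q: "pd (ei 3) q z = jac3 u v w z"
    and A: "\<And>i. A $ i = vector [c $ i, d $ i, e $ i]"
    and c: "c = mk3 (inverse (jac3 u v w z) * grad_cross v w z $ 1) (inverse (jac3 u v w z) * grad_cross v w z $ 2) (inverse (jac3 u v w z) * jac3 v w q z)"
    and d: "d = mk3 (inverse (jac3 u v w z) * grad_cross w u z $ 1) (inverse (jac3 u v w z) * grad_cross w u z $ 2) (inverse (jac3 u v w z) * jac3 w u q z)"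
    and e: "e = mk3 (inverse (jac3 u v w z) * grad_cross u v z $ 1) (inverse (jac3 u v w z) * grad_cross u v z $ 2) (inverse (jac3 u v w z) * jac3 u v q z)"
  shows "det (A :: real^3^3) = 1"
proof -
  let ?i = "inverse (jac3 u v w z)"
  have cyc: "jac3 v w q z = jac3 q v w z" "jac3 w u q z = jac3 q w u z" "jac3 u v q z = jac3 q u v z"
    by (simp_all add: jac3_def algebra_simps)
  \<comment> \<open>The last row is a combination of the three cofactor rows with weights
    \<open>t1\<close>, \<open>t2\<close>, \<open>t3\<close>; the parts proportional to the first two
    rows drop out.\<close>
  have lin: "(k * c1) * (k * d2) * (k * (e1 * t1 + e2 * t2 + e3 * t3)) + (k * d1) * (k * e2) * (k * (c1 * t1 + c2 * t2 + c3 * t3))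
     + (k * e1) * (k * c2) * (k * (d1 * t1 + d2 * t2 + d3 * t3))
     - (k * c1) * (k * e2) * (k * (d1 * t1 + d2 * t2 + d3 * t3)) - (k * d1) * (k * c2) * (k * (e1 * t1 + e2 * t2 + e3 * t3))
     - (k * e1) * (k * d2) * (k * (c1 * t1 + c2 * t2 + c3 * t3))
     = k * k * k * t3 * (c1 * (d2 * e3 - d3 * e2) - c2 * (d1 * e3 - d3 * e1) + c3 * (d1 * e2 - d2 * e1))"
    for k c1 c2 c3 d1 d2 d3 e1 e2 e3 t1 t2 t3 :: real
    by algebra
  have "det A = ?i * ?i * ?i * pd (ei 3) q z *
     (grad_cross v w z $ 1 * (grad_cross w u z $ 2 * grad_cross u v z $ 3 - grad_cross w u z $ 3 * grad_cross u v z $ 2)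
     - grad_cross v w z $ 2 * (grad_cross w u z $ 1 * grad_cross u v z $ 3 - grad_cross w u z $ 3 * grad_cross u v z $ 1)
     + grad_cross v w z $ 3 * (grad_cross w u z $ 1 * grad_cross u v z $ 2 - grad_cross w u z $ 2 * grad_cross u v z $ 1))"
    unfolding det_3 A c d e vector_3 mk3_nth cyc jac3_grad_cross[of q] by (rule lin)
  \<comment> \<open>The determinant of a three by three cofactor matrix is the square of the
    original determinant.\<close>
  also have "\<dots> = ?i * ?i * ?i * pd (ei 3) q z * (jac3 u v w z * jac3 u v w z)"
  proof -
    have "(grad_cross v w z $ 1 * (grad_cross w u z $ 2 * grad_cross u v z $ 3 - grad_cross w u z $ 3 * grad_cross u v z $ 2)
     - grad_cross v w z $ 2 * (grad_cross w u z $ 1 * grad_cross u v z $ 3 - grad_cross w u z $ 3 * grad_cross u v z $ 1)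
     + grad_cross v w z $ 3 * (grad_cross w u z $ 1 * grad_cross u v z $ 2 - grad_cross w u z $ 2 * grad_cross u v z $ 1))
      = jac3 u v w z * jac3 u v w z"
      unfolding grad_cross_def mk3_nth jac3_def by algebra
    then show ?thesis by simp
  qed
  also have "\<dots> = 1" using J by (simp add: q field_simps)
  finally show ?thesis .
qed

text \<open>Besides the normalizing data it records how they arise, for use in the error estimates:
  \<open>h\<close> is the local inverse of \<open>\<Psi>\<close>, \<open>\<phi>\<close> is
  \<open>h\<close> followed by the correction with \<open>A3\<close>, and \<open>a\<close> is the
  last component \<open>\<Theta>\<close> of the transformed system, independent of the third
  coordinate up to order \<open>Suc K\<close>.\<close>

definition straightened where
  "straightened K \<Theta> V \<phi> W \<epsilon> \<mu>1 \<mu>2 P p a h A3 \<longleftrightarrow>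
    normalizing V \<phi> W \<epsilon> \<mu>1 \<mu>2 P p \<and>
    (\<forall>j\<in>Basis. germ (\<lambda>y. h y \<bullet> j)) \<and> h 0 = 0 \<and>
    (\<lambda>y. \<Psi> (h y)) \<doteq> (\<lambda>y. y) \<and> (\<lambda>x. h (\<Psi> x)) \<doteq> (\<lambda>x. x) \<and>
    germ A3 \<and> flat (Suc K) (\<lambda>z. A3 z - fst z $ 3) \<and>
    (\<forall>\<eta> l. \<phi> \<eta> l = mk3 (fst (h (\<eta>, l)) $ 1) (fst (h (\<eta>, l)) $ 2) (A3 (h (\<eta>, l)))) \<and>
    germ a \<and> (\<forall>y. a y = \<Theta> (h y)) \<and>
    (\<forall>l x y. \<epsilon> l + \<mu>1 l * x + \<mu>2 l * y + p l x y = a (mk3 x y 0, l)) \<and>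
    flat (Suc K) (\<lambda>y. a y - a (mk3 (fst y $ 1) (fst y $ 2) 0, snd y))"
  for V :: "('m space) set"

lemma straightening:
  assumes \<Theta>: "germ \<Theta>" "\<Theta> 0 = 0" "pd (ei 1) \<Theta> 0 = 0" "pd (ei 2) \<Theta> 0 = 0"
    and J: "flat (Suc K) (\<lambda>z. jac3 u v w z - 1)" and J\<Theta>: "flat (Suc K) (jac3 u v \<Theta>)"
  shows "\<exists>V \<phi> W \<epsilon> \<mu>1 \<mu>2 P p a h A3. 
    straightened K \<Theta> V \<phi> W \<epsilon> \<mu>1 \<mu>2 P p a h A3"
proof (rule antiderivative[OF jac3_germ[OF germs] ei_Basis[of 3]])
  fix A3 assume A3: "germ A3" "pd (ei 3) A3 \<doteq> jac3 u v w" and A3_0: "\<And>z. z \<bullet> ei 3 = 0 \<Longrightarrow> A3 z = 0"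
  let ?J = "jac3 u v w" and ?b = "\<lambda>z. A3 z - fst z $ 3"
  have gJ: "germ ?J" by (rule jac3_germ[OF germs])
  have gb: "germ ?b" by (rule germ_diff[OF A3(1) germ_fst_nth])
  have proj: "z - (z \<bullet> ei 3) *\<^sub>R ei 3 = (mk3 (fst z $ 1) (fst z $ 2) 0, snd z)" for z :: "'m space"
    by (intro prod_eqI) (auto simp: vec_eq_iff forall_3 axis_def)
  \<comment> \<open>\<open>A3 - z\<close> vanishes on the plane \<open>z = 0\<close> and its
    \<open>z\<close>-derivative is \<open>J - 1\<close>, so it vanishes to one order more than
    \<open>J - 1\<close>.\<close>
  have fb: "flat (Suc (Suc K)) ?b"
  proof -
    have "(\<lambda>z. ?J z - 1) \<doteq> pd (ei 3) ?b"
      using pd_diff[OF A3(1) germ_fst_nth, of "ei 3" 3] A3(2)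
      by (rule eventually_elim2) (simp add: pd_fst_nth)
    from flat_minus_projection[OF ei_Basis gb flat_cong[OF J this]]
    have "flat (Suc (Suc K)) (\<lambda>z. ?b z - ?b (z - (z \<bullet> ei 3) *\<^sub>R ei 3))" .
    moreover have "?b (z - (z \<bullet> ei 3) *\<^sub>R ei 3) = 0" for z
      unfolding proj using A3_0[of "(mk3 (fst z $ 1) (fst z $ 2) 0, snd z)"] by simp
    ultimately show ?thesis by (simp only: diff_0_right)
  qed
  have fb0: "A3 0 = 0" "pd d A3 0 = fst d $ 3" for d
  proof -
    show "A3 0 = 0" by (rule A3_0) simp
    have "A3 differentiable (at 0)" "(\<lambda>z::'m space. fst z $ 3) differentiable (at 0)"
      by (rule eventually_nhds_x_imp_x[OF germ_differentiable[OF A3(1)]],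
          rule eventually_nhds_x_imp_x[OF germ_differentiable[OF germ_fst_nth]])
    from pd_diff_at[OF this, of d] have "pd d ?b 0 = pd d A3 0 - fst d $ 3" by (simp add: pd_fst_nth)
    moreover have "pd d ?b 0 = 0" using flat_pd[OF fb, of d] by simp
    ultimately show "pd d A3 0 = fst d $ 3" by simp
  qed
  have iJ: "germ (\<lambda>z. inverse (?J z))" by (rule germ_inverse[OF gJ]) (simp add: jac3_0)
  have "\<exists>r>0. \<forall>q\<in>{u, v, w, A3, \<Theta>, (\<lambda>z. inverse (?J z))}. smooth_on (ball 0 r) q"
    by (rule germ_common_ball) (use germs A3 \<Theta> iJ in auto)
  then obtain r1 where r1: "r1 > 0" "smooth_on (ball 0 r1) u" "smooth_on (ball 0 r1) v" "smooth_on (ball 0 r1) w"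
    "smooth_on (ball 0 r1) A3" "smooth_on (ball 0 r1) \<Theta>" "smooth_on (ball 0 r1) (\<lambda>z. inverse (?J z))"
    by auto
  have "eventually (\<lambda>z. pd (ei 3) A3 z = ?J z \<and> ?J z \<noteq> 0) (nhds 0)"
    by (intro eventually_conj A3(2) germ_nonzero[OF gJ]) (simp add: jac3_0)
  then obtain r2 where r2: "r2 > 0" "\<And>z. dist z 0 < r2 \<Longrightarrow> pd (ei 3) A3 z = ?J z \<and> ?J z \<noteq> 0"
    unfolding eventually_nhds_metric by blast
  define S where "S = ball (0 :: 'm space) (min r1 r2)"
  have S: "open S" "0 \<in> S" "S \<subseteq> ball 0 r1" using r1(1) r2(1) by (auto simp: S_def)
  note sm = r1(2-7)[THEN smooth_on_subset, OF S(1,3)]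
  have SJ: "pd (ei 3) A3 z = ?J z" "?J z \<noteq> 0" if "z \<in> S" for z
    using r2(2)[of z] that by (auto simp: S_def dist_commute)
  have Sd: "u differentiable (at z)" "v differentiable (at z)" "w differentiable (at z)" "A3 differentiable (at z)" if "z \<in> S" for z
    using smooth_on_differentiable[OF sm(1) that] smooth_on_differentiable[OF sm(2) that]
      smooth_on_differentiable[OF sm(3) that] smooth_on_differentiable[OF sm(4) that] by auto
  have \<Psi>d: "frechet_derivative \<Psi> (at z) (dual j z) = j" if "z \<in> S" for z j
    by (rule \<Psi>_dual[OF Sd(1-3)[OF that] SJ(2)[OF that]])
  show ?thesis
  proof (rule smooth_local_inverse[OF S(1,2) smooth_on_\<Psi>[OF sm(1-3)] \<Psi>_0 smooth_on_dual[OF sm(1-3,6)] \<Psi>d])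
    fix U V h
    assume UV: "open U" "U \<subseteq> S" "0 \<in> U" "open V" "0 \<in> V" "homeomorphism U V \<Psi> h"
      and comp: "\<And>q :: 'm space \<Rightarrow> real. smooth_on U q \<Longrightarrow> smooth_on V (\<lambda>y. q (h y))"
      and pdcomp: "\<And>(q :: 'm space \<Rightarrow> real) y j. smooth_on U q \<Longrightarrow> y \<in> V \<Longrightarrow> j \<in> Basis \<Longrightarrow>
         pd j (\<lambda>y. q (h y)) y = pd (dual j (h y)) q (h y)"
    have hU: "h y \<in> U" "\<Psi> (h y) = y" if "y \<in> V" for y
      using UV(6) that unfolding homeomorphism_def by blast+
    have h\<Psi>: "h (\<Psi> x) = x" if "x \<in> U" for x
      using UV(6) that unfolding homeomorphism_def by blast
    have h0: "h 0 = 0" using h\<Psi>[OF UV(3)] \<Psi>_0 by simp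
    note smU = sm[THEN smooth_on_subset, OF UV(1,2)]
    have gh: "germ (\<lambda>y. h y \<bullet> j)" for j
      by (rule germI[OF comp UV(5)]) (intro smooth_on_linear UV(1) bounded_linear_inner_left)
    define \<phi> where "\<phi> \<eta> l = mk3 (fst (h (\<eta>, l)) $ 1) (fst (h (\<eta>, l)) $ 2) (A3 (h (\<eta>, l)))" for \<eta> l
    define a where "a y = \<Theta> (h y)" for y
    define \<epsilon> where "\<epsilon> l = a (0, l)" for l
    define \<mu>1 where "\<mu>1 l = pd (ei 1) a (0, l)" for l
    define \<mu>2 where "\<mu>2 l = pd (ei 2) a (0, l)" for l
    \<comment> \<open>Removing the value and the first derivatives at \<open>x = y = 0\<close>, for
      each parameter separately, is what makes \<open>p\<close> begin with quadratic terms.\<close>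
    define p where "p l x y = a (mk3 x y 0, l) - \<epsilon> l - \<mu>1 l * x - \<mu>2 l * y" for l x y
    define W where "W = (\<lambda>l. (0 :: real^3, l)) -` V"
    \<comment> \<open>Besides the point where \<open>a\<close> is evaluated, the point
      \<open>(0, l)\<close> must lie in \<open>V\<close>, since \<open>\<epsilon>\<close>,
      \<open>\<mu>1\<close> and \<open>\<mu>2\<close> are read off there.\<close>
    define P where "P = (\<lambda>(l, x, y). (mk3 x y 0, l)) -` V \<inter> fst -` W"
    have sa: "smooth_on V a" unfolding a_def[abs_def] by (rule comp[OF smU(5)])
    have ga: "germ a" by (rule germI[OF sa UV(5)])
    have zz: "(0, 0) = (0 :: 'm space)" by (simp add: zero_prod_def)
    have V0: "(0, 0) \<in> V" using UV(5) by (simp add: zz)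

    have comps: "(\<lambda>z. \<phi> (fst z) (snd z) $ 1) = (\<lambda>z. fst (h z) $ 1)" "(\<lambda>z. \<phi> (fst z) (snd z) $ 2) = (\<lambda>z. fst (h z) $ 2)"
      "(\<lambda>z. \<phi> (fst z) (snd z) $ 3) = (\<lambda>z. A3 (h z))"
      by (simp_all add: \<phi>_def fun_eq_iff)
    have \<phi>_smooth: "smooth_on V (\<lambda>z. \<phi> (fst z) (snd z))"
    proof (rule smooth_on_componentwise[OF UV(4)])
      fix j :: "real^3"
      have "smooth_on V (\<lambda>z. fst (h z) $ 1 * j $ 1 + fst (h z) $ 2 * j $ 2 + A3 (h z) * j $ 3)"
        by (intro smooth_on_add smooth_on_mult smooth_on_const UV(4) comp smU(4)
             comp[OF smooth_on_fst_nth[OF UV(1)]])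
      then show "smooth_on V (\<lambda>z. \<phi> (fst z) (snd z) \<bullet> j)"
        by (simp add: \<phi>_def inner_mk3)
    qed
    have jac_nth: "jacobian (\<lambda>\<eta>'. \<phi> \<eta>' l) (at \<eta>) $ i $ j = pd (ei j) (\<lambda>z. \<phi> (fst z) (snd z) $ i) (\<eta>, l)"
      if "(\<eta>, l) \<in> V" for \<eta> l i j
      using jacobian_nth[OF smooth_on_differentiable[OF \<phi>_smooth that], of i j] by simp
    have jac12: "jacobian (\<lambda>\<eta>'. \<phi> \<eta>' l) (at \<eta>) $ 1 $ j = fst (dual (ei j) (h (\<eta>, l))) $ 1"
      "jacobian (\<lambda>\<eta>'. \<phi> \<eta>' l) (at \<eta>) $ 2 $ j = fst (dual (ei j) (h (\<eta>, l))) $ 2"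
      "jacobian (\<lambda>\<eta>'. \<phi> \<eta>' l) (at \<eta>) $ 3 $ j = pd (dual (ei j) (h (\<eta>, l))) A3 (h (\<eta>, l))"
      if V: "(\<eta>, l) \<in> V" for \<eta> l j
      unfolding jac_nth[OF V] comps
      using pdcomp[OF smooth_on_fst_nth[OF UV(1)] V ei_Basis] pdcomp[OF smU(4) V ei_Basis]
      by (simp_all add: pd_fst_nth)
    have "normalizing V \<phi> W \<epsilon> \<mu>1 \<mu>2 P p"
      unfolding normalizing_def
    proof (intro conjI allI impI)
      show "(0, 0) \<in> V" by (rule V0)
      show "smooth_on V (\<lambda>z. \<phi> (fst z) (snd z))" by (rule \<phi>_smooth)
      show "\<phi> 0 0 = 0" by (simp add: \<phi>_def zz h0 fb0)
      have "jacobian (\<lambda>\<eta>. \<phi> \<eta> 0) (at 0) $ i $ j = mat 1 $ i $ j" for i j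
        using jac12[OF V0, of j] exhaust_3[of i]
        by (auto simp: zz h0 dual_ei_0 fb0 mat_def axis_def)
      then show "jacobian (\<lambda>\<eta>. \<phi> \<eta> 0) (at 0) = mat 1" by (simp add: vec_eq_iff)
      show "det (jacobian (\<lambda>\<eta>'. \<phi> \<eta>' l) (at \<eta>)) = 1" if V: "(\<eta>, l) \<in> V" for \<eta> l
      proof -
        let ?x = "h (\<eta>, l)"
        have x: "?x \<in> S" using hU(1)[OF V] UV(2) by auto
        show ?thesis
        proof (rule det_dual[OF SJ(2)[OF x] SJ(1)[OF x] _ refl refl refl])
          fix i
          show "jacobian (\<lambda>\<eta>'. \<phi> \<eta>' l) (at \<eta>) $ i = vector [
             mk3 (inverse (?J ?x) * grad_cross v w ?x $ 1) (inverse (?J ?x) * grad_cross v w ?x $ 2) (inverse (?J ?x) * jac3 v w A3 ?x) $ i,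
             mk3 (inverse (?J ?x) * grad_cross w u ?x $ 1) (inverse (?J ?x) * grad_cross w u ?x $ 2) (inverse (?J ?x) * jac3 w u A3 ?x) $ i,
             mk3 (inverse (?J ?x) * grad_cross u v ?x $ 1) (inverse (?J ?x) * grad_cross u v ?x $ 2) (inverse (?J ?x) * jac3 u v A3 ?x) $ i]"
            using exhaust_3[of i] jac12[OF V]
            by (auto simp: vec_eq_iff forall_3 dual_ei[OF Sd(1-3)[OF x]] pd_grad_cross[OF Sd(4)[OF x]])
        qed
      qed
      have cont: "continuous_on UNIV (\<lambda>l. (0 :: real^3, l))" "continuous_on UNIV (\<lambda>(l, x, y). (mk3 x y 0, l))"
        unfolding split_beta mk3_def by (intro continuous_intros)+
      have oW: "open W"
        unfolding W_def by (rule open_vimage[OF UV(4) cont(1)])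
      have oP: "open P"
        unfolding P_def
        by (intro open_Int open_vimage[OF UV(4) cont(2)] open_vimage[OF oW] continuous_on_fst continuous_on_id)
      have W_smooth: "smooth_on W (\<lambda>l. q (0, l))" if "smooth_on V q" for q :: "'m space \<Rightarrow> real"
      proof (rule smooth_on_compose[OF that oW])
        show "smooth_on W (\<lambda>l. (0, l) \<bullet> j)" for j :: "'m space"
          unfolding inner_Pair_alt
          by (intro smooth_on_add smooth_on_inner_linear oW bounded_linear_zero bounded_linear_ident)
      qed (simp add: W_def)
      show "0 \<in> W" using V0 by (simp add: W_def)
      show "smooth_on W \<epsilon>" unfolding \<epsilon>_def[abs_def] by (rule W_smooth[OF sa])
      show "smooth_on W \<mu>1" unfolding \<mu>1_def[abs_def] by (rule W_smooth[OF smooth_on_pd(2)[OF sa]])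
      show "smooth_on W \<mu>2" unfolding \<mu>2_def[abs_def] by (rule W_smooth[OF smooth_on_pd(2)[OF sa]])
      show "\<epsilon> 0 = 0" by (simp add: \<epsilon>_def a_def zz h0 \<Theta>(2))
      \<comment> \<open>In the state directions the inverse of \<open>\<Psi>\<close> is tangent to
        the identity at the origin, so the first derivatives of \<open>\<Theta>\<close> there carry
        over to \<open>a\<close>.\<close>
      have "pd (ei i) a 0 = pd (ei i) \<Theta> 0" for i
        using pdcomp[OF smU(5) UV(5) ei_Basis[of i]] by (simp add: a_def[abs_def] h0 dual_ei_0)
      then show "\<mu>1 0 = 0" "\<mu>2 0 = 0" by (simp_all add: \<mu>1_def \<mu>2_def zz \<Theta>)
      show "(0, 0, 0) \<in> P" using V0 by (simp add: P_def W_def)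
      have P_smooth: "smooth_on P (\<lambda>z. q (f z))"
        if "smooth_on V q" "bounded_linear f" "\<And>z. z \<in> P \<Longrightarrow> f z \<in> V" for q :: "'m space \<Rightarrow> real" and f :: "_ \<Rightarrow> 'm space"
        by (rule smooth_on_compose[OF that(1) oP smooth_on_inner_linear[OF oP that(2)] that(3)])
      have bl: "bounded_linear (\<lambda>z::(real^'m) \<times> real \<times> real. fst (snd z))" "bounded_linear (\<lambda>z::(real^'m) \<times> real \<times> real. snd (snd z))"
        by (intro bounded_linear_compose[OF bounded_linear_fst bounded_linear_snd]
            bounded_linear_compose[OF bounded_linear_snd bounded_linear_snd])+
      have P1: "smooth_on P (\<lambda>z. q (mk3 (fst (snd z)) (snd (snd z)) 0, fst z))" if "smooth_on V q" for q :: "'m space \<Rightarrow> real"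
        by (rule P_smooth[OF that])
           (auto simp: P_def split_beta intro!: bounded_linear_Pair bounded_linear_mk3 bl bounded_linear_fst bounded_linear_zero)
      have P2: "smooth_on P (\<lambda>z. q (0, fst z))" if "smooth_on V q" for q :: "'m space \<Rightarrow> real"
        by (rule P_smooth[OF that])
           (auto simp: P_def W_def intro!: bounded_linear_Pair bounded_linear_fst bounded_linear_zero)
      have "smooth_on P (\<lambda>z. a (mk3 (fst (snd z)) (snd (snd z)) 0, fst z) - a (0, fst z) -
          pd (ei 1) a (0, fst z) * fst (snd z) - pd (ei 2) a (0, fst z) * snd (snd z))"
        by (intro smooth_on_diff smooth_on_mult P1 P2 smooth_on_pd(2) sa smooth_on_linear[OF oP] bl)
      then show "smooth_on P (\<lambda>(l, x, y). p l x y)"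
        by (rule smooth_on_cong) (simp add: split_beta p_def \<epsilon>_def \<mu>1_def \<mu>2_def)
      fix l assume l: "(l, 0, 0) \<in> P"
      then have lV: "(0, l) \<in> V" by (simp add: P_def W_def)
      have ad: "a differentiable (at (0, l))" by (rule smooth_on_differentiable[OF sa lV])
      show "p l 0 0 = 0" by (simp add: p_def \<epsilon>_def)
      have f: "((\<lambda>q. (mk3 (fst q) (snd q) 0, l)) has_derivative (\<lambda>k. (mk3 (fst k) (snd k) 0, 0))) (at (0, 0))"
        unfolding mk3_def by (auto intro!: derivative_eq_intros)
      have "((\<lambda>q. a (mk3 (fst q) (snd q) 0, l)) has_derivative (\<lambda>k. pd (mk3 (fst k) (snd k) 0, 0) a (0, l))) (at (0, 0))"
        using has_derivative_compose[OF f, of a "\<lambda>h. pd h a (0, l)"] has_derivative_pd[OF ad] by simp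
      then have "((\<lambda>q. a (mk3 (fst q) (snd q) 0, l) - \<epsilon> l - \<mu>1 l * fst q - \<mu>2 l * snd q) has_derivative
         (\<lambda>k. pd (mk3 (fst k) (snd k) 0, 0) a (0, l) - 0 - \<mu>1 l * fst k - \<mu>2 l * snd k)) (at (0, 0))"
        by (intro has_derivative_diff has_derivative_const has_derivative_mult_right has_derivative_fst has_derivative_snd has_derivative_ident)
      moreover have "pd (mk3 (fst k) (snd k) 0, 0) a (0, l) - 0 - \<mu>1 l * fst k - \<mu>2 l * snd k = 0" for k
        unfolding pd_fst[OF ad] by (simp add: \<mu>1_def \<mu>2_def)
      ultimately show "((\<lambda>(x, y). p l x y) has_derivative (\<lambda>_. 0)) (at (0, 0))"
        by (simp add: case_prod_unfold p_def)
    qed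
    moreover have "(\<lambda>y. \<Psi> (h y)) \<doteq> (\<lambda>y. y)"
      by (rule eventually_mono[OF eventually_nhds_in_open[OF UV(4,5)] hU(2)])
    moreover have "(\<lambda>x. h (\<Psi> x)) \<doteq> (\<lambda>x. x)"
      by (rule eventually_mono[OF eventually_nhds_in_open[OF UV(1,3)] h\<Psi>])
    moreover have "\<epsilon> l + \<mu>1 l * x + \<mu>2 l * y + p l x y = a (mk3 x y 0, l)" for l x y
      by (simp add: p_def)
    \<comment> \<open>By Cramer's rule the derivative of \<open>a\<close> in the third direction is
      \<open>jac3 u v \<Theta> / J\<close> evaluated at \<open>h y\<close>, and the numerator is
      flat by assumption.\<close>
    moreover have "flat (Suc K) (\<lambda>y. a y - a (mk3 (fst y $ 1) (fst y $ 2) 0, snd y))"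
    proof -
      have "flat (Suc K) (\<lambda>z. inverse (?J z) * jac3 u v \<Theta> z)" by (rule flat_mult_left[OF iJ J\<Theta>])
      from flat_compose[OF this gh h0]
      have "flat (Suc K) (\<lambda>y. inverse (?J (h y)) * jac3 u v \<Theta> (h y))" .
      moreover have "(\<lambda>y. inverse (?J (h y)) * jac3 u v \<Theta> (h y)) \<doteq> pd (ei 3) a"
      proof (rule eventually_mono[OF eventually_nhds_in_open[OF UV(4,5)]])
        fix y assume y: "y \<in> V"
        have x: "h y \<in> S" using hU(1)[OF y] UV(2) by auto
        show "inverse (?J (h y)) * jac3 u v \<Theta> (h y) = pd (ei 3) a y"
          using pdcomp[OF smU(5) y ei_Basis[of 3]]
          by (simp add: a_def[abs_def] dual_ei[OF Sd(1-3)[OF x]]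
              pd_grad_cross[OF smooth_on_differentiable[OF sm(5) x]])
      qed
      ultimately have "flat (Suc K) (pd (ei 3) a)" by (rule flat_cong)
      from flat_minus_projection[OF ei_Basis ga this] show ?thesis
        unfolding proj by (rule flat_SucD)
    qed
    moreover have "\<phi> \<eta> l = mk3 (fst (h (\<eta>, l)) $ 1) (fst (h (\<eta>, l)) $ 2) (A3 (h (\<eta>, l)))" for \<eta> l
      by (rule \<phi>_def)
    moreover have "a y = \<Theta> (h y)" for y by (rule a_def)
    ultimately show ?thesis
      unfolding straightened_def using gh h0 A3(1) flat_SucD[OF fb] ga
      by (intro exI[of _ V] exI[of _ \<phi>] exI[of _ W] exI[of _ \<epsilon>] exI[of _ \<mu>1] exI[of _ \<mu>2] exI[of _ P]
          exI[of _ p] exI[of _ a] exI[of _ h] exI[of _ A3] conjI ballI allI)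
  qed
qed

end

text \<open>What the two cases share once a shift operator is given. The premise \<open>det\<close>
  is conservation of volume, in the form in which fields and maps agree; together with
  \<open>D 1 = 0\<close> it turns flatness of \<open>J - 1\<close> into flatness of
  \<open>jac3 u v (D w)\<close>.\<close>

lemma straightened_coordinates:
  fixes D :: "('m::finite space \<Rightarrow> real) \<Rightarrow> 'm space \<Rightarrow> real"
  assumes so: "shift_operator D s M (ei 1) (ei 2) (ei 3)"
    and D1: "D (\<lambda>_. 1) \<doteq> (\<lambda>_. 0)"
    and det: "\<And>u v w. germ u \<Longrightarrow> germ v \<Longrightarrow> germ w \<Longrightarrow> D u \<doteq> v \<Longrightarrow> D v \<doteq> (\<lambda>z. w z + s * D w z) \<Longrightarrow>
      jac3 u v (D w) \<doteq> D (jac3 u v w)"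
  shows "\<exists>u v w. coordinates u v w \<and> D u \<doteq> v \<and> D v \<doteq> (\<lambda>z. w z + s * D w z) \<and>
    (\<exists>V \<phi> W \<epsilon> \<mu>1 \<mu>2 P p a h A3. coordinates.straightened u v w K (D w) V \<phi> W \<epsilon> \<mu>1 \<mu>2 P p a h A3)"
proof -
  interpret shift_operator D s M "ei 1" "ei 2" "ei 3" by (rule so)
  have jac_eq: "jac = jac3"
    by (intro ext) (simp add: jac_def jac3_def)
  have "\<exists>X. germ X \<and> X 0 = 0 \<and> unit_gradients (S X) (D (S X)) (D (D X)) \<and>
    flat (Suc K) (\<lambda>z. jac (S X) (D (S X)) (D (D X)) z - 1)"
    by (rule approximate_volume_exists) simp_all
  then obtain X where X: "germ X" "X 0 = 0" "unit_gradients (S X) (D (S X)) (D (D X))"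
    "flat (Suc K) (\<lambda>z. jac (S X) (D (S X)) (D (D X)) z - 1)"
    by blast
  let ?u = "S X" and ?v = "D (S X)" and ?w = "D (D X)"
  have g: "germ ?u" "germ ?v" "germ ?w" by (intro S_germ D_germ X)+
  have z: "?u 0 = 0" "?v 0 = 0" "?w 0 = 0"
    using X D_zero[OF X(1)] D_zero[OF g(1)] D_zero[OF D_germ[OF X(1)]] by (simp_all add: S_def)
  interpret c: coordinates ?u ?v ?w
    by unfold_locales (use g z X(3) in \<open>simp_all add: unit_gradients_def\<close>)
  have Dv: "D ?v \<doteq> (\<lambda>z. ?w z + s * D ?w z)"
    using germ_eq_trans[OF D_cong[OF D_S[OF X(1)]] D_S[OF D_germ[OF X(1)]]] unfolding S_def[of "D (D X)"] .
  let ?J = "jac3 ?u ?v ?w"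
  have gJ: "germ ?J" by (rule jac3_germ[OF g])
  have fJ: "flat (Suc K) (\<lambda>z. ?J z - 1)" using X(4) by (simp only: jac_eq)
  have "flat (Suc K) (D (\<lambda>z. ?J z - 1))" by (rule D_flat[OF fJ])
  moreover have "D (\<lambda>z. ?J z - 1) \<doteq> D ?J"
    using D_diff[OF gJ germ_const, of 1] D1 by (rule eventually_elim2) simp
  moreover have "D ?J \<doteq> jac3 ?u ?v (D ?w)"
    by (rule germ_eq_sym[OF det[OF g _ Dv]]) simp
  ultimately have fT: "flat (Suc K) (jac3 ?u ?v (D ?w))"
    using flat_cong by blast
  \<comment> \<open>This makes \<open>\<mu>1\<close> and \<open>\<mu>2\<close> vanish at parameter
    0: at the origin the derivative of \<open>D w\<close> along \<open>d\<close> is that of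
    \<open>w\<close> along \<open>M d\<close>, and \<open>M\<close> sends \<open>ei 1\<close> to 0
    and \<open>ei 2\<close> to \<open>ei 1\<close>.\<close>
  have w0: "pd (M d) ?w 0 = 0" if "M d = 0 \<or> M d = ei 1" for d
  proof -
    have "?w differentiable (at 0)" by (rule eventually_nhds_x_imp_x[OF germ_differentiable[OF g(3)]])
    then show ?thesis using that c.unit(7) by auto
  qed
  have "\<exists>V \<phi> W \<epsilon> \<mu>1 \<mu>2 P p a h A3. c.straightened K (D ?w) V \<phi> W \<epsilon> \<mu>1 \<mu>2 P p a h A3"
  proof (rule c.straightening)
    show "germ (D ?w)" by (rule D_germ[OF g(3)])
    show "D ?w 0 = 0" by (rule D_zero[OF g(3)])
    show "pd (ei 1) (D ?w) 0 = 0" "pd (ei 2) (D ?w) 0 = 0"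
      unfolding pd_D_0[OF g(3) z(3)] by (intro w0, simp add: M_ex M_ey)+
  qed (rule fJ, rule fT)
  then show ?thesis using c.coordinates_axioms Dv germ_eq_refl by blast
qed

text \<open>Origin of the exponent 4: one application of \<open>M\<close> removes the parameter
  component, and on states \<open>M\<close> is \<open>N3\<close>, whose third power is zero.\<close>

lemma nilpotent_linear_part:
  fixes M :: "'m::finite space \<Rightarrow> 'm space"
  assumes M: "\<And>w. M (w, 0) = (mk3 (w $ 2) (w $ 3) 0, 0)" and sM: "\<And>d. snd (M d) = 0"
  shows "M (ei 1) = 0" "M (ei 2) = ei 1" "M (ei 3) = ei 2" "(M ^^ 4) d = 0"
proof -
  show "M (ei 1) = 0" "M (ei 2) = ei 1" "M (ei 3) = ei 2"
    by (simp_all add: ei_def M, simp_all add: vec_eq_iff forall_3 axis_def zero_prod_def)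
  have "M d = (fst (M d), 0)" using sM[of d] by (simp add: prod_eq_iff)
  then obtain w where w: "M d = (w, 0)" by blast
  have "(M ^^ 4) d = M (M (M (M d)))" by (simp add: numeral_eq_Suc)
  also have "\<dots> = 0" by (simp add: w M zero_prod_def)
  finally show "(M ^^ 4) d = 0" .
qed

section \<open>Coordinate formulas for the normal forms\<close>

lemma mat_vector_3:
  fixes B :: "real^3^3"
  shows "(B *v w) $ i = B $ i $ 1 * w $ 1 + B $ i $ 2 * w $ 2 + B $ i $ 3 * w $ 3"
  by (simp add: matrix_vector_mult_def sum_3)

lemma N3_nth: "N3 $ 1 $ 1 = 0" "N3 $ 1 $ 2 = 1" "N3 $ 1 $ 3 = 0" "N3 $ 2 $ 1 = 0" "N3 $ 2 $ 2 = 0" "N3 $ 2 $ 3 = 1"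
  "N3 $ 3 $ 1 = 0" "N3 $ 3 $ 2 = 0" "N3 $ 3 $ 3 = 0"
  by (simp_all add: N3_def)

lemma e3_nth: "e3 $ 1 = 0" "e3 $ 2 = 0" "e3 $ 3 = 1"
  by (simp_all add: e3_def)

lemma N3_mult: "N3 *v w = mk3 (w $ 2) (w $ 3) 0"
  by (simp add: vec_eq_iff forall_3 mat_vector_3 N3_nth)

lemma N3_normal_form: "N3 *v w + c *\<^sub>R e3 = mk3 (w $ 2) (w $ 3) c"
  by (simp add: vec_eq_iff forall_3 N3_mult e3_nth)

lemma J3_normal_form: "(mat 1 + N3) *v (w + c *\<^sub>R e3) = mk3 (w $ 1 + w $ 2) (w $ 2 + (w $ 3 + c)) (w $ 3 + c)"
  by (simp add: vec_eq_iff forall_3 matrix_vector_mult_add_rdistrib N3_mult e3_nth)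

text \<open>The error term of the theorem agrees with the estimated one only near the origin, so
  \<open>\<delta>\<close> is also shrunk to the region of agreement. The constant is the sum of the
  componentwise ones.\<close>

lemma flat_vector_bound:
  fixes e e' :: "'m::finite space \<Rightarrow> real^3"
  assumes "\<And>i. flat k (\<lambda>y. e y $ i)" "e' \<doteq> e"
  shows "\<exists>C \<delta>. \<delta> > 0 \<and> (\<forall>\<eta> l. norm (\<eta>, l) < \<delta> \<longrightarrow> norm (e' (\<eta>, l)) \<le> C * norm (\<eta>, l) ^ k)"
proof -
  have "\<forall>i\<in>UNIV. \<exists>C. eventually (\<lambda>y. \<bar>e y $ i\<bar> \<le> C * norm y ^ k) (nhds 0)"
    using flat_bound[OF assms(1)] by blast
  then obtain C where "\<forall>i\<in>UNIV. eventually (\<lambda>y. \<bar>e y $ i\<bar> \<le> C i * norm y ^ k) (nhds 0)"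
    by (rule bchoice[THEN exE])
  then have "eventually (\<lambda>y. (\<forall>i\<in>UNIV. \<bar>e y $ i\<bar> \<le> C i * norm y ^ k) \<and> e' y = e y) (nhds 0)"
    using assms(2) by (intro eventually_conj eventually_ball_finite) auto
  then obtain \<delta> where \<delta>: "\<delta> > 0" "\<And>y i. dist y 0 < \<delta> \<Longrightarrow> \<bar>e y $ i\<bar> \<le> C i * norm y ^ k"
    "\<And>y. dist y 0 < \<delta> \<Longrightarrow> e' y = e y"
    unfolding eventually_nhds_metric by blast
  have "norm (e' y) \<le> (\<Sum>i\<in>UNIV. C i) * norm y ^ k" if "norm y < \<delta>" for y
  proof -
    have "norm (e' y) \<le> (\<Sum>i\<in>UNIV. \<bar>e y $ i\<bar>)" using \<delta>(3)[of y] that norm_le_l1_cart[of "e y"] by simp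
    also have "\<dots> \<le> (\<Sum>i\<in>UNIV. C i * norm y ^ k)" using \<delta>(2)[of y] that by (intro sum_mono) simp
    finally show ?thesis by (simp add: sum_distrib_right)
  qed
  then show ?thesis using \<delta>(1) by blast
qed

lemma germ_vector_nth:
  fixes f :: "'a::euclidean_space \<Rightarrow> real^3"
  assumes "germ (\<lambda>z. f z $ 1)" "germ (\<lambda>z. f z $ 2)" "germ (\<lambda>z. f z $ 3)"
  shows "germ (\<lambda>z. f z \<bullet> j)"
  unfolding inner_vec_def using assms by (auto simp: sum_3 intro!: germ_add germ_mult germ_const)

lemma germ_Pair_snd:
  fixes f :: "'m::finite space \<Rightarrow> real^3"
  assumes "\<And>i. germ (\<lambda>z. f z $ i)"
  shows "germ (\<lambda>z. (f z, snd z) \<bullet> j)" "germ (\<lambda>z. (f z, 0 :: real^'m) \<bullet> j)"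
  unfolding inner_Pair_alt
  by (rule germ_add[OF germ_vector_nth[OF assms assms assms] germ_linear
      [OF bounded_linear_compose[OF bounded_linear_inner_left bounded_linear_snd]]],
      rule germ_add[OF germ_vector_nth[OF assms assms assms] germ_const])

lemma eventually_differentiable_components:
  fixes f :: "'m::finite space \<Rightarrow> real^3"
  assumes "\<And>i. germ (\<lambda>z. f z $ i)"
  shows "eventually (\<lambda>z. f differentiable (at z)) (nhds 0)"
  by (rule germ_vector_differentiable) (intro germ_vector_nth assms)

lemma flat_Pair_diff:
  fixes f g :: "'m::finite space \<Rightarrow> real^3"
  assumes "\<And>i. flat k (\<lambda>z. f z $ i - g z $ i)"
  shows "flat k (\<lambda>z. (f z, snd z) \<bullet> j - (g z, snd z) \<bullet> j)"
proof -
  have "flat k (\<lambda>z. fst j $ 1 * (f z $ 1 - g z $ 1) + fst j $ 2 * (f z $ 2 - g z $ 2) + fst j $ 3 * (f z $ 3 - g z $ 3))"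
    by (intro flat_add flat_cmult assms)
  then show ?thesis
    by (rule flat_cong) (simp add: inner_Pair_alt inner_vec_def sum_3 algebra_simps)
qed

lemma frechet_derivative_nth:
  fixes f :: "'a::euclidean_space \<Rightarrow> real^3"
  assumes "f differentiable (at z)"
  shows "frechet_derivative f (at z) d $ i = pd d (\<lambda>z. f z $ i) z"
  by (rule pd_eq[OF bounded_linear.has_derivative[OF bounded_linear_vec_nth
        assms[unfolded frechet_derivative_works]], symmetric])

section \<open>Comparison with the straightening coordinates\<close>

context coordinates
begin

context
  fixes K \<Theta> V \<phi> W \<epsilon> \<mu>1 \<mu>2 P p a h A3
  assumes st: "straightened K \<Theta> V \<phi> W \<epsilon> \<mu>1 \<mu>2 P p a h A3"
begin

lemma straightenedD:
  shows st_normalizing: "normalizing V \<phi> W \<epsilon> \<mu>1 \<mu>2 P p"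
    and st_h: "\<And>j. j \<in> Basis \<Longrightarrow> germ (\<lambda>y. h y \<bullet> j)" "h 0 = 0"
    and st_inv: "(\<lambda>y. \<Psi> (h y)) \<doteq> (\<lambda>y. y)" "(\<lambda>x. h (\<Psi> x)) \<doteq> (\<lambda>x. x)"
    and st_A3: "germ A3" "flat (Suc K) (\<lambda>z. A3 z - fst z $ 3)"
    and st_\<phi>: "\<And>\<eta> l. \<phi> \<eta> l = mk3 (fst (h (\<eta>, l)) $ 1) (fst (h (\<eta>, l)) $ 2) (A3 (h (\<eta>, l)))"
    and st_a: "germ a" "\<And>y. a y = \<Theta> (h y)"
    and st_p: "\<And>l x y. \<epsilon> l + \<mu>1 l * x + \<mu>2 l * y + p l x y = a (mk3 x y 0, l)"
    and st_flat: "flat (Suc K) (\<lambda>y. a y - a (mk3 (fst y $ 1) (fst y $ 2) 0, snd y))"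
  using st unfolding straightened_def by blast+

text \<open>Together with the parameters this is the factor \<open>A\<close> of \<open>\<phi> = A \<circ> h\<close>.\<close>
definition shear where "shear z = mk3 (fst z $ 1) (fst z $ 2) (A3 z)"

lemma \<phi>_shear: "\<phi> (fst y) (snd y) = shear (h y)"
  by (simp add: shear_def st_\<phi>)

lemma germ_shear: "germ (\<lambda>z. shear z $ i)"
  using exhaust_3[of i] st_A3(1) by (auto simp: shear_def germ_fst_nth)

lemma flat_shear: "flat (Suc K) (\<lambda>z. shear z $ i - fst z $ i)"
  using exhaust_3[of i] st_A3(2) by (auto simp: shear_def simp del: flat.simps(2))

lemma shear_0: "(shear 0, snd (0 :: 'm space)) = 0"
proof -
  have "A3 0 = 0" using st_A3(2) by simp
  then show ?thesis by (simp add: shear_def zero_prod_def)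
qed

lemma germ_\<phi>: "germ (\<lambda>y. \<phi> (fst y) (snd y) $ i)"
  unfolding \<phi>_shear by (rule germ_compose[OF germ_shear st_h])

lemma \<phi>_\<Psi>: "(\<lambda>x. \<phi> (fst (\<Psi> x)) (snd (\<Psi> x))) \<doteq> shear"
  using st_inv(2) by (rule eventually_mono) (simp add: \<phi>_shear)

text \<open>The correction is the identity up to order \<open>Suc K\<close>, hence invisible to that
  order inside any smooth function.\<close>

lemma flat_compose_shear:
  assumes "germ q"
  shows "flat (Suc K) (\<lambda>z. q (shear z, snd z) - q z)"
proof -
  have "flat (Suc K) (\<lambda>z. q (shear z, snd z) - q (fst z, snd z))"
    using shear_0
    by (intro flat_compose_diff[OF _ _ _ _ flat_Pair_diff[OF flat_shear] assms]
        germ_Pair_snd germ_shear germ_fst_nth) (simp_all add: zero_prod_def)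
  then show ?thesis by simp
qed

text \<open>Errors can be estimated in the original coordinates \<open>x\<close>, with
  \<open>y = \<Psi> x\<close>, where the components of \<open>\<Psi>\<close> satisfy explicit
  relations.\<close>

lemma flat_pull_back:
  assumes "flat k (\<lambda>x. e (\<Psi> x))"
  shows "flat k e"
proof -
  have "flat k (\<lambda>y. e (\<Psi> (h y)))" by (rule flat_compose[OF assms st_h])
  then show ?thesis by (rule flat_cong) (use st_inv(1) in \<open>auto elim: eventually_mono\<close>)
qed

end

end

subsection \<open>Volume and the last component\<close>

text \<open>One entry of the transposed Jacobian matrix of \<open>f\<close> at \<open>z\<close>
  applied to the gradient of \<open>q\<close> at \<open>z'\<close>. For a field the two points
  coincide; for a map \<open>z'\<close> is the image of \<open>z\<close>.\<close>

definition chain :: "('m::finite space \<Rightarrow> real^3) \<Rightarrow> 3 \<Rightarrow> 'm space \<Rightarrow>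
    ('m space \<Rightarrow> real) \<Rightarrow> 'm space \<Rightarrow> real" where
  "chain f i z q z' = pd (ei i) (\<lambda>z. f z $ 1) z * pd (ei 1) q z' +
     pd (ei i) (\<lambda>z. f z $ 2) z * pd (ei 2) q z' + pd (ei i) (\<lambda>z. f z $ 3) z * pd (ei 3) q z'"

lemma pd_vector_field:
  fixes f :: "'m::finite space \<Rightarrow> real^3"
  assumes "f differentiable (at z)" "q differentiable (at z)"
  shows "(\<Sum>j\<in>Basis. pd (ei i) (\<lambda>z. (f z, 0) \<bullet> j) z * pd j q z) = chain f i z q z"
proof -
  let ?f' = "frechet_derivative f (at z) (ei i)"
  have "((\<lambda>z. (f z, 0) \<bullet> j) has_derivative (\<lambda>d. (frechet_derivative f (at z) d, 0) \<bullet> j)) (at z)" for j :: "'m space"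
    using assms(1) unfolding frechet_derivative_works by (auto intro!: derivative_eq_intros)
  then have "pd (ei i) (\<lambda>z. (f z, 0) \<bullet> j) z = (?f', 0) \<bullet> j" for j :: "'m space"
    by (rule pd_eq)
  then have "(\<Sum>j\<in>Basis. pd (ei i) (\<lambda>z. (f z, 0) \<bullet> j) z * pd j q z) = pd (?f', 0) q z"
    using pd_basis_sum[OF assms(2), of "(?f', 0)"] by simp
  then show ?thesis
    unfolding chain_def pd_fst[OF assms(2)] frechet_derivative_nth[OF assms(1)] .
qed

text \<open>Leibniz rule for the determinant, with one block for each differentiated row.\<close>

lemma pd_jac3:
  assumes "\<And>i. pd (ei i) u differentiable (at z)" "\<And>i. pd (ei i) v differentiable (at z)"
    "\<And>i. pd (ei i) w differentiable (at z)"
  shows "pd d (jac3 u v w) z =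
    pd d (pd (ei 1) u) z * (pd (ei 2) v z * pd (ei 3) w z - pd (ei 3) v z * pd (ei 2) w z)
     - pd d (pd (ei 2) u) z * (pd (ei 1) v z * pd (ei 3) w z - pd (ei 3) v z * pd (ei 1) w z)
     + pd d (pd (ei 3) u) z * (pd (ei 1) v z * pd (ei 2) w z - pd (ei 2) v z * pd (ei 1) w z)
   + (pd (ei 1) u z * (pd d (pd (ei 2) v) z * pd (ei 3) w z - pd d (pd (ei 3) v) z * pd (ei 2) w z)
     - pd (ei 2) u z * (pd d (pd (ei 1) v) z * pd (ei 3) w z - pd d (pd (ei 3) v) z * pd (ei 1) w z)
     + pd (ei 3) u z * (pd d (pd (ei 1) v) z * pd (ei 2) w z - pd d (pd (ei 2) v) z * pd (ei 1) w z))
   + (pd (ei 1) u z * (pd (ei 2) v z * pd d (pd (ei 3) w) z - pd (ei 3) v z * pd d (pd (ei 2) w) z)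
     - pd (ei 2) u z * (pd (ei 1) v z * pd d (pd (ei 3) w) z - pd (ei 3) v z * pd d (pd (ei 1) w) z)
     + pd (ei 3) u z * (pd (ei 1) v z * pd d (pd (ei 2) w) z - pd (ei 2) v z * pd d (pd (ei 1) w) z))"
  unfolding jac3_def[abs_def]
  by (simp add: pd_add_at pd_diff_at pd_mult_at assms differentiable_mult differentiable_diff differentiable_add,
      simp add: algebra_simps)

text \<open>With \<open>A\<close> the transposed Jacobian matrix of the field, \<open>\<nabla>(Lq) = L(\<nabla>q) + A \<nabla>q\<close>; differentiating the
  determinant row by row leaves only the last row and the trace of \<open>A\<close>.\<close>
lemma jac3_lie:
  fixes f :: "'m::finite space \<Rightarrow> real^3"
  assumes f: "\<And>i. germ (\<lambda>z. f z $ i)"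
    and div: "(\<lambda>z. pd (ei 1) (\<lambda>z. f z $ 1) z + pd (ei 2) (\<lambda>z. f z $ 2) z + pd (ei 3) (\<lambda>z. f z $ 3) z) \<doteq> (\<lambda>_. 0)"
    and g: "germ u" "germ v" "germ w"
    and uv: "(\<lambda>z. pd (f z, 0) u z) \<doteq> v" and vw: "(\<lambda>z. pd (f z, 0) v z) \<doteq> w"
  shows "jac3 u v (\<lambda>z. pd (f z, 0) w z) \<doteq> (\<lambda>z. pd (f z, 0) (jac3 u v w) z)"
proof -
  let ?w' = "\<lambda>z. pd (f z, 0) w z"
  have lie: "\<forall>\<^sub>F z in nhds 0. \<forall>i. pd (ei i) q' z = pd (f z, 0) (pd (ei i) q) z + chain f i z q z"
    if q: "germ q" and q': "(\<lambda>z. pd (f z, 0) q z) \<doteq> q'" for q q'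
  proof -
    have "\<forall>\<^sub>F z in nhds 0. (\<forall>i\<in>UNIV. pd (ei i) (\<lambda>z. pd (f z, 0) q z) z = pd (ei i) q' z) \<and>
       (\<forall>i\<in>UNIV. pd (ei i) (\<lambda>z. pd (f z, 0) q z) z = pd (f z, 0) (pd (ei i) q) z +
          (\<Sum>j\<in>Basis. pd (ei i) (\<lambda>z. (f z, 0) \<bullet> j) z * pd j q z)) \<and>
       f differentiable (at z) \<and> q differentiable (at z)"
      by (intro eventually_conj eventually_ball_finite finite ballI pd_cong[OF q'] pd_lie[OF germ_Pair_snd(2)[OF f] q]
           eventually_differentiable_components f germ_differentiable q)
    then show ?thesis
    proof (rule eventually_mono, elim conjE, intro allI)
      fix z i
      assume 1: "\<forall>i\<in>UNIV. pd (ei i) (\<lambda>z. pd (f z, 0) q z) z = pd (ei i) q' z"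
        and 2: "\<forall>i\<in>UNIV. pd (ei i) (\<lambda>z. pd (f z, 0) q z) z = pd (f z, 0) (pd (ei i) q) z +
          (\<Sum>j\<in>Basis. pd (ei i) (\<lambda>z. (f z, 0) \<bullet> j) z * pd j q z)"
        and d: "f differentiable (at z)" "q differentiable (at z)"
      show "pd (ei i) q' z = pd (f z, 0) (pd (ei i) q) z + chain f i z q z"
        using 1[rule_format, OF UNIV_I, of i] 2[rule_format, OF UNIV_I, of i] unfolding pd_vector_field[OF d] by linarith
    qed
  qed
  have d0: "\<forall>\<^sub>F z in nhds 0. ((\<forall>i\<in>UNIV. pd (ei i) u differentiable (at z)) \<and> (\<forall>i\<in>UNIV. pd (ei i) v differentiable (at z)) \<and>
     (\<forall>i\<in>UNIV. pd (ei i) w differentiable (at z)))"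
    by (intro eventually_conj eventually_ball_finite finite ballI germ_differentiable germ_pd g)
  show ?thesis
  proof (rule eventually_mono[OF eventually_conj[OF d0 eventually_conj[OF lie[OF g(1) uv] eventually_conj[OF lie[OF g(2) vw]
        eventually_conj[OF lie[OF g(3) germ_eq_refl] div]]]]], elim conjE)
    fix z
    assume d: "\<forall>i\<in>UNIV. pd (ei i) u differentiable (at z)" "\<forall>i\<in>UNIV. pd (ei i) v differentiable (at z)"
      "\<forall>i\<in>UNIV. pd (ei i) w differentiable (at z)"
    let ?a = "\<lambda>i k. pd (ei i) (\<lambda>z. f z $ k) z"
    assume v: "\<forall>i. pd (ei i) v z = pd (f z, 0) (pd (ei i) u) z + chain f i z u z"
      and w: "\<forall>i. pd (ei i) w z = pd (f z, 0) (pd (ei i) v) z + chain f i z v z"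
      and w': "\<forall>i. pd (ei i) ?w' z = pd (f z, 0) (pd (ei i) w) z + chain f i z w z"
      and div: "?a 1 1 + ?a 2 2 + ?a 3 3 = 0"
    have l: "pd (f z, 0) (pd (ei i) u) z = pd (ei i) v z - chain f i z u z"
      "pd (f z, 0) (pd (ei i) v) z = pd (ei i) w z - chain f i z v z"
      "pd (f z, 0) (pd (ei i) w) z = pd (ei i) ?w' z - chain f i z w z" for i
      using v[rule_format, of i] w[rule_format, of i] w'[rule_format, of i] by linarith+
    \<comment> \<open>Zero trace enters by eliminating one diagonal entry, after which the
      determinant identity is polynomial.\<close>
    have a33: "?a 3 3 = - ?a 1 1 - ?a 2 2" using div by linarith
    have "pd (f z, 0) (jac3 u v w) z = jac3 u v ?w' z"
      using d by (subst pd_jac3) (auto simp: l chain_def jac3_def a33 algebra_simps)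
    then show "jac3 u v ?w' z = pd (f z, 0) (jac3 u v w) z" by simp
  qed
qed

text \<open>Since \<open>f\<close> has determinant 1, the determinant of the composed functions is
  \<open>J\<close> at the image point. These functions are \<open>u + v\<close>,
  \<open>v + w + D w\<close> and \<open>w + D w\<close>; subtracting rows leaves the determinant of
  \<open>u\<close>, \<open>v\<close>, \<open>w + D w\<close>, which is
  \<open>J + jac3 u v (D w)\<close>.\<close>

lemma jac3_compose:
  fixes f :: "'m::finite space \<Rightarrow> real^3"
  assumes f: "\<And>i. germ (\<lambda>z. f z $ i)" "f 0 = 0"
    and det: "eventually (\<lambda>z. det (\<chi> i j. pd (ei j) (\<lambda>z. f z $ i) z) = 1) (nhds 0)"
    and g: "germ u" "germ v" "germ w"
    and uv: "(\<lambda>z. u (f z, snd z) - u z) \<doteq> v"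
    and vw: "(\<lambda>z. v (f z, snd z) - v z) \<doteq> (\<lambda>z. w z + 1 * (w (f z, snd z) - w z))"
  shows "jac3 u v (\<lambda>z. w (f z, snd z) - w z) \<doteq> (\<lambda>z. jac3 u v w (f z, snd z) - jac3 u v w z)"
proof -
  let ?f = "\<lambda>z. (f z, snd z)" and ?w' = "\<lambda>z. w (f z, snd z) - w z"
  have fj: "germ (\<lambda>z. ?f z \<bullet> j)" for j by (rule germ_Pair_snd(1)[OF f(1)])
  have f0: "?f 0 = 0" using f(2) by (simp add: zero_prod_def)
  have gw': "germ ?w'" by (rule germ_diff[OF germ_compose[OF g(3) fj f0] g(3)])
  have ch: "\<forall>\<^sub>F z in nhds 0. \<forall>i\<in>UNIV. pd (ei i) (\<lambda>z. q (?f z)) z = chain f i z q (?f z)"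
    if q: "germ q" for q
  proof -
    have "\<forall>\<^sub>F z in nhds 0. q differentiable (at (?f z)) \<and> f differentiable (at z)"
      by (intro eventually_conj eventually_compose_germ[OF fj f0 germ_differentiable[OF q]]
           eventually_differentiable_components f)
    then show ?thesis
    proof (rule eventually_mono, elim conjE, intro ballI)
      fix z i assume d: "q differentiable (at (?f z))" "f differentiable (at z)"
      have "(?f has_derivative (\<lambda>d. (frechet_derivative f (at z) d, snd d))) (at z)"
        using d(2) unfolding frechet_derivative_works by (auto intro!: derivative_eq_intros)
      from pd_eq[OF has_derivative_compose[OF this has_derivative_pd[OF d(1)]], of "ei i"]
      show "pd (ei i) (\<lambda>z. q (?f z)) z = chain f i z q (?f z)"
        by (simp add: chain_def pd_fst[OF d(1)] frechet_derivative_nth[OF d(2)])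
    qed
  qed
  have sum2: "\<forall>\<^sub>F z in nhds 0. \<forall>i\<in>UNIV. pd (ei i) (\<lambda>z. q (?f z)) z = pd (ei i) a z + pd (ei i) b z"
    if "(\<lambda>z. q (?f z)) \<doteq> (\<lambda>z. a z + b z)" "germ a" "germ b" for q a b
    by (intro eventually_ball_finite finite ballI germ_eq_trans[OF pd_cong[OF that(1)] pd_add[OF that(2,3)]])
  have e1: "(\<lambda>z. u (?f z)) \<doteq> (\<lambda>z. u z + v z)" using uv by (rule eventually_mono) simp
  have e2: "(\<lambda>z. v (?f z)) \<doteq> (\<lambda>z. v z + (w z + ?w' z))" using vw by (rule eventually_mono) simp
  have e3: "(\<lambda>z. w (?f z)) \<doteq> (\<lambda>z. w z + ?w' z)" by simp
  have e4: "\<forall>\<^sub>F z in nhds 0. \<forall>i\<in>UNIV. pd (ei i) (\<lambda>z. w z + ?w' z) z = pd (ei i) w z + pd (ei i) ?w' z"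
    by (intro eventually_ball_finite finite ballI pd_add g gw')
  show ?thesis
  proof (rule eventually_mono[OF eventually_conj[OF sum2[OF e1 g(1,2)] eventually_conj[OF sum2[OF e2 g(2) germ_add[OF g(3) gw']]
        eventually_conj[OF sum2[OF e3 g(3) gw'] eventually_conj[OF e4 eventually_conj[OF ch[OF g(1)]
        eventually_conj[OF ch[OF g(2)] eventually_conj[OF ch[OF g(3)] det]]]]]]]], elim conjE)
    fix z
    assume u: "\<forall>i\<in>UNIV. pd (ei i) (\<lambda>z. u (?f z)) z = pd (ei i) u z + pd (ei i) v z"
      and v: "\<forall>i\<in>UNIV. pd (ei i) (\<lambda>z. v (?f z)) z = pd (ei i) v z + pd (ei i) (\<lambda>z. w z + ?w' z) z"
      and w: "\<forall>i\<in>UNIV. pd (ei i) (\<lambda>z. w (?f z)) z = pd (ei i) w z + pd (ei i) ?w' z"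
      and vw: "\<forall>i\<in>UNIV. pd (ei i) (\<lambda>z. w z + ?w' z) z = pd (ei i) w z + pd (ei i) ?w' z"
      and cu: "\<forall>i\<in>UNIV. pd (ei i) (\<lambda>z. u (?f z)) z = chain f i z u (?f z)"
      and cv: "\<forall>i\<in>UNIV. pd (ei i) (\<lambda>z. v (?f z)) z = chain f i z v (?f z)"
      and cw: "\<forall>i\<in>UNIV. pd (ei i) (\<lambda>z. w (?f z)) z = chain f i z w (?f z)"
      and dt: "det (\<chi> i j. pd (ei j) (\<lambda>z. f z $ i) z) = 1"
    have 1: "jac3 (\<lambda>z. u (?f z)) (\<lambda>z. v (?f z)) (\<lambda>z. w (?f z)) z = det (\<chi> i j. pd (ei j) (\<lambda>z. f z $ i) z) * jac3 u v w (?f z)"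
      unfolding jac3_def cu[rule_format, OF UNIV_I] cv[rule_format, OF UNIV_I] cw[rule_format, OF UNIV_I] chain_def det_3 vec_lambda_beta
      by algebra
    have 2: "jac3 (\<lambda>z. u (?f z)) (\<lambda>z. v (?f z)) (\<lambda>z. w (?f z)) z = jac3 u v w z + jac3 u v ?w' z"
      unfolding jac3_def u[rule_format, OF UNIV_I] v[rule_format, OF UNIV_I] w[rule_format, OF UNIV_I] vw[rule_format, OF UNIV_I]
      by algebra
    show "jac3 u v ?w' z = jac3 u v w (?f z) - jac3 u v w z"
      using 1 2 dt by simp
  qed
qed

subsection \<open>Error estimates\<close>

lemma smooth_family_germ:
  fixes F :: "real^3 \<Rightarrow> real^'m::finite \<Rightarrow> real^3"
  assumes "smooth_on U (\<lambda>z. F (fst z) (snd z))" "(0, 0) \<in> U"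
  shows "germ (\<lambda>z. F (fst z) (snd z) $ i)"
    "eventually (\<lambda>z. z \<in> U \<and> (\<forall>j. jacobian (\<lambda>\<xi>'. F \<xi>' (snd z)) (at (fst z)) $ i $ j = pd (ei j) (\<lambda>z. F (fst z) (snd z) $ i) z)) (nhds 0)"
proof -
  have U: "open U" "0 \<in> U" using smooth_on_open[OF assms(1)] assms(2) by (simp_all add: zero_prod_def)
  show "germ (\<lambda>z. F (fst z) (snd z) $ i)"
    using smooth_on_inner[OF assms(1), of "axis i 1"] U(2) by (auto simp: inner_axis intro: germI)
  show "eventually (\<lambda>z. z \<in> U \<and> (\<forall>j. jacobian (\<lambda>\<xi>'. F \<xi>' (snd z)) (at (fst z)) $ i $ j = pd (ei j) (\<lambda>z. F (fst z) (snd z) $ i) z)) (nhds 0)"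
  proof (rule eventually_mono[OF eventually_nhds_in_open[OF U]], intro conjI allI)
    fix z :: "'m space" and j assume z: "z \<in> U"
    show "jacobian (\<lambda>\<xi>'. F \<xi>' (snd z)) (at (fst z)) $ i $ j = pd (ei j) (\<lambda>z. F (fst z) (snd z) $ i) z"
      using jacobian_nth[of "\<lambda>z. F (fst z) (snd z)" "fst z" "snd z" i j] smooth_on_differentiable[OF assms(1) z] by simp
  qed
qed

lemma frechet_derivative_fst:
  fixes f :: "'m::finite space \<Rightarrow> real^3"
  assumes d: "f differentiable (at 0)" and B: "\<And>i j. pd (ei j) (\<lambda>z. f z $ i) 0 = B $ i $ j"
  shows "frechet_derivative f (at 0) (w, 0) = B *v w"
proof -
  have "(\<lambda>z. f z $ i) differentiable (at 0)" for i
    using bounded_linear.has_derivative[OF bounded_linear_vec_nth d[unfolded frechet_derivative_works]]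
    by (rule differentiableI)
  then show ?thesis
    by (simp add: vec_eq_iff frechet_derivative_nth[OF d] pd_fst B mat_vector_3 algebra_simps)
qed

context coordinates
begin

lemma \<phi>_jacobian:
  assumes "normalizing V \<phi> W \<epsilon> \<mu>1 \<mu>2 P p"
  shows "eventually (\<lambda>y. \<forall>i w. (jacobian (\<lambda>\<eta>'. \<phi> \<eta>' (snd y)) (at (fst y)) *v w) $ i =
    w $ 1 * pd (ei 1) (\<lambda>z. \<phi> (fst z) (snd z) $ i) y + w $ 2 * pd (ei 2) (\<lambda>z. \<phi> (fst z) (snd z) $ i) y
      + w $ 3 * pd (ei 3) (\<lambda>z. \<phi> (fst z) (snd z) $ i) y) (nhds 0)"
proof -
  have V: "smooth_on V (\<lambda>z. \<phi> (fst z) (snd z))" "(0, 0) \<in> V" using assms unfolding normalizing_def by blast+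
  have "eventually (\<lambda>z. \<forall>i\<in>UNIV. z \<in> V \<and> (\<forall>j. jacobian (\<lambda>\<xi>'. \<phi> \<xi>' (snd z)) (at (fst z)) $ i $ j =
      pd (ei j) (\<lambda>z. \<phi> (fst z) (snd z) $ i) z)) (nhds 0)"
    by (intro eventually_ball_finite finite ballI smooth_family_germ V)
  then show ?thesis by (rule eventually_mono) (simp add: mat_vector_3 mult.commute)
qed

text \<open>Differentiating \<open>\<phi> \<circ> \<Psi> = shear\<close> along the field gives the
  derivative of \<open>\<phi>\<close> applied to \<open>(v, w, \<Theta>)\<close>. The error splits
  into \<open>F\<close> at sheared minus original points, the Lie derivative of
  \<open>shear - id\<close>, and the dependence of \<open>a\<close> on the third coordinate, each of
  order \<open>Suc K\<close>.\<close>

lemma lie_error: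
  fixes F :: "real^3 \<Rightarrow> real^'m \<Rightarrow> real^3"
  assumes st: "straightened K \<Theta> V \<phi> W \<epsilon> \<mu>1 \<mu>2 P p a h A3"
    and F: "\<And>i. germ (\<lambda>z. F (fst z) (snd z) $ i)" "F 0 0 = 0"
    and so: "shift_operator (\<lambda>u z. pd (F (fst z) (snd z), 0) u z) s M ex ey ez"
    and uv: "(\<lambda>z. pd (F (fst z) (snd z), 0) u z) \<doteq> v" "(\<lambda>z. pd (F (fst z) (snd z), 0) v z) \<doteq> w"
      "\<Theta> = (\<lambda>z. pd (F (fst z) (snd z), 0) w z)"
  shows "flat (Suc K) (\<lambda>y. F (\<phi> (fst y) (snd y)) (snd y) $ i -
     (fst y $ 2 * pd (ei 1) (\<lambda>z. \<phi> (fst z) (snd z) $ i) y + fst y $ 3 * pd (ei 2) (\<lambda>z. \<phi> (fst z) (snd z) $ i) y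
      + a (mk3 (fst y $ 1) (fst y $ 2) 0, snd y) * pd (ei 3) (\<lambda>z. \<phi> (fst z) (snd z) $ i) y))" (is "flat _ ?e")
proof (rule flat_pull_back[OF st])
  interpret so: shift_operator "\<lambda>u z. pd (F (fst z) (snd z), 0) u z" s M ex ey ez by (rule so)
  let ?\<phi> = "\<lambda>z. \<phi> (fst z) (snd z) $ i" and ?F = "\<lambda>z. F (fst z) (snd z)"
  let ?\<pi> = "\<lambda>y :: 'm space. (mk3 (fst y $ 1) (fst y $ 2) 0, snd y)"
  let ?A = "\<lambda>z. shear A3 z $ i"
  have gA: "germ ?A" by (rule germ_shear[OF st])
  have g\<phi>: "germ ?\<phi>" by (rule germ_\<phi>[OF st])
  let ?e1 = "\<lambda>x. F (shear A3 x) (snd x) $ i - F (fst x) (snd x) $ i"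
  let ?e2 = "\<lambda>x. pd (?F x, 0) (\<lambda>z. ?A z - fst z $ i) x"
  let ?e3 = "\<lambda>x. (a (\<Psi> x) - a (?\<pi> (\<Psi> x))) * pd (ei 3) ?\<phi> (\<Psi> x)"
  have "flat (Suc K) (\<lambda>x. ?e1 x - ?e2 x + ?e3 x)"
  proof -
    have 1: "flat (Suc K) ?e1" using flat_compose_shear[OF st F(1)] by simp
    have 2: "flat (Suc K) ?e2" by (rule so.D_flat[OF flat_shear[OF st]])
    have 3: "flat (Suc K) (\<lambda>x. a (\<Psi> x) - a (?\<pi> (\<Psi> x)))"
      by (rule flat_compose[OF st_flat[OF st] germ_\<Psi> \<Psi>_0])
    have 4: "germ (\<lambda>x. pd (ei 3) ?\<phi> (\<Psi> x))"
      by (rule germ_compose[OF germ_pd[OF g\<phi>] germ_\<Psi> \<Psi>_0])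
    show ?thesis by (rule flat_add[OF flat_diff[OF 1 2] flat_mult_right[OF 3 4]])
  qed
  moreover have "(\<lambda>x. ?e1 x - ?e2 x + ?e3 x) \<doteq> (\<lambda>x. ?e (\<Psi> x))"
  proof -
    have "\<forall>\<^sub>F x in nhds 0. ((\<forall>\<^sub>F x' in nhds x. \<phi> (fst (\<Psi> x')) (snd (\<Psi> x')) = shear A3 x') \<and>
        h (\<Psi> x) = x \<and> ?\<phi> differentiable (at (\<Psi> x))) \<and>
        (?A differentiable (at x) \<and> u differentiable (at x) \<and> v differentiable (at x) \<and> w differentiable (at x)) \<and>
        (\<lambda>z::'m space. fst z $ i) differentiable (at x) \<and>
        (pd (?F x, 0) u x = v x \<and> pd (?F x, 0) v x = w x)"
      using \<phi>_\<Psi>[OF st]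
      by (intro eventually_conj st_inv(2)[OF st] germ_differentiable gA germs germ_fst_nth uv
           eventually_compose_germ[OF germ_\<Psi> \<Psi>_0 germ_differentiable[OF g\<phi>]]) (simp add: eventually_eventually)
    then show ?thesis
    proof (rule eventually_mono, elim conjE)
      fix x
      assume near: "\<forall>\<^sub>F x' in nhds x. \<phi> (fst (\<Psi> x')) (snd (\<Psi> x')) = shear A3 x'" and hx: "h (\<Psi> x) = x"
        and d\<phi>: "?\<phi> differentiable (at (\<Psi> x))" and dA: "?A differentiable (at x)"
        and d: "u differentiable (at x)" "v differentiable (at x)" "w differentiable (at x)"
        and di: "(\<lambda>z::'m space. fst z $ i) differentiable (at x)"
        and uvx: "pd (?F x, 0) u x = v x" "pd (?F x, 0) v x = w x"
      have \<phi>x: "\<phi> (fst (\<Psi> x)) (snd (\<Psi> x)) = shear A3 x" using eventually_nhds_x_imp_x[OF near] .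
      have "pd (?F x, 0) ?A x = pd (?F x, 0) (\<lambda>x. ?\<phi> (\<Psi> x)) x"
        by (rule pd_cong_at, rule eventually_mono[OF near]) simp
      also have "\<dots> = pd (mk3 (v x) (w x) (\<Theta> x), 0) ?\<phi> (\<Psi> x)"
        using pd_eq[OF has_derivative_compose[OF \<Psi>_has_derivative[OF d] has_derivative_pd[OF d\<phi>]], of "(?F x, 0)"]
        by (simp add: uvx uv(3))
      also have "\<dots> = v x * pd (ei 1) ?\<phi> (\<Psi> x) + w x * pd (ei 2) ?\<phi> (\<Psi> x) + \<Theta> x * pd (ei 3) ?\<phi> (\<Psi> x)"
        by (simp add: pd_fst[OF d\<phi>])
      finally have 1: "pd (?F x, 0) ?A x = \<dots>" .
      have 2: "?e2 x = pd (?F x, 0) ?A x - ?F x $ i"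
        by (simp add: pd_diff_at[OF dA di] pd_fst_nth)
      have 3: "snd (\<Psi> x) = snd x" "fst (\<Psi> x) $ 2 = v x" "fst (\<Psi> x) $ 3 = w x" "a (\<Psi> x) = \<Theta> x"
        by (simp_all add: \<Psi>_def st_a(2)[OF st] hx[unfolded \<Psi>_def])
      show "?e1 x - ?e2 x + ?e3 x = ?e (\<Psi> x)"
        unfolding 2 1 using \<phi>x by (simp add: 3 algebra_simps)
    qed
  qed
  ultimately show "flat (Suc K) (\<lambda>x. ?e (\<Psi> x))" by (rule flat_cong)
qed

text \<open>With the full \<open>a\<close> in place of its restriction to the plane, the normal form
  map sends \<open>\<Psi> x\<close> to \<open>\<Psi>\<close> of the image of \<open>x\<close>. What
  remains is the failure of \<open>shear\<close> to commute with the map, flat because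
  \<open>shear\<close> is nearly the identity, plus the effect of restricting
  \<open>a\<close>.\<close>

lemma compose_error:
  fixes f :: "real^3 \<Rightarrow> real^'m \<Rightarrow> real^3"
  assumes st: "straightened K \<Theta> V \<phi> W \<epsilon> \<mu>1 \<mu>2 P p a h A3"
    and f: "\<And>i. germ (\<lambda>z. f (fst z) (snd z) $ i)" "f 0 0 = 0" and \<Theta>: "\<Theta> 0 = 0"
    and uv: "(\<lambda>z. u (f (fst z) (snd z), snd z) - u z) \<doteq> v"
      "(\<lambda>z. v (f (fst z) (snd z), snd z) - v z) \<doteq> (\<lambda>z. w z + 1 * (w (f (fst z) (snd z), snd z) - w z))"
      "\<Theta> = (\<lambda>z. w (f (fst z) (snd z), snd z) - w z)"
  shows "flat (Suc K) (\<lambda>y. f (\<phi> (fst y) (snd y)) (snd y) $ i -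
     \<phi> ((mat 1 + N3) *v (fst y + a (mk3 (fst y $ 1) (fst y $ 2) 0, snd y) *\<^sub>R e3)) (snd y) $ i)" (is "flat _ ?e")
proof -
  let ?\<phi> = "\<lambda>z. \<phi> (fst z) (snd z) $ i" and ?f = "\<lambda>z. f (fst z) (snd z)"
  let ?\<pi> = "\<lambda>y :: 'm space. (mk3 (fst y $ 1) (fst y $ 2) 0, snd y)"
  let ?G = "\<lambda>b y. (mat 1 + N3) *v (fst y + b y *\<^sub>R e3)"
  let ?b = "\<lambda>y. a (?\<pi> y)"
  have "germ (\<lambda>y :: 'm space. mk3 (fst y $ 1) (fst y $ 2) 0 $ k)" for k
    using exhaust_3[of k] by (auto simp: germ_fst_nth)
  from germ_Pair_snd(1)[OF this] have p1: "germ (\<lambda>y. ?\<pi> y \<bullet> j)" for j .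
  have p2: "?\<pi> 0 = 0" by (simp add: zero_prod_def)
  note p = p1 p2
  have gb: "germ ?b" by (rule germ_compose[OF st_a(1)[OF st] p])
  have a0: "a 0 = 0" by (simp add: st_a(2)[OF st] st_h(2)[OF st] \<Theta>)
  have gG: "germ (\<lambda>y. ?G c y $ k)" if "germ c" for c :: "'m space \<Rightarrow> real" and k
    using exhaust_3[of k] that
    by (elim disjE; simp only: J3_normal_form mk3_nth) (intro germ_add germ_fst_nth that)+
  have G0: "(?G c 0, snd (0 :: 'm space)) = 0" if "c 0 = 0" for c :: "'m space \<Rightarrow> real"
    using that by (simp add: zero_prod_def)
  have fG: "flat (Suc K) (\<lambda>y. ?G a y $ k - ?G ?b y $ k)" for k
    using exhaust_3[of k] st_flat[OF st]
    by (elim disjE; simp only: J3_normal_form mk3_nth) (simp_all del: flat.simps(2))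
  have f2: "flat (Suc K) (\<lambda>y. ?\<phi> (?G a y, snd y) - ?\<phi> (?G ?b y, snd y))"
  proof -
    have b0: "?b 0 = 0" by (simp only: p(2) a0)
    show ?thesis
      by (rule flat_compose_diff[where u = ?\<phi> and g = "\<lambda>y. (?G a y, snd y)" and h = "\<lambda>y. (?G ?b y, snd y)",
          OF germ_Pair_snd(1)[OF gG[OF st_a(1)[OF st]]] G0[of a, OF a0]
          germ_Pair_snd(1)[OF gG[OF gb]] G0[of ?b, OF b0] flat_Pair_diff[OF fG] germ_\<phi>[OF st]])
  qed
  have fj: "germ (\<lambda>z. (?f z, snd z) \<bullet> j)" for j by (rule germ_Pair_snd(1)[OF f(1)])
  have f0: "(?f 0, snd 0) = (0 :: 'm space)" using f(2) by (simp add: zero_prod_def)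
  have f1: "flat (Suc K) (\<lambda>y. f (\<phi> (fst y) (snd y)) (snd y) $ i - ?\<phi> (?G a y, snd y))" (is "flat _ ?e'")
  proof (rule flat_pull_back[OF st])
    let ?e1 = "\<lambda>x. f (shear A3 x) (snd x) $ i - ?f x $ i"
    let ?e2 = "\<lambda>x. shear A3 (?f x, snd x) $ i - fst (?f x, snd x) $ i"
    have "flat (Suc K) (\<lambda>x. ?e1 x - ?e2 x)"
    proof (rule flat_diff)
      show "flat (Suc K) ?e1" using flat_compose_shear[OF st f(1)] by simp
      show "flat (Suc K) ?e2" by (rule flat_compose[OF flat_shear[OF st] fj f0])
    qed
    moreover have "(\<lambda>x. ?e1 x - ?e2 x) \<doteq> (\<lambda>x. ?e' (\<Psi> x))"
    proof -
      have "\<forall>\<^sub>F x in nhds 0. (h (\<Psi> x) = x \<and> \<phi> (fst (\<Psi> x)) (snd (\<Psi> x)) = shear A3 x) \<and>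
          \<phi> (fst (\<Psi> (?f x, snd x))) (snd (\<Psi> (?f x, snd x))) = shear A3 (?f x, snd x) \<and>
          (u (?f x, snd x) - u x = v x \<and> v (?f x, snd x) - v x = w x + 1 * (w (?f x, snd x) - w x))"
        by (intro eventually_conj st_inv(2)[OF st] \<phi>_\<Psi>[OF st] uv(1,2) eventually_compose_germ[OF fj f0 \<phi>_\<Psi>[OF st]])
      then show ?thesis
      proof (rule eventually_mono, elim conjE)
        fix x
        assume hx: "h (\<Psi> x) = x" and \<phi>x: "\<phi> (fst (\<Psi> x)) (snd (\<Psi> x)) = shear A3 x"
          and \<phi>f: "\<phi> (fst (\<Psi> (?f x, snd x))) (snd (\<Psi> (?f x, snd x))) = shear A3 (?f x, snd x)"
          and uvx: "u (?f x, snd x) - u x = v x" "v (?f x, snd x) - v x = w x + 1 * (w (?f x, snd x) - w x)"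
        have "a (\<Psi> x) = \<Theta> x" by (simp add: st_a(2)[OF st] hx)
        then have "(?G a (\<Psi> x), snd (\<Psi> x)) = \<Psi> (?f x, snd x)"
          using uvx by (intro prod_eqI) (simp_all add: J3_normal_form \<Psi>_def uv(3) vec_eq_iff forall_3)
        then have "\<phi> (?G a (\<Psi> x)) (snd (\<Psi> x)) = shear A3 (?f x, snd x)"
          using \<phi>f by (metis fst_conv snd_conv)
        then show "?e1 x - ?e2 x = ?e' (\<Psi> x)"
          using \<phi>x by (simp add: \<Psi>_def)
      qed
    qed
    ultimately show "flat (Suc K) (\<lambda>x. ?e' (\<Psi> x))" by (rule flat_cong)
  qed
  from flat_add[OF f1 f2] show ?thesis by simp
qed

end

section \<open>The two normal forms\<close>

lemma vector_field_normal_form: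
  fixes F :: "real^3 \<Rightarrow> real^'m::finite \<Rightarrow> real^3"
  assumes U: "(0, 0) \<in> U" and sF: "smooth_on U (\<lambda>z. F (fst z) (snd z))"
    and div: "\<forall>\<xi> l. (\<xi>, l) \<in> U \<longrightarrow> trace (jacobian (\<lambda>\<xi>'. F \<xi>' l) (at \<xi>)) = 0"
    and F0: "F 0 0 = 0" and N: "jacobian (\<lambda>\<xi>. F \<xi> 0) (at 0) = N3"
  shows "\<exists>V \<phi> W \<epsilon> \<mu>1 \<mu>2 P p. normalizing V \<phi> W \<epsilon> \<mu>1 \<mu>2 P p \<and>
    (\<exists>C \<delta>. \<delta> > 0 \<and> (\<forall>\<eta> l. norm (\<eta>, l) < \<delta> \<longrightarrow>
      norm (F (\<phi> \<eta> l) l - jacobian (\<lambda>\<eta>'. \<phi> \<eta>' l) (at \<eta>) *v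
            (N3 *v \<eta> + (\<epsilon> l + \<mu>1 l * \<eta>$1 + \<mu>2 l * \<eta>$2 + p l (\<eta>$1) (\<eta>$2)) *\<^sub>R e3))
      \<le> C * norm (\<eta>, l) ^ K))"
proof -
  let ?F = "\<lambda>z. F (fst z) (snd z)" and ?D = "\<lambda>u z. pd (F (fst z) (snd z), 0) u z"
  have gF: "germ (\<lambda>z. ?F z $ i)" for i by (rule smooth_family_germ(1)[OF sF U])
  have jF: "\<forall>\<^sub>F z in nhds 0. \<forall>i\<in>UNIV. z \<in> U \<and> (\<forall>j. jacobian (\<lambda>\<xi>'. F \<xi>' (snd z)) (at (fst z)) $ i $ j = pd (ei j) (\<lambda>z. ?F z $ i) z)"
    by (intro eventually_ball_finite finite ballI smooth_family_germ(2)[OF sF U])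
  have V0: "(?F 0, 0) = (0 :: 'm space)" using F0 by (simp add: zero_prod_def)
  let ?M = "frechet_derivative (\<lambda>z. (?F z, 0 :: real^'m)) (at 0)"
  have dF: "?F differentiable (at 0)"
    by (rule eventually_nhds_x_imp_x[OF eventually_differentiable_components[OF gF]])
  have M: "?M d = (frechet_derivative ?F (at 0) d, 0)" for d
  proof -
    have "((\<lambda>z. (?F z, 0 :: real^'m)) has_derivative (\<lambda>d. (frechet_derivative ?F (at 0) d, 0))) (at 0)"
      using dF unfolding frechet_derivative_works by (auto intro!: derivative_eq_intros)
    from fun_cong[OF frechet_derivative_at[OF this], of d] show ?thesis by (rule sym)
  qed
  have "frechet_derivative ?F (at 0) (w, 0) = N3 *v w" for w
    using eventually_nhds_x_imp_x[OF jF] N by (intro frechet_derivative_fst[OF dF]) simp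
  then have Mw: "?M (w, 0) = (mk3 (w $ 2) (w $ 3) 0, 0)" for w by (simp add: M N3_mult)
  have sM: "snd (?M d) = 0" for d by (simp only: M snd_conv)
  \<comment> \<open>The extended field keeps parameters at rest, so \<open>?M\<close> takes values
    in state directions and acts there as \<open>N3\<close>.\<close>
  have so: "shift_operator ?D 0 ?M (ei 1) (ei 2) (ei 3)"
    by (rule shift_operator_lie[OF germ_Pair_snd(2)[OF gF] V0 refl nilpotent_linear_part[OF Mw sM] ei_Basis])
  have div0: "(\<lambda>z. pd (ei 1) (\<lambda>z. ?F z $ 1) z + pd (ei 2) (\<lambda>z. ?F z $ 2) z + pd (ei 3) (\<lambda>z. ?F z $ 3) z) \<doteq> (\<lambda>_. 0)"
  proof (rule eventually_mono[OF jF])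
    fix z assume z: "\<forall>i\<in>UNIV. z \<in> U \<and> (\<forall>j. jacobian (\<lambda>\<xi>'. F \<xi>' (snd z)) (at (fst z)) $ i $ j = pd (ei j) (\<lambda>z. ?F z $ i) z)"
    then show "pd (ei 1) (\<lambda>z. ?F z $ 1) z + pd (ei 2) (\<lambda>z. ?F z $ 2) z + pd (ei 3) (\<lambda>z. ?F z $ 3) z = 0"
      using div[rule_format, of "fst z" "snd z"] by (simp add: trace_def sum_3)
  qed
  have "\<exists>u v w. coordinates u v w \<and> ?D u \<doteq> v \<and> ?D v \<doteq> (\<lambda>z. w z + 0 * ?D w z) \<and>
    (\<exists>V \<phi> W \<epsilon> \<mu>1 \<mu>2 P p a h A3. coordinates.straightened u v w K (?D w) V \<phi> W \<epsilon> \<mu>1 \<mu>2 P p a h A3)"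
    by (rule straightened_coordinates[OF so]) (auto intro!: jac3_lie[OF gF div0])
  then obtain u v w V \<phi> W \<epsilon> \<mu>1 \<mu>2 P p a h A3 where co: "coordinates u v w"
    and uv: "?D u \<doteq> v" "?D v \<doteq> (\<lambda>z. w z + 0 * ?D w z)"
    and st: "coordinates.straightened u v w K (?D w) V \<phi> W \<epsilon> \<mu>1 \<mu>2 P p a h A3"
    by (elim exE conjE) (rule that)
  interpret coordinates u v w by (rule co)
  note nz = st_normalizing[OF st]
  let ?\<phi> = "\<lambda>i z. \<phi> (fst z) (snd z) $ i"
  let ?e = "\<lambda>y. \<chi> i. F (\<phi> (fst y) (snd y)) (snd y) $ i -
     (fst y $ 2 * pd (ei 1) (?\<phi> i) y + fst y $ 3 * pd (ei 2) (?\<phi> i) y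
      + a (mk3 (fst y $ 1) (fst y $ 2) 0, snd y) * pd (ei 3) (?\<phi> i) y)"
  have "flat K (\<lambda>y. ?e y $ i)" for i
    using lie_error[OF st gF F0 so uv(1) _ refl, of i] uv(2) by (simp del: flat.simps add: flat_SucD)
  moreover have "(\<lambda>y. F (\<phi> (fst y) (snd y)) (snd y) - jacobian (\<lambda>\<eta>'. \<phi> \<eta>' (snd y)) (at (fst y)) *v
      (N3 *v fst y + (\<epsilon> (snd y) + \<mu>1 (snd y) * fst y $ 1 + \<mu>2 (snd y) * fst y $ 2 + p (snd y) (fst y $ 1) (fst y $ 2)) *\<^sub>R e3)) \<doteq> ?e"
    using \<phi>_jacobian[OF nz]
    by (rule eventually_mono) (simp add: vec_eq_iff N3_normal_form st_p[OF st])
  ultimately have E: "\<exists>C \<delta>. \<delta> > 0 \<and> (\<forall>\<eta> l. norm (\<eta>, l) < \<delta> \<longrightarrow> norm ((\<lambda>y. F (\<phi> (fst y) (snd y)) (snd y) - jacobian (\<lambda>\<eta>'. \<phi> \<eta>' (snd y)) (at (fst y)) *v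
      (N3 *v fst y + (\<epsilon> (snd y) + \<mu>1 (snd y) * fst y $ 1 + \<mu>2 (snd y) * fst y $ 2 + p (snd y) (fst y $ 1) (fst y $ 2)) *\<^sub>R e3)) (\<eta>, l)) \<le> C * norm (\<eta>, l) ^ K)"
    by (rule flat_vector_bound)
  show ?thesis
    by (intro exI[of _ V] exI[of _ \<phi>] exI[of _ W] exI[of _ \<epsilon>] exI[of _ \<mu>1] exI[of _ \<mu>2] exI[of _ P] exI[of _ p]
        conjI nz E[unfolded fst_conv snd_conv])
qed

text \<open>The instance \<open>s = 1\<close> for the map extended by the identity on parameters.
  Subtracting the identity from its linear part turns \<open>mat 1 + N3\<close> into the same
  nilpotent matrix as in the field case.\<close>

lemma diffeomorphism_normal_form:
  fixes f :: "real^3 \<Rightarrow> real^'m::finite \<Rightarrow> real^3"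
  assumes U: "(0, 0) \<in> U" and sf: "smooth_on U (\<lambda>z. f (fst z) (snd z))"
    and det: "\<forall>\<xi> l. (\<xi>, l) \<in> U \<longrightarrow> det (jacobian (\<lambda>\<xi>'. f \<xi>' l) (at \<xi>)) = 1"
    and f0: "f 0 0 = 0" and N: "jacobian (\<lambda>\<xi>. f \<xi> 0) (at 0) = mat 1 + N3"
  shows "\<exists>V \<phi> W \<epsilon> \<mu>1 \<mu>2 P p. normalizing V \<phi> W \<epsilon> \<mu>1 \<mu>2 P p \<and>
    (\<exists>C \<delta>. \<delta> > 0 \<and> (\<forall>\<eta> l. norm (\<eta>, l) < \<delta> \<longrightarrow>
      norm (f (\<phi> \<eta> l) l -
            \<phi> ((mat 1 + N3) *v
                 (\<eta> + (\<epsilon> l + \<mu>1 l * \<eta>$1 + \<mu>2 l * \<eta>$2 + p l (\<eta>$1) (\<eta>$2)) *\<^sub>R e3)) l)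
      \<le> C * norm (\<eta>, l) ^ K))"
proof -
  let ?f = "\<lambda>z. f (fst z) (snd z)" and ?g = "\<lambda>z. (f (fst z) (snd z), snd z)"
  let ?D = "\<lambda>u z. u (f (fst z) (snd z), snd z) - u z"
  have gf: "germ (\<lambda>z. ?f z $ i)" for i by (rule smooth_family_germ(1)[OF sf U])
  have jf: "\<forall>\<^sub>F z in nhds 0. \<forall>i\<in>UNIV. z \<in> U \<and> (\<forall>j. jacobian (\<lambda>\<xi>'. f \<xi>' (snd z)) (at (fst z)) $ i $ j = pd (ei j) (\<lambda>z. ?f z $ i) z)"
    by (intro eventually_ball_finite finite ballI smooth_family_germ(2)[OF sf U])
  have g0: "?g 0 = 0" using f0 by (simp add: zero_prod_def)
  let ?M = "\<lambda>d. frechet_derivative ?g (at 0) d - d"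
  have df: "?f differentiable (at 0)"
    by (rule eventually_nhds_x_imp_x[OF eventually_differentiable_components[OF gf]])
  have M: "?M d = (frechet_derivative ?f (at 0) d - fst d, 0)" for d
  proof -
    have "(?g has_derivative (\<lambda>d. (frechet_derivative ?f (at 0) d, snd d))) (at 0)"
      using df unfolding frechet_derivative_works by (auto intro!: derivative_eq_intros)
    from fun_cong[OF frechet_derivative_at[OF this], of d]
    have "frechet_derivative ?g (at 0) d = (frechet_derivative ?f (at 0) d, snd d)" by (rule sym)
    then show ?thesis by (simp add: prod_eq_iff)
  qed
  have "frechet_derivative ?f (at 0) (w, 0) = (mat 1 + N3) *v w" for w
    using eventually_nhds_x_imp_x[OF jf] N by (intro frechet_derivative_fst[OF df]) simp
  then have Mw: "?M (w, 0) = (mk3 (w $ 2) (w $ 3) 0, 0)" for w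
    by (simp add: M matrix_vector_mult_add_rdistrib N3_mult)
  have sM: "snd (?M d) = 0" for d by (simp only: M snd_conv)
  have so: "shift_operator ?D 1 ?M (ei 1) (ei 2) (ei 3)"
    by (rule shift_operator_difference[OF germ_Pair_snd(1)[OF gf] g0 refl nilpotent_linear_part[OF Mw sM] ei_Basis])
  have det1: "\<forall>\<^sub>F z in nhds 0. det (\<chi> i j. pd (ei j) (\<lambda>z. ?f z $ i) z) = 1"
  proof (rule eventually_mono[OF jf])
    fix z assume z: "\<forall>i\<in>UNIV. z \<in> U \<and> (\<forall>j. jacobian (\<lambda>\<xi>'. f \<xi>' (snd z)) (at (fst z)) $ i $ j = pd (ei j) (\<lambda>z. ?f z $ i) z)"
    then have "(\<chi> i j. pd (ei j) (\<lambda>z. ?f z $ i) z) = jacobian (\<lambda>\<xi>'. f \<xi>' (snd z)) (at (fst z))"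
      by (simp add: vec_eq_iff)
    then show "det (\<chi> i j. pd (ei j) (\<lambda>z. ?f z $ i) z) = 1"
      using det[rule_format, of "fst z" "snd z"] z by simp
  qed
  have "?f 0 = 0" using f0 by simp
  note jc = jac3_compose[OF gf this det1]
  have "\<exists>u v w. coordinates u v w \<and> ?D u \<doteq> v \<and> ?D v \<doteq> (\<lambda>z. w z + 1 * ?D w z) \<and>
    (\<exists>V \<phi> W \<epsilon> \<mu>1 \<mu>2 P p a h A3. coordinates.straightened u v w K (?D w) V \<phi> W \<epsilon> \<mu>1 \<mu>2 P p a h A3)"
    by (rule straightened_coordinates[OF so]) (simp, rule jc)
  then obtain u v w V \<phi> W \<epsilon> \<mu>1 \<mu>2 P p a h A3 where co: "coordinates u v w"
    and uv: "?D u \<doteq> v" "?D v \<doteq> (\<lambda>z. w z + 1 * ?D w z)"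
    and st: "coordinates.straightened u v w K (?D w) V \<phi> W \<epsilon> \<mu>1 \<mu>2 P p a h A3"
    by (elim exE conjE) (rule that)
  interpret coordinates u v w by (rule co)
  note nz = st_normalizing[OF st]
  have w0: "?D w 0 = 0" using g0 by simp
  let ?e = "\<lambda>y. f (\<phi> (fst y) (snd y)) (snd y) -
     \<phi> ((mat 1 + N3) *v (fst y + a (mk3 (fst y $ 1) (fst y $ 2) 0, snd y) *\<^sub>R e3)) (snd y)"
  have "flat K (\<lambda>y. ?e y $ i)" for i
    using compose_error[OF st gf f0 w0 uv refl, of i, THEN flat_SucD] by (simp del: flat.simps)
  moreover have "(\<lambda>y. f (\<phi> (fst y) (snd y)) (snd y) - \<phi> ((mat 1 + N3) *v (fst y +
      (\<epsilon> (snd y) + \<mu>1 (snd y) * fst y $ 1 + \<mu>2 (snd y) * fst y $ 2 + p (snd y) (fst y $ 1) (fst y $ 2)) *\<^sub>R e3)) (snd y)) \<doteq> ?e"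
    by (simp add: st_p[OF st])
  ultimately have E: "\<exists>C \<delta>. \<delta> > 0 \<and> (\<forall>\<eta> l. norm (\<eta>, l) < \<delta> \<longrightarrow> norm ((\<lambda>y. f (\<phi> (fst y) (snd y)) (snd y) - \<phi> ((mat 1 + N3) *v (fst y +
      (\<epsilon> (snd y) + \<mu>1 (snd y) * fst y $ 1 + \<mu>2 (snd y) * fst y $ 2 + p (snd y) (fst y $ 1) (fst y $ 2)) *\<^sub>R e3)) (snd y)) (\<eta>, l)) \<le> C * norm (\<eta>, l) ^ K)"
    by (rule flat_vector_bound)
  show ?thesis
    by (intro exI[of _ V] exI[of _ \<phi>] exI[of _ W] exI[of _ \<epsilon>] exI[of _ \<mu>1] exI[of _ \<mu>2] exI[of _ P] exI[of _ p]
        conjI nz E[unfolded fst_conv snd_conv])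
qed

theorem theorem3:
  shows
  "(\<forall>(F :: real^3 \<Rightarrow> real^'m::finite \<Rightarrow> real^3) U.
      (0, 0) \<in> U \<and> smooth_on U (\<lambda>z. F (fst z) (snd z)) \<and>
      (\<forall>\<xi> l. (\<xi>, l) \<in> U \<longrightarrow> trace (jacobian (\<lambda>\<xi>'. F \<xi>' l) (at \<xi>)) = 0) \<and>
      F 0 0 = 0 \<and> jacobian (\<lambda>\<xi>. F \<xi> 0) (at 0) = N3
      \<longrightarrow>
      (\<forall>K::nat. \<exists>V (\<phi> :: real^3 \<Rightarrow> real^'m \<Rightarrow> real^3) W (\<epsilon> :: real^'m \<Rightarrow> real) \<mu>1 \<mu>2
          P (p :: real^'m \<Rightarrow> real \<Rightarrow> real \<Rightarrow> real).
         (0, 0) \<in> V \<and> smooth_on V (\<lambda>z. \<phi> (fst z) (snd z)) \<and>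
         \<phi> 0 0 = 0 \<and> jacobian (\<lambda>\<eta>. \<phi> \<eta> 0) (at 0) = mat 1 \<and>
         (\<forall>\<eta> l. (\<eta>, l) \<in> V \<longrightarrow> det (jacobian (\<lambda>\<eta>'. \<phi> \<eta>' l) (at \<eta>)) = 1) \<and>
         0 \<in> W \<and> smooth_on W \<epsilon> \<and> smooth_on W \<mu>1 \<and> smooth_on W \<mu>2 \<and>
         \<epsilon> 0 = 0 \<and> \<mu>1 0 = 0 \<and> \<mu>2 0 = 0 \<and>
         (0, 0, 0) \<in> P \<and> smooth_on P (\<lambda>(l, x, y). p l x y) \<and>
         (\<forall>l. (l, 0, 0) \<in> P \<longrightarrow> p l 0 0 = 0 \<and>
              ((\<lambda>(x, y). p l x y) has_derivative (\<lambda>_. 0)) (at (0, 0))) \<and>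
         (\<exists>C \<delta>. \<delta> > 0 \<and> (\<forall>\<eta> l. norm (\<eta>, l) < \<delta> \<longrightarrow>
            norm (F (\<phi> \<eta> l) l - jacobian (\<lambda>\<eta>'. \<phi> \<eta>' l) (at \<eta>) *v
                  (N3 *v \<eta> + (\<epsilon> l + \<mu>1 l * \<eta>$1 + \<mu>2 l * \<eta>$2 + p l (\<eta>$1) (\<eta>$2)) *\<^sub>R e3))
            \<le> C * norm (\<eta>, l) ^ K))))
   \<and>
   (\<forall>(f :: real^3 \<Rightarrow> real^'m \<Rightarrow> real^3) U.
      (0, 0) \<in> U \<and> smooth_on U (\<lambda>z. f (fst z) (snd z)) \<and>
      (\<forall>\<xi> l. (\<xi>, l) \<in> U \<longrightarrow> det (jacobian (\<lambda>\<xi>'. f \<xi>' l) (at \<xi>)) = 1) \<and>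
      f 0 0 = 0 \<and> jacobian (\<lambda>\<xi>. f \<xi> 0) (at 0) = mat 1 + N3
      \<longrightarrow>
      (\<forall>K::nat. \<exists>V (\<phi> :: real^3 \<Rightarrow> real^'m \<Rightarrow> real^3) W (\<epsilon> :: real^'m \<Rightarrow> real) \<mu>1 \<mu>2
          P (p :: real^'m \<Rightarrow> real \<Rightarrow> real \<Rightarrow> real).
         (0, 0) \<in> V \<and> smooth_on V (\<lambda>z. \<phi> (fst z) (snd z)) \<and>
         \<phi> 0 0 = 0 \<and> jacobian (\<lambda>\<eta>. \<phi> \<eta> 0) (at 0) = mat 1 \<and>
         (\<forall>\<eta> l. (\<eta>, l) \<in> V \<longrightarrow> det (jacobian (\<lambda>\<eta>'. \<phi> \<eta>' l) (at \<eta>)) = 1) \<and>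
         0 \<in> W \<and> smooth_on W \<epsilon> \<and> smooth_on W \<mu>1 \<and> smooth_on W \<mu>2 \<and>
         \<epsilon> 0 = 0 \<and> \<mu>1 0 = 0 \<and> \<mu>2 0 = 0 \<and>
         (0, 0, 0) \<in> P \<and> smooth_on P (\<lambda>(l, x, y). p l x y) \<and>
         (\<forall>l. (l, 0, 0) \<in> P \<longrightarrow> p l 0 0 = 0 \<and>
              ((\<lambda>(x, y). p l x y) has_derivative (\<lambda>_. 0)) (at (0, 0))) \<and>
         (\<exists>C \<delta>. \<delta> > 0 \<and> (\<forall>\<eta> l. norm (\<eta>, l) < \<delta> \<longrightarrow>
            norm (f (\<phi> \<eta> l) l -
                  \<phi> ((mat 1 + N3) *v
                       (\<eta> + (\<epsilon> l + \<mu>1 l * \<eta>$1 + \<mu>2 l * \<eta>$2 + p l (\<eta>$1) (\<eta>$2)) *\<^sub>R e3)) l)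
            \<le> C * norm (\<eta>, l) ^ K))))"
  by (intro conjI allI impI; elim conjE)
    (rule vector_field_normal_form[unfolded normalizing_def conj_assoc]
       diffeomorphism_normal_form[unfolded normalizing_def conj_assoc]; assumption)+

end
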